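(* On an input string $w$ of length $n$ (and any integer parameter $ml\ge 1$), the algorithm findmaxr runs in time $O(n\log n)$.
   Context: Model: integers of value at most $n$ fit in a machine word and arithmetic/comparisons on them, as well as comparisons of alphabet symbols, take $O(1)$ time. Notation: positions of $w$ are $1,\dots,n$, $w[i..j]$ is the substring from $i$ to $j$; the suffix array $r$ of $w$ is the permutation of $\{1,\dots,n\}$ listing the suffixes $w[r[i]..n]$ in increasing lexicographic order; $p$ is its inverse; $LCP[i]$ ($1\le i<n$) is the length of the longest common prefix of $w[r[i]..n]$ and $w[r[i+1]..n]$. Algorithm findmaxr$(w,ml)$: compute $r$ (by the Larsson–Sadakane $O(n\log n)$ suffix sorting algorithm), $p$, and $LCP$ (by the linear-time algorithm of Kasai et al.). Let $S:=\{t\in\{1,\dots,n-1\}: LCP[t]<ml\}\cup\{0,n\}$, stored as a complete binary tree of bits over the universe $\{0,\dots,n+1\}$ (leaf $=1$ iff the element is in $S$, internal node $=1$ iff some child is $1$), supporting insertion, "maximum element of $S$ less than $x$" and "minimum element of $S$ greater than $x$". Process the indices $t\in\{1,\dots,n-1\}$ with $LCP[t]\ge ml$ one at a time in non-decreasing order of $LCP[t]$. For the current index $i$: set $p_i:=\max\{j\in S: j<i\}+1$, $n_i:=\min\{j\in S: j>i\}$, insert $i$ into $S$; if ($p_i=1$ or $LCP[p_i-1]\neq LCP[i]$) and ($n_i=n$ or $LCP[n_i]\neq LCP[i]$) and ($r[p_i]=1$ or $r[n_i]=1$ or $w[r[p_i]-1]\neq w[r[n_i]-1]$ or $p[r[n_i]-1]-p[r[p_i]-1]\neq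 n_i-p_i$), report the maximal repeat as the triple (start index $p_i$ in $r$, length $LCP[i]$, number of occurrences $n_i-p_i+1$), its occurrences being at positions $r[p_i],\dots,r[n_i]$. *)

theory Defs
  imports Complex_Main "HOL-Library.Landau_Symbols" "HOL-Library.Monad_Syntax"
begin

section \<open>A unit-cost random access machine\<close>

text \<open>
  The memory holds the read-only input string, a fixed number of arrays of machine words
  (partial functions on indices, undefined outside the allocated range), and the output stream of
  reported triples.  String positions are \<open>1, \<dots>, n\<close>, as in \<open>w[1..n]\<close>.
\<close>

datatype array =
    SA      \<comment> \<open>suffix array \<open>r\<close>\<close>
  | ISA     \<comment> \<open>its inverse \<open>p\<close>\<close>
  | LCP
  | GRP     \<comment> \<open>suffix sorting: group number of a suffix\<close>
  | LEN     \<comment> \<open>suffix sorting: length of the group starting at an index\<close>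
  | SORTED  \<comment> \<open>suffix sorting: 1 if that group is a run of already sorted suffixes\<close>
  | MARK    \<comment> \<open>suffix sorting: 1 if a group ends at an index\<close>
  | TREE    \<comment> \<open>the bit tree for \<open>S\<close>, children of node \<open>v\<close> are \<open>2 v\<close> and \<open>2 v + 1\<close>\<close>
  | HEAD    \<comment> \<open>bucket sort: first element of a bucket, 0 if empty\<close>
  | NEXT    \<comment> \<open>bucket sort: next element in the same bucket, 0 if none\<close>

record 'a mem =
  inp :: "'a list"
  arr :: "array \<Rightarrow> nat \<Rightarrow> nat option"
  out :: "(nat \<times> nat \<times> nat) list"

text \<open>
  A program maps a memory to a result, a final memory and the number of steps executed, or to
  \<^const>\<open>None\<close> if it fails or does not terminate.
\<close>

type_synonym ('a, 'b) prog = "'a mem \<Rightarrow> ('b \<times> 'a mem \<times> nat) option"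

definition bind_prog :: "('a, 'b) prog \<Rightarrow> ('b \<Rightarrow> ('a, 'c) prog) \<Rightarrow> ('a, 'c) prog" where
  "bind_prog p f = (\<lambda>m. Option.bind (p m) (\<lambda>(x, m1, t1).
     Option.bind (f x m1) (\<lambda>(y, m2, t2). Some (y, m2, t1 + t2))))"

adhoc_overloading Monad_Syntax.bind \<rightleftharpoons> bind_prog

text \<open>
  Cost discipline: every program other than a sequential composition costs at least one step, so
  each executed statement is charged.  Pure expressions occurring in a statement consist of
  boundedly many operations on words (arithmetic, comparison) and of constant-time list operations
  (constructing and matching \<open>[]\<close> and \<open>x # xs\<close>, i.e. allocating and following cells of linked
  lists); everything else (access to arrays and to the string, list lengths, list indexing, ...) is
  programmed.  In particular, symbols can only be compared with each other.
\<close>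

definition ret :: "'b \<Rightarrow> ('a, 'b) prog" where
  "ret x = (\<lambda>m. Some (x, m, 1))"

definition abort :: "('a, 'b) prog" where
  "abort = (\<lambda>m. None)"

definition text_length :: "('a, nat) prog" where
  "text_length = (\<lambda>m. Some (length (inp m), m, 1))"

definition position :: "'a mem \<Rightarrow> nat \<Rightarrow> bool" where
  "position m i \<longleftrightarrow> 1 \<le> i \<and> i \<le> length (inp m)"

definition sym_less :: "nat \<Rightarrow> nat \<Rightarrow> ('a::linorder, bool) prog" where
  "sym_less i j = (\<lambda>m. if position m i \<and> position m j
     then Some (inp m ! (i - 1) < inp m ! (j - 1), m, 1) else None)"

definition sym_eq :: "nat \<Rightarrow> nat \<Rightarrow> ('a::linorder, bool) prog" where
  "sym_eq i j = (\<lambda>m. if position m i \<and> position m j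
     then Some (inp m ! (i - 1) = inp m ! (j - 1), m, 1) else None)"

text \<open>
  Only words of value at most \<open>n + 1\<close> can be stored (\<open>n + 1\<close> is the largest element of the universe
  of the bit tree).  Local variables of the programs below stay in \<open>O(n)\<close>, i.e. fit in \<open>O(1)\<close> words.
\<close>

definition word :: "'a mem \<Rightarrow> nat \<Rightarrow> bool" where
  "word m v \<longleftrightarrow> v \<le> length (inp m) + 1"

definition alloc :: "array \<Rightarrow> nat \<Rightarrow> ('a, unit) prog" where
  "alloc A k = (\<lambda>m. Some ((), m\<lparr>arr := (arr m)(A := (\<lambda>i. if i < k then Some 0 else None))\<rparr>, k + 1))"

definition rd :: "array \<Rightarrow> nat \<Rightarrow> ('a, nat) prog" where
  "rd A i = (\<lambda>m. case arr m A i of None \<Rightarrow> None | Some v \<Rightarrow> Some (v, m, 1))"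

definition wr :: "array \<Rightarrow> nat \<Rightarrow> nat \<Rightarrow> ('a, unit) prog" where
  "wr A i v = (\<lambda>m. if arr m A i \<noteq> None \<and> word m v
     then Some ((), m\<lparr>arr := (arr m)(A := (arr m A)(i := Some v))\<rparr>, 1) else None)"

definition report :: "nat \<times> nat \<times> nat \<Rightarrow> ('a, unit) prog" where
  "report x = (\<lambda>m. Some ((), m\<lparr>out := out m @ [x]\<rparr>, 1))"


lemma bind_prog_mono [partial_function_mono]:
  assumes p: "mono_option (\<lambda>f. p f m)"
    and q: "\<And>x m1. mono_option (\<lambda>f. q f x m1)"
  shows "mono_option (\<lambda>f. bind_prog (p f) (\<lambda>x. q f x) m)"
  unfolding bind_prog_def
  apply (rule bind_mono[OF p])
  apply (clarsimp split: prod.split)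
  apply (rule bind_mono[OF q])
  by (rule option.const_mono)

lemma if_prog_mono [partial_function_mono]:
  assumes "mono_option (\<lambda>f. p f m)" and "mono_option (\<lambda>f. q f m)"
  shows "mono_option (\<lambda>f. (if b then p f else q f) m)"
  using assms by (cases b) simp_all

lemma case_prod_prog_mono [partial_function_mono]:
  assumes "\<And>x y. mono_option (\<lambda>f. p f x y m)"
  shows "mono_option (\<lambda>f. (case z of (x, y) \<Rightarrow> p f x y) m)"
  using assms by (cases z) simp

partial_function (option) while_loop ::
  "('s \<Rightarrow> ('a, bool) prog) \<Rightarrow> ('s \<Rightarrow> ('a, 's) prog) \<Rightarrow> 's \<Rightarrow> ('a, 's) prog" where
  "while_loop b c s m = (do {x \<leftarrow> b s; if x then do {s' \<leftarrow> c s; while_loop b c s'} else ret s}) m"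

definition for_loop :: "nat \<Rightarrow> nat \<Rightarrow> (nat \<Rightarrow> ('a, unit) prog) \<Rightarrow> ('a, unit) prog" where
  "for_loop lo hi body = do {
     _ \<leftarrow> while_loop (\<lambda>i. ret (i \<le> hi)) (\<lambda>i. do {body i; ret (i + 1)}) lo;
     ret ()
   }"

definition and_also :: "('a, bool) prog \<Rightarrow> ('a, bool) prog \<Rightarrow> ('a, bool) prog" where
  "and_also p q = do {x \<leftarrow> p; if x then q else ret False}"

definition or_else :: "('a, bool) prog \<Rightarrow> ('a, bool) prog \<Rightarrow> ('a, bool) prog" where
  "or_else p q = do {x \<leftarrow> p; if x then ret True else q}"


section \<open>Larsson--Sadakane suffix sorting\<close>

text \<open>
  Suffixes are denoted by their starting positions.  The argument \<open>lt\<close> of the sorting programs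
  compares the current sort keys of two suffixes; it is charged at every use.
\<close>

subsection \<open>Lists\<close>

primrec list_length :: "'b list \<Rightarrow> ('a, nat) prog" where
  "list_length [] = ret 0"
| "list_length (x # xs) = do {k \<leftarrow> list_length xs; ret (k + 1)}"

primrec list_nth :: "'b list \<Rightarrow> nat \<Rightarrow> ('a, 'b) prog" where
  "list_nth [] k = abort"
| "list_nth (x # xs) k = (if k = 0 then ret x else do {y \<leftarrow> list_nth xs (k - 1); ret y})"

primrec insert_sorted :: "(nat \<Rightarrow> nat \<Rightarrow> ('a, bool) prog) \<Rightarrow> nat \<Rightarrow> nat list \<Rightarrow> ('a, nat list) prog" where
  "insert_sorted lt x [] = ret [x]"
| "insert_sorted lt x (y # ys) = do {
     b \<leftarrow> lt y x;
     if b then do {zs \<leftarrow> insert_sorted lt x ys; ret (y # zs)} else ret (x # y # ys)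
   }"

primrec insertion_sort :: "(nat \<Rightarrow> nat \<Rightarrow> ('a, bool) prog) \<Rightarrow> nat list \<Rightarrow> ('a, nat list) prog" where
  "insertion_sort lt [] = ret []"
| "insertion_sort lt (x # xs) = do {ys \<leftarrow> insertion_sort lt xs; insert_sorted lt x ys}"

text \<open>Ternary split around the key of \<open>v\<close>.\<close>

primrec ternary_split ::
  "(nat \<Rightarrow> nat \<Rightarrow> ('a, bool) prog) \<Rightarrow> nat \<Rightarrow> nat list
     \<Rightarrow> ('a, nat list \<times> nat list \<times> nat list) prog" where
  "ternary_split lt v [] = ret ([], [], [])"
| "ternary_split lt v (x # xs) = do {
     (ls, es, gs) \<leftarrow> ternary_split lt v xs;
     a \<leftarrow> lt x v;
     if a then ret (x # ls, es, gs)
     else do {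
       b \<leftarrow> lt v x;
       if b then ret (ls, es, x # gs) else ret (ls, x # es, gs)
     }
   }"

text \<open>The linear-time selection algorithm of Blum, Floyd, Pratt, Rivest and Tarjan.\<close>

fun medians_of_five :: "(nat \<Rightarrow> nat \<Rightarrow> ('a, bool) prog) \<Rightarrow> nat list \<Rightarrow> ('a, nat list) prog" where
  "medians_of_five lt (a # b # c # d # e # xs) = do {
     ys \<leftarrow> insertion_sort lt [a, b, c, d, e];
     m \<leftarrow> list_nth ys 2;
     ms \<leftarrow> medians_of_five lt xs;
     ret (m # ms)
   }"
| "medians_of_five lt xs = ret []"

partial_function (option) select ::
  "(nat \<Rightarrow> nat \<Rightarrow> ('a, bool) prog) \<Rightarrow> nat \<Rightarrow> nat list \<Rightarrow> ('a, nat) prog" where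
  "select lt k xs mem = (do {
     l \<leftarrow> list_length xs;
     if l \<le> 5 then do {
       ys \<leftarrow> insertion_sort lt xs;
       list_nth ys k
     } else do {
       ms \<leftarrow> medians_of_five lt xs;
       v \<leftarrow> select lt (l div 5 div 2) ms;
       (ls, es, gs) \<leftarrow> ternary_split lt v xs;
       a \<leftarrow> list_length ls;
       b \<leftarrow> list_length es;
       if k < a then select lt k ls
       else if k < a + b then ret v
       else select lt (k - a - b) gs
     }
   }) mem"

subsection \<open>Ternary-split Quicksort with median pivots\<close>

primrec read_block :: "nat \<Rightarrow> nat \<Rightarrow> ('a, nat list) prog" where
  "read_block f 0 = ret []"
| "read_block f (Suc l) = do {x \<leftarrow> rd SA f; xs \<leftarrow> read_block (f + 1) l; ret (x # xs)}"

primrec write_block :: "nat \<Rightarrow> nat list \<Rightarrow> ('a, unit) prog" where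
  "write_block f [] = ret ()"
| "write_block f (x # xs) = do {wr SA f x; write_block (f + 1) xs}"

text \<open>
  Write the sorted list to \<open>SA\<close> from index \<open>f\<close> on, and mark the last index of each block of suffixes
  with equal keys.
\<close>

partial_function (option) quicksort ::
  "(nat \<Rightarrow> nat \<Rightarrow> ('a, bool) prog) \<Rightarrow> nat \<Rightarrow> nat list \<Rightarrow> ('a, unit) prog" where
  "quicksort lt f xs mem = (if xs = [] then ret () else do {
     l \<leftarrow> list_length xs;
     v \<leftarrow> select lt (l div 2) xs;
     (ls, es, gs) \<leftarrow> ternary_split lt v xs;
     a \<leftarrow> list_length ls;
     b \<leftarrow> list_length es;
     quicksort lt f ls;
     write_block (f + a) es;
     wr MARK (f + a + b - 1) 1;
     quicksort lt (f + a + b) gs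
   }) mem"

subsection \<open>Prefix doubling\<close>

text \<open>Sort each unsorted group, skipping over the runs of sorted suffixes.\<close>

definition sort_groups :: "(nat \<Rightarrow> nat \<Rightarrow> ('a, bool) prog) \<Rightarrow> nat \<Rightarrow> ('a, unit) prog" where
  "sort_groups lt n = do {
     _ \<leftarrow> while_loop (\<lambda>f. ret (f \<le> n)) (\<lambda>f. do {
       l \<leftarrow> rd LEN f;
       s \<leftarrow> rd SORTED f;
       if s = 1 then ret (f + l)
       else do {
         xs \<leftarrow> read_block f l;
         quicksort lt f xs;
         ret (f + l)
       }
     }) 1;
     ret ()
   }"

text \<open>
  In the following programs \<open>s\<close> is the first index of the current run of sorted suffixes, or 0 if
  there is none.
\<close>

definition add_sorted :: "nat \<Rightarrow> nat \<Rightarrow> nat \<Rightarrow> ('a, nat) prog" where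
  "add_sorted s f l = (if s = 0 then do {wr LEN f l; wr SORTED f 1; ret f}
     else do {k \<leftarrow> rd LEN s; wr LEN s (k + l); ret s})"

definition split_group :: "nat \<Rightarrow> nat \<Rightarrow> nat \<Rightarrow> ('a, nat) prog" where
  "split_group f g s = do {
     (_, s') \<leftarrow> while_loop (\<lambda>(j, s). ret (j \<le> g)) (\<lambda>(j, s). do {
       e \<leftarrow> while_loop (\<lambda>e. do {b \<leftarrow> rd MARK e; ret (b = 0)}) (\<lambda>e. ret (e + 1)) j;
       for_loop j e (\<lambda>k. do {x \<leftarrow> rd SA k; wr GRP x e});
       if e = j then do {
         s' \<leftarrow> add_sorted s j 1;
         ret (e + 1, s')
       } else do {
         wr LEN j (e - j + 1);
         wr SORTED j 0;
         ret (e + 1, 0)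
       }
     }) (f, s);
     ret s'
   }"

definition update_groups :: "nat \<Rightarrow> ('a, unit) prog" where
  "update_groups n = do {
     _ \<leftarrow> while_loop (\<lambda>(f, s). ret (f \<le> n)) (\<lambda>(f, s). do {
       l \<leftarrow> rd LEN f;
       d \<leftarrow> rd SORTED f;
       s' \<leftarrow> (if d = 1 then add_sorted s f l else split_group f (f + l - 1) s);
       ret (f + l, s')
     }) (1, 0);
     ret ()
   }"

definition key_less :: "nat \<Rightarrow> nat \<Rightarrow> nat \<Rightarrow> ('a, bool) prog" where
  "key_less h x y = do {a \<leftarrow> rd GRP (x + h); b \<leftarrow> rd GRP (y + h); ret (a < b)}"

text \<open>
  The empty suffix, at position \<open>n + 1\<close>, plays the role of the end marker: its group number
  is 0 throughout.
\<close>

definition suffix_sort :: "nat \<Rightarrow> ('a::linorder, unit) prog" where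
  "suffix_sort n = do {
     alloc SA (n + 2);
     alloc GRP (n + 2);
     alloc LEN (n + 2);
     alloc SORTED (n + 2);
     alloc MARK (n + 2);
     for_loop 1 n (\<lambda>i. wr SA i i);
     wr LEN 1 n;
     wr SORTED 1 (if n \<le> 1 then 1 else 0);
     sort_groups sym_less n;
     update_groups n;
     _ \<leftarrow> while_loop (\<lambda>h. do {l \<leftarrow> rd LEN 1; d \<leftarrow> rd SORTED 1; ret (\<not> (d = 1 \<and> l = n))}) (\<lambda>h. do {
       sort_groups (key_less h) n;
       update_groups n;
       ret (2 * h)
     }) 1;
     ret ()
   }"


section \<open>Inverse of the suffix array and LCP array\<close>

definition invert_suffix_array :: "nat \<Rightarrow> ('a, unit) prog" where
  "invert_suffix_array n = do {
     alloc ISA (n + 2);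
     for_loop 1 n (\<lambda>i. do {x \<leftarrow> rd SA i; wr ISA x i})
   }"

text \<open>
  The algorithm of Kasai et al., with \<open>LCP[i]\<close> referring to the suffixes of ranks \<open>i\<close> and \<open>i + 1\<close>.
\<close>

definition kasai :: "nat \<Rightarrow> ('a::linorder, unit) prog" where
  "kasai n = do {
     alloc LCP (n + 2);
     _ \<leftarrow> while_loop (\<lambda>(i, h). ret (i \<le> n)) (\<lambda>(i, h). do {
       q \<leftarrow> rd ISA i;
       if q < n then do {
         j \<leftarrow> rd SA (q + 1);
         h' \<leftarrow> while_loop (\<lambda>h. if i + h \<le> n \<and> j + h \<le> n then sym_eq (i + h) (j + h) else ret False)
           (\<lambda>h. ret (h + 1)) h;
         wr LCP q h';
         ret (i + 1, if h' > 0 then h' - 1 else 0)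
       } else ret (i + 1, h)
     }) (1, 0);
     ret ()
   }"


section \<open>The set \<open>S\<close> as a bit tree\<close>

text \<open>
  The tree has \<open>N\<close> leaves, where \<open>N\<close> is the least power of two with \<open>N \<ge> n + 2\<close>; the root is
  node 1 and the leaf of \<open>x\<close> is node \<open>N + x\<close>.  Searches climb to the first ancestor having a
  nonempty sibling on the relevant side and then descend into that sibling; they are only used
  when the element sought exists.
\<close>

definition leaf_count :: "nat \<Rightarrow> ('a, nat) prog" where
  "leaf_count n = while_loop (\<lambda>k. ret (k < n + 2)) (\<lambda>k. ret (2 * k)) 1"

definition tree_insert :: "nat \<Rightarrow> nat \<Rightarrow> ('a, unit) prog" where
  "tree_insert N x = do {
     _ \<leftarrow> while_loop (\<lambda>v. ret (v \<ge> 1)) (\<lambda>v. do {wr TREE v 1; ret (v div 2)}) (N + x);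
     ret ()
   }"

text \<open>The greatest element less than \<open>x\<close>.\<close>

definition tree_pred :: "nat \<Rightarrow> nat \<Rightarrow> ('a, nat) prog" where
  "tree_pred N x = do {
     v \<leftarrow> while_loop (\<lambda>v. if odd v then do {b \<leftarrow> rd TREE (v - 1); ret (b = 0)} else ret True)
       (\<lambda>v. ret (v div 2)) (N + x);
     u \<leftarrow> while_loop (\<lambda>u. ret (u < N))
       (\<lambda>u. do {b \<leftarrow> rd TREE (2 * u + 1); ret (if b = 1 then 2 * u + 1 else 2 * u)}) (v - 1);
     ret (u - N)
   }"

text \<open>The least element greater than \<open>x\<close>.\<close>

definition tree_succ :: "nat \<Rightarrow> nat \<Rightarrow> ('a, nat) prog" where
  "tree_succ N x = do {
     v \<leftarrow> while_loop (\<lambda>v. if even v then do {b \<leftarrow> rd TREE (v + 1); ret (b = 0)} else ret True)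
       (\<lambda>v. ret (v div 2)) (N + x);
     u \<leftarrow> while_loop (\<lambda>u. ret (u < N))
       (\<lambda>u. do {b \<leftarrow> rd TREE (2 * u); ret (if b = 1 then 2 * u else 2 * u + 1)}) (v + 1);
     ret (u - N)
   }"


section \<open>The algorithm\<close>

definition left_diverse :: "nat \<Rightarrow> nat \<Rightarrow> ('a::linorder, bool) prog" where
  "left_diverse a b = do {
     x \<leftarrow> rd SA a;
     y \<leftarrow> rd SA b;
     if x = 1 \<or> y = 1 then ret True
     else do {
       e \<leftarrow> sym_eq (x - 1) (y - 1);
       if \<not> e then ret True
       else do {
         q \<leftarrow> rd ISA (y - 1);
         p \<leftarrow> rd ISA (x - 1);
         ret (int q - int p \<noteq> int b - int a)
       }
     }
   }"

definition process_index :: "nat \<Rightarrow> nat \<Rightarrow> nat \<Rightarrow> ('a::linorder, unit) prog" where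
  "process_index N n i = do {
     j \<leftarrow> tree_pred N i;
     a \<leftarrow> ret (j + 1);
     b \<leftarrow> tree_succ N i;
     tree_insert N i;
     k \<leftarrow> rd LCP i;
     c \<leftarrow> and_also
       (or_else (ret (a = 1)) (do {x \<leftarrow> rd LCP (a - 1); ret (x \<noteq> k)}))
       (and_also
         (or_else (ret (b = n)) (do {x \<leftarrow> rd LCP b; ret (x \<noteq> k)}))
         (left_diverse a b));
     if c then report (a, k, b - a + 1) else ret ()
   }"

text \<open>
  The indices \<open>t\<close> with \<open>LCP[t] \<ge> ml\<close> are brought into non-decreasing order of \<open>LCP[t]\<close> by bucket
  sort.
\<close>

definition findmaxr :: "nat \<Rightarrow> ('a::linorder, unit) prog" where
  "findmaxr ml = do {
     n \<leftarrow> text_length;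
     suffix_sort n;
     invert_suffix_array n;
     kasai n;
     N \<leftarrow> leaf_count n;
     alloc TREE (2 * N);
     tree_insert N 0;
     tree_insert N n;
     for_loop 1 (n - 1) (\<lambda>t. do {
       l \<leftarrow> rd LCP t;
       if l < ml then tree_insert N t else ret ()
     });
     alloc HEAD (n + 2);
     alloc NEXT (n + 2);
     for_loop 1 (n - 1) (\<lambda>t. do {
       l \<leftarrow> rd LCP t;
       if l < ml then ret ()
       else do {x \<leftarrow> rd HEAD l; wr NEXT t x; wr HEAD l t}
     });
     for_loop 0 n (\<lambda>l. do {
       t \<leftarrow> rd HEAD l;
       _ \<leftarrow> while_loop (\<lambda>t. ret (t \<noteq> 0)) (\<lambda>t. do {process_index N n t; rd NEXT t}) t;
       ret ()
     })
   }"

definition initial_mem :: "'a list \<Rightarrow> 'a mem" where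
  "initial_mem w = \<lparr>inp = w, arr = (\<lambda>A i. None), out = []\<rparr>"

text \<open>\<open>p\<close>, started in memory \<open>m\<close>, terminates without failure after exactly \<open>t\<close> steps.\<close>

definition halts_after :: "('a, 'b) prog \<Rightarrow> 'a mem \<Rightarrow> nat \<Rightarrow> bool" where
  "halts_after p m t \<longleftrightarrow> (\<exists>x m'. p m = Some (x, m', t))"

end

theory Submission
  imports Defs "HOL-Library.Discrete_Functions" "HOL-Library.Multiset"
begin

text \<open>
  Every pass of the prefix doubling costs linear time plus a multiple of the decrease of the
  potential \<open>\<Sum>x. log |group of x|\<close>: a partition step around the median charges its linear cost to the
  elements that end up in a part of at most half the size, while the elements equal to the pivot are
  charged only once per pass.  As a suffix in a nontrivial group has length at least \<open>h\<close>, and \<open>h\<close> doubles,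
  there are \<open>O(log n)\<close> passes, and suffix sorting takes \<open>O(n log n)\<close> steps.  Kasai's algorithm is linear
  since each iteration decreases the matching length by at most one.  The buckets contain at most \<open>n\<close>
  indices in total, each causing a constant number of searches and insertions along paths of length
  \<open>O(log n)\<close> in the bit tree.  Correctness of the suffix array is never needed, only that its entries
  are positions of the string.
\<close>

section \<open>A program logic with running times\<close>

text \<open>A time bound presupposes that nothing fails: every access must hit an allocated cell,
  every stored word must be at most n + 1, every search must have a target, every loop must end.
  \<open>spec\<close> therefore asserts the existence of a result, and the invariants record what
  safety and cost depend on. The arrays of the sorting phase are mirrored by lists, one per group,
  that occur in no program; loops over groups become inductions over these lists, with
  \<open>mods\<close> framing the segments not being treated. The number of passes depends on the
  data, and the loop test inspects only the entries at index 1. Its termination takes two facts: no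
  unsorted group survives once h exceeds n, and adjacent runs have been merged into one. A single
  pass may exceed linear time; the excess is taken from one potential, at most n log n at the start,
  which telescopes over all passes. In the bit tree, 0 and n are inserted before any search. Full
  paths of ones above these two leaves guarantee that every climb finds a nonempty sibling.\<close>

definition spec :: "('a, 'b) prog \<Rightarrow> 'a mem \<Rightarrow> ('b \<Rightarrow> 'a mem \<Rightarrow> nat \<Rightarrow> bool) \<Rightarrow> bool" where
  "spec p m Q \<longleftrightarrow> (\<exists>x m' t. p m = Some (x, m', t) \<and> Q x m' t)"

definition val :: "'a mem \<Rightarrow> array \<Rightarrow> nat \<Rightarrow> nat" where
  "val m A i = the (arr m A i)"

definition allocated :: "'a mem \<Rightarrow> array \<Rightarrow> nat \<Rightarrow> bool" where
  "allocated m A i \<longleftrightarrow> arr m A i \<noteq> None"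

definition store :: "'a mem \<Rightarrow> array \<Rightarrow> nat \<Rightarrow> nat \<Rightarrow> 'a mem" where
  "store m A i v = m\<lparr>arr := (arr m)(A := (arr m A)(i := Some v))\<rparr>"

definition new_array :: "'a mem \<Rightarrow> array \<Rightarrow> nat \<Rightarrow> 'a mem" where
  "new_array m A k = m\<lparr>arr := (arr m)(A := (\<lambda>i. if i < k then Some 0 else None))\<rparr>"

text \<open>The set X bounds the cells whose value may change, while allocation may only grow. The
  output stream is left free, so a report is covered by \<open>mods {}\<close>; an allocation is not
  covered in general, since it replaces a whole array.\<close>

definition mods :: "(array \<times> nat) set \<Rightarrow> 'a mem \<Rightarrow> 'a mem \<Rightarrow> bool" where
  "mods X m m' \<longleftrightarrow> inp m' = inp m \<and> (\<forall>A i. (A, i) \<notin> X \<longrightarrow> val m' A i = val m A i) \<and>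
     (\<forall>A i. allocated m A i \<longrightarrow> allocated m' A i)"

lemma val_store [simp]: "val (store m A i v) B j = (if A = B \<and> i = j then v else val m B j)"
  by (simp add: val_def store_def)

lemma allocated_store [simp]:
  "allocated (store m A i v) B j \<longleftrightarrow> A = B \<and> i = j \<or> allocated m B j"
  by (auto simp: allocated_def store_def)

lemma inp_store [simp]: "inp (store m A i v) = inp m"
  by (simp add: store_def)

lemma val_new_array [simp]: "j < k \<Longrightarrow> val (new_array m A k) A j = 0"
  by (simp add: val_def new_array_def)

lemma val_new_array_other [simp]: "A \<noteq> B \<Longrightarrow> val (new_array m A k) B j = val m B j"
  by (simp add: val_def new_array_def)

lemma allocated_new_array [simp]:
  "allocated (new_array m A k) B j \<longleftrightarrow> (if A = B then j < k else allocated m B j)"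
  by (auto simp: allocated_def new_array_def)

lemma inp_new_array [simp]: "inp (new_array m A k) = inp m"
  by (simp add: new_array_def)

lemma mods_refl [simp]: "mods X m m"
  by (simp add: mods_def)

lemma mods_trans: "mods X m m1 \<Longrightarrow> mods X m1 m2 \<Longrightarrow> mods X m m2"
  by (auto simp: mods_def)

lemma mods_mono: "mods X m m' \<Longrightarrow> X \<subseteq> Y \<Longrightarrow> mods Y m m'"
  by (auto simp: mods_def)

lemma mods_comp: "mods X m m1 \<Longrightarrow> mods Y m1 m2 \<Longrightarrow> X \<union> Y \<subseteq> Z \<Longrightarrow> mods Z m m2"
  by (rule mods_trans) (auto elim: mods_mono)

lemma mods_store: "(A, i) \<in> X \<Longrightarrow> mods X m (store m A i v)"
  by (auto simp: mods_def)

lemma mods_trans_store: "mods X m m' \<Longrightarrow> (A, i) \<in> X \<Longrightarrow> mods X m (store m' A i v)"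
  by (auto simp: mods_def)

lemma mods_inp: "mods X m m' \<Longrightarrow> inp m' = inp m"
  by (simp add: mods_def)

lemma mods_val: "mods X m m' \<Longrightarrow> (A, i) \<notin> X \<Longrightarrow> val m' A i = val m A i"
  by (simp add: mods_def)

lemma mods_allocated: "mods X m m' \<Longrightarrow> allocated m A i \<Longrightarrow> allocated m' A i"
  by (simp add: mods_def)

section \<open>Rules for the statements of the machine and for loops\<close>

lemma spec_mono: "spec p m P \<Longrightarrow> (\<And>x m' t. P x m' t \<Longrightarrow> Q x m' t) \<Longrightarrow> spec p m Q"
  by (auto simp: spec_def)

lemma spec_unfold: "p m = q m \<Longrightarrow> spec q m Q \<Longrightarrow> spec p m Q"
  by (simp add: spec_def)

text \<open>An equivalence, so that \<open>spec\<close> behaves like a weakest precondition and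
  \<open>simp\<close> executes straight-line code symbolically, the running time accumulating inside
  the postcondition.\<close>

lemma spec_bind [simp]:
  "spec (bind_prog p f) m Q \<longleftrightarrow> spec p m (\<lambda>x m1 t1. spec (f x) m1 (\<lambda>y m2 t2. Q y m2 (t1 + t2)))"
  by (auto simp: spec_def bind_prog_def Option.bind_eq_Some_conv split: prod.splits)

lemma spec_bindI:
  "spec p m P \<Longrightarrow> (\<And>x m1 t1. P x m1 t1 \<Longrightarrow> spec (f x) m1 (\<lambda>y m2 t2. Q y m2 (t1 + t2))) \<Longrightarrow>
    spec (bind_prog p f) m Q"
  by (auto intro: spec_mono)

lemma spec_ret [simp]: "spec (ret x) m Q \<longleftrightarrow> Q x m 1"
  by (simp add: spec_def ret_def)

lemma spec_if [simp]:
  "spec (if b then p else q) m Q \<longleftrightarrow> (b \<longrightarrow> spec p m Q) \<and> (\<not> b \<longrightarrow> spec q m Q)"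
  by simp

lemma spec_ifI:
  "(b \<Longrightarrow> spec p m Q) \<Longrightarrow> (\<not> b \<Longrightarrow> spec q m Q) \<Longrightarrow> spec (if b then p else q) m Q"
  by simp

lemma spec_rd [simp]: "spec (rd A i) m Q \<longleftrightarrow> allocated m A i \<and> Q (val m A i) m 1"
  by (auto simp: spec_def rd_def val_def allocated_def split: option.splits)

lemma spec_wr [simp]:
  "spec (wr A i v) m Q \<longleftrightarrow> allocated m A i \<and> v \<le> length (inp m) + 1 \<and> Q () (store m A i v) 1"
  by (auto simp: spec_def wr_def store_def allocated_def word_def)

lemma spec_alloc [simp]: "spec (alloc A k) m Q \<longleftrightarrow> Q () (new_array m A k) (k + 1)"
  by (simp add: spec_def alloc_def new_array_def)

lemma spec_text_length [simp]: "spec text_length m Q \<longleftrightarrow> Q (length (inp m)) m 1"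
  by (simp add: spec_def text_length_def)

lemma spec_sym_less [simp]:
  "spec (sym_less i j) m Q \<longleftrightarrow> position m i \<and> position m j \<and> Q (inp m ! (i - 1) < inp m ! (j - 1)) m 1"
  by (auto simp: spec_def sym_less_def)

lemma spec_sym_eq [simp]:
  "spec (sym_eq i j) m Q \<longleftrightarrow> position m i \<and> position m j \<and> Q (inp m ! (i - 1) = inp m ! (j - 1)) m 1"
  by (auto simp: spec_def sym_eq_def)

lemma spec_report:
  "(\<And>m'. mods {} m m' \<Longrightarrow> Q () m' 1) \<Longrightarrow> spec (report x) m Q"
  by (auto simp: spec_def report_def mods_def val_def allocated_def)

text \<open>Unfolding once is how loops that walk along a ghost list are treated: the induction runs
  over the list, and each step peels off one iteration. The potential rules for loops rest on it as
  well.\<close>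

lemma spec_while_unfold:
  "spec (while_loop b c s) m Q \<longleftrightarrow> spec (b s) m (\<lambda>x m1 t1.
     if x then spec (c s) m1 (\<lambda>s' m2 t2. spec (while_loop b c s') m2 (\<lambda>r m3 t3. Q r m3 (t1 + t2 + t3)))
     else Q s m1 (t1 + 1))"
proof -
  have "spec (while_loop b c s) m Q \<longleftrightarrow>
      spec (bind_prog (b s) (\<lambda>x. if x then bind_prog (c s) (while_loop b c) else ret s)) m Q"
    by (subst while_loop.simps[abs_def]) (simp add: spec_def while_loop.simps)
  also have "\<dots> \<longleftrightarrow> spec (b s) m (\<lambda>x m1 t1.
     if x then spec (c s) m1 (\<lambda>s' m2 t2. spec (while_loop b c s') m2 (\<lambda>r m3 t3. Q r m3 (t1 + t2 + t3)))
     else Q s m1 (t1 + 1))"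
    by (simp add: if_distrib[of "\<lambda>p. spec p _ _"] add.assoc cong: if_cong)
  finally show ?thesis .
qed

text \<open>The time bound is a potential, so that amortised analyses fit the rule.\<close>

lemma spec_while:
  fixes \<Phi> :: "'s \<Rightarrow> nat"
  assumes "I s m"
    and "\<And>s m. I s m \<Longrightarrow> spec (b s) m (\<lambda>x m1 t1.
      if x then spec (c s) m1 (\<lambda>s' m2 t2. I s' m2 \<and> 0 < t1 + t2 \<and> t1 + t2 + \<Phi> s' \<le> \<Phi> s)
      else Q s m1 \<and> t1 + 1 \<le> \<Phi> s)"
  shows "spec (while_loop b c s) m (\<lambda>s' m' t. Q s' m' \<and> t \<le> \<Phi> s)"
  using assms(1)
proof (induction "\<Phi> s" arbitrary: s m rule: less_induct)
  case less
  show ?case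
    apply (subst spec_while_unfold)
    apply (rule spec_mono[OF assms(2)[OF less.prems]])
    apply (auto split: if_splits)
    apply (erule spec_mono)
    apply (rule spec_mono[OF less.hyps])
    by auto
qed

text \<open>The exit is paid by the constant k instead of the potential, and the unspent
  \<open>\<Phi> s'\<close> stays in the conclusion. An enclosing loop can thus carry it over, which
  is how the inner loop of Kasai's algorithm is accounted for.\<close>

lemma spec_while_amortized:
  fixes \<Phi> :: "'s \<Rightarrow> nat"
  assumes "I s m"
    and "\<And>s m. I s m \<Longrightarrow> spec (b s) m (\<lambda>x m1 t1.
      if x then spec (c s) m1 (\<lambda>s' m2 t2. I s' m2 \<and> 0 < t1 + t2 \<and> t1 + t2 + \<Phi> s' \<le> \<Phi> s)
      else Q s m1 \<and> t1 + 1 \<le> k)"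
  shows "spec (while_loop b c s) m (\<lambda>s' m' t. Q s' m' \<and> t + \<Phi> s' \<le> \<Phi> s + k)"
  using assms(1)
proof (induction "\<Phi> s" arbitrary: s m rule: less_induct)
  case less
  show ?case
    apply (subst spec_while_unfold)
    apply (rule spec_mono[OF assms(2)[OF less.prems]])
    apply (auto split: if_splits)
    apply (erule spec_mono)
    apply (rule spec_mono[OF less.hyps])
    by auto
qed

text \<open>Each round adds 2 to the body for the test and the increment; the final 3 are the last
  test, the \<open>ret\<close> of the loop and the closing \<open>ret ()\<close>. The function P
  lets rounds of uneven cost share a common budget; \<open>lo \<le> Suc hi\<close> makes the exit
  index exactly \<open>Suc hi\<close>.\<close>

lemma spec_for:
  fixes P :: "nat \<Rightarrow> nat"
  assumes "I lo m" "lo \<le> Suc hi"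
    and step: "\<And>i m. lo \<le> i \<Longrightarrow> i \<le> hi \<Longrightarrow> I i m \<Longrightarrow>
      spec (body i) m (\<lambda>_ m' t. I (Suc i) m' \<and> t + P (Suc i) \<le> P i + k)"
  shows "spec (for_loop lo hi body) m (\<lambda>_ m' t. I (Suc hi) m' \<and> t \<le> P lo + (k + 2) * (Suc hi - lo) + 3)"
proof -
  have "spec (while_loop (\<lambda>i. ret (i \<le> hi)) (\<lambda>i. bind_prog (body i) (\<lambda>_. ret (i + 1))) lo) m
    (\<lambda>s m t. I (Suc hi) m \<and> t \<le> P lo + (k + 2) * (Suc hi - lo) + 2)"
    apply (rule spec_while[where I = "\<lambda>i m. lo \<le> i \<and> i \<le> Suc hi \<and> I i m"
        and \<Phi> = "\<lambda>i. P i + (k + 2) * (Suc hi - i) + 2" and Q = "\<lambda>s m. I (Suc hi) m"])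
    using assms(1,2) apply simp
    apply auto
     apply (rule spec_mono[OF step])
        apply auto
     apply (simp add: Suc_diff_le)
    by (metis le_antisym not_less_eq_eq)
  then show ?thesis
    by (auto simp: for_loop_def elim: spec_mono)
qed

lemma spec_for_uniform:
  assumes "I lo m" "lo \<le> Suc hi"
    and "\<And>i m. lo \<le> i \<Longrightarrow> i \<le> hi \<Longrightarrow> I i m \<Longrightarrow> spec (body i) m (\<lambda>_ m' t. I (Suc i) m' \<and> t \<le> k)"
  shows "spec (for_loop lo hi body) m (\<lambda>_ m' t. I (Suc hi) m' \<and> t \<le> (k + 2) * (Suc hi - lo) + 3)"
  using spec_for[of I lo m hi body "\<lambda>_. 0" k] assms by simp

section \<open>Sorting with median pivots\<close>

text \<open>The bound 3 is the cost of \<open>key_less\<close> (two reads and a \<open>ret\<close>);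
  \<open>sym_less\<close> takes a single step. The set U restricts the claim to suffixes whose keys
  can be read without failure.\<close>

definition comparator ::
  "(nat \<Rightarrow> nat \<Rightarrow> ('a, bool) prog) \<Rightarrow> (nat \<Rightarrow> 'k::linorder) \<Rightarrow> nat set \<Rightarrow> 'a mem \<Rightarrow> bool" where
  "comparator lt key U m \<longleftrightarrow>
     (\<forall>x\<in>U. \<forall>y\<in>U. spec (lt x y) m (\<lambda>b m' t. b = (key x < key y) \<and> m' = m \<and> t \<le> 3))"

lemma comparatorD:
  "comparator lt key U m \<Longrightarrow> x \<in> U \<Longrightarrow> y \<in> U \<Longrightarrow>
    spec (lt x y) m (\<lambda>b m' t. b = (key x < key y) \<and> m' = m \<and> t \<le> 3)"
  by (simp add: comparator_def)

lemma comparator_subset: "comparator lt key U m \<Longrightarrow> V \<subseteq> U \<Longrightarrow> comparator lt key V m"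
  by (auto simp: comparator_def)

section \<open>Cost of the list programs\<close>

lemma spec_list_length: "spec (list_length xs) m (\<lambda>l m' t. l = length xs \<and> m' = m \<and> t = length xs + 1)"
proof (induction xs)
  case (Cons x xs)
  show ?case
    by (simp, rule spec_mono[OF Cons.IH]) simp
qed simp

lemma spec_list_nth:
  "k < length xs \<Longrightarrow> spec (list_nth xs k) m (\<lambda>x m' t. x = xs ! k \<and> m' = m \<and> t = k + 1)"
proof (induction xs arbitrary: k)
  case (Cons x xs)
  then show ?case
  proof (cases k)
    case 0
    then show ?thesis by simp
  next
    case (Suc j)
    have "spec (list_nth xs j) m (\<lambda>x m' t. x = xs ! j \<and> m' = m \<and> t = j + 1)"
      using Cons Suc by simp
    then show ?thesis
      using Suc by (auto elim!: spec_mono)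
  qed
qed simp

lemma spec_insert_sorted:
  assumes "comparator lt key U m" "x \<in> U"
  shows "set ys \<subseteq> U \<Longrightarrow> sorted (map key ys) \<Longrightarrow> spec (insert_sorted lt x ys) m
    (\<lambda>zs m' t. m' = m \<and> mset zs = mset (x # ys) \<and> sorted (map key zs) \<and> t \<le> 4 * length ys + 1)"
proof (induction ys)
  case Nil
  then show ?case by simp
next
  case (Cons y ys)
  have eq: "set zs = insert x (set ys)" if "mset zs = add_mset x (mset ys)" for zs
    by (metis that mset.simps(2) list.simps(15) set_mset_mset)
  show ?case
    unfolding insert_sorted.simps
    apply (rule spec_bindI[OF comparatorD[OF assms(1)]])
    using Cons.prems assms(2) apply simp
    using Cons.prems assms(2) apply simp
    apply (elim conjE, hypsubst)
    apply (rule spec_ifI)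
     apply (rule spec_bindI[OF Cons.IH])
    using Cons.prems apply simp
    using Cons.prems apply simp
    using Cons.prems apply (auto simp: eq)
    done
qed

text \<open>A quadratic bound is enough, because every list sorted this way has at most five
  elements.\<close>

lemma spec_insertion_sort:
  assumes "comparator lt key U m"
  shows "set xs \<subseteq> U \<Longrightarrow> spec (insertion_sort lt xs) m
    (\<lambda>zs m' t. m' = m \<and> mset zs = mset xs \<and> sorted (map key zs) \<and> t \<le> 4 * length xs * length xs + length xs + 1)"
proof (induction xs)
  case Nil
  then show ?case by simp
next
  case (Cons x xs)
  have eq: "set zs = set xs \<and> length zs = length xs" if "mset zs = mset xs" for zs
    using mset_eq_setD[OF that] mset_eq_length[OF that] by simp
  show ?case
    apply simp
    apply (rule spec_mono[OF Cons.IH])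
    using Cons.prems apply simp
    apply clarsimp
    apply (rule spec_mono[OF spec_insert_sorted[OF assms]])
    using Cons.prems by (auto dest!: eq simp: algebra_simps)
qed

text \<open>The 7 per element are two comparisons at 3 steps each and one
  \<open>ret\<close>.\<close>

lemma spec_ternary_split:
  assumes "comparator lt key U m" "v \<in> U"
  shows "set xs \<subseteq> U \<Longrightarrow> spec (ternary_split lt v xs) m
    (\<lambda>r m' t. m' = m \<and> r = (filter (\<lambda>x. key x < key v) xs, filter (\<lambda>x. key x = key v) xs,
       filter (\<lambda>x. key v < key x) xs) \<and> t \<le> 7 * length xs + 1)"
proof (induction xs)
  case Nil
  then show ?case by simp
next
  case (Cons x xs)
  show ?case
    unfolding ternary_split.simps
    apply (rule spec_bindI[OF Cons.IH])
    using Cons.prems apply simp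
    apply (elim conjE, hypsubst, unfold prod.case)
    apply (rule spec_bindI[OF comparatorD[OF assms(1)]])
    using Cons.prems apply simp
     apply (rule assms(2))
    apply (elim conjE, hypsubst)
    apply (rule spec_ifI)
     apply force
    apply (rule spec_bindI[OF comparatorD[OF assms(1)]])
      apply (rule assms(2))
    using Cons.prems apply simp
    apply (elim conjE, hypsubst)
    apply (rule spec_ifI)
     apply force
    apply force
    done
qed

lemma length_filter_mset_eq: "mset xs = mset ys \<Longrightarrow> length (filter P xs) = length (filter P ys)"
  by (metis mset_filter size_mset)

text \<open>In a sorted group of five, three elements, the median included, lie on either side;
  hence each median at most u accounts for three elements at most u. Quantifying over all thresholds
  u, before a pivot is known, makes the count additive along the list. Five elements cost 106 + 3 +
  1 steps (sorting, access, \<open>ret\<close>), within 5 * 23.\<close>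

lemma spec_medians_of_five:
  assumes cmp: "comparator lt key U m"
  shows "set xs \<subseteq> U \<Longrightarrow> spec (medians_of_five lt xs) m
    (\<lambda>ms m' t. m' = m \<and> length ms = length xs div 5 \<and> set ms \<subseteq> set xs \<and>
       (\<forall>u. 3 * length (filter (\<lambda>x. key x \<le> u) ms) \<le> length (filter (\<lambda>x. key x \<le> u) xs)) \<and>
       (\<forall>u. 3 * length (filter (\<lambda>x. u \<le> key x) ms) \<le> length (filter (\<lambda>x. u \<le> key x) xs)) \<and>
       t \<le> 23 * length xs + 1)"
  using cmp
proof (induction lt xs rule: medians_of_five.induct)
  case (1 lt a b c d e xs)
  have count: "length (filter (\<lambda>x. P (key x)) ys) = length (filter (\<lambda>x. P (key x)) [a,b,c,d,e])"
    if "mset ys = mset [a,b,c,d,e]" for P ys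
    using that by (rule length_filter_mset_eq)
  have median: "3 * length (filter (\<lambda>x. key x \<le> u) [ys ! 2]) \<le> length (filter (\<lambda>x. key x \<le> u) [a,b,c,d,e])"
    "3 * length (filter (\<lambda>x. u \<le> key x) [ys ! 2]) \<le> length (filter (\<lambda>x. u \<le> key x) [a,b,c,d,e])"
    "ys ! 2 \<in> {a,b,c,d,e}" "2 < length ys"
    if m: "mset ys = mset [a,b,c,d,e]" and s: "sorted (map key ys)" for u ys
  proof -
    have "length ys = 5"
      using mset_eq_length[OF m] by simp
    then obtain y0 y1 y2 y3 y4 where ys: "ys = [y0,y1,y2,y3,y4]"
      by (auto simp: numeral_eq_Suc length_Suc_conv)
    show "3 * length (filter (\<lambda>x. key x \<le> u) [ys ! 2]) \<le> length (filter (\<lambda>x. key x \<le> u) [a,b,c,d,e])"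
      using s unfolding count[OF m, of "\<lambda>x. x \<le> u", symmetric] ys by auto
    show "3 * length (filter (\<lambda>x. u \<le> key x) [ys ! 2]) \<le> length (filter (\<lambda>x. u \<le> key x) [a,b,c,d,e])"
      using s unfolding count[OF m, of "\<lambda>x. u \<le> x", symmetric] ys by auto
    show "ys ! 2 \<in> {a,b,c,d,e}" "2 < length ys"
      using mset_eq_setD[OF m] by (auto simp: ys)
  qed
  show ?case
    unfolding medians_of_five.simps
    apply (rule spec_bindI[OF spec_insertion_sort[OF 1(3)]])
    using 1(2) apply simp
    apply (elim conjE, hypsubst)
    apply (rule spec_bindI[OF spec_list_nth])
     apply (rule median(4), assumption+)
    apply (elim conjE, hypsubst)
    apply (rule spec_bindI[OF 1(1)[OF _ 1(3)]])
    using 1(2) apply simp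
    apply (elim conjE, hypsubst)
    subgoal premises prems for ys _ t1 _ _ _ ms _ t2
    proof -
      have *: "3 * length (filter P (y # ms)) \<le> length (filter P (a # b # c # d # e # xs))"
        if "3 * length (filter P [y]) \<le> length (filter P [a,b,c,d,e])"
          "3 * length (filter P ms) \<le> length (filter P xs)" for P y
      proof -
        have "filter P (y # ms) = filter P [y] @ filter P ms"
          "filter P (a # b # c # d # e # xs) = filter P [a,b,c,d,e] @ filter P xs"
          by simp_all
        then have "length (filter P (y # ms)) = length (filter P [y]) + length (filter P ms)"
          "length (filter P (a # b # c # d # e # xs)) = length (filter P [a,b,c,d,e]) + length (filter P xs)"
          by (simp_all only: length_append)
        then show ?thesis
          using that by linarith
      qed
      show ?thesis
        unfolding spec_ret
        apply (intro conjI allI refl)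
        subgoal using prems(4) by simp
        subgoal using prems(5) median(3)[OF prems(1,2)] by auto
        subgoal by (rule *[OF median(1)[OF prems(1,2)]]) (use prems(6) in blast)
        subgoal by (rule *[OF median(2)[OF prems(1,2)]]) (use prems(7) in blast)
        subgoal using prems(3,8) by simp
        done
    qed
    done
qed auto

section \<open>Ranks in a list and linear-time selection\<close>

lemma sorted_nth_rank:
  assumes "sorted (map key ys)" "k < length ys"
  shows "length (filter (\<lambda>x. key x < key (ys ! k)) ys) \<le> k"
    and "k < length (filter (\<lambda>x. key x \<le> key (ys ! k)) ys)"
proof -
  let ?v = "key (ys ! k)"
  have nth: "key (ys ! i) \<le> key (ys ! j)" if "i \<le> j" "j < length ys" for i j
    using sorted_nth_mono[OF assms(1), of i j] that by simp
  have "filter (\<lambda>x. key x < ?v) (drop k ys) = []"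
    using assms(2) by (auto simp: filter_empty_conv in_set_conv_nth not_less intro!: nth)
  then have "length (filter (\<lambda>x. key x < ?v) ys) = length (filter (\<lambda>x. key x < ?v) (take k ys))"
    by (metis append_take_drop_id filter_append append_Nil2)
  also have "\<dots> \<le> k"
    by (rule order_trans[OF length_filter_le]) simp
  finally show "length (filter (\<lambda>x. key x < ?v) ys) \<le> k" .
  have "filter (\<lambda>x. key x \<le> ?v) (take (Suc k) ys) = take (Suc k) ys"
    using assms(2) by (auto simp: filter_id_conv in_set_conv_nth intro!: nth)
  then have "length (filter (\<lambda>x. key x \<le> ?v) (take (Suc k) ys @ drop (Suc k) ys)) \<ge> Suc k"
    using assms(2) by (simp only: filter_append length_append) simp
  then show "k < length (filter (\<lambda>x. key x \<le> ?v) ys)"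
    by simp
qed

lemma length_filter_split3:
  fixes key :: "'b \<Rightarrow> 'k::linorder"
  shows "length (filter P xs) = length (filter P (filter (\<lambda>x. key x < key v) xs)) +
    length (filter P (filter (\<lambda>x. key x = key v) xs)) + length (filter P (filter (\<lambda>x. key v < key x) xs))"
  by (induction xs) auto

lemma length_split3:
  fixes key :: "'b \<Rightarrow> 'k::linorder"
  shows "length xs = length (filter (\<lambda>x. key x < key v) xs) + length (filter (\<lambda>x. key x = key v) xs) +
    length (filter (\<lambda>x. key v < key x) xs)"
  using length_filter_split3[of "\<lambda>_. True" xs key v] by simp

text \<open>The element of index k in sorted order, counted from 0. With repeated keys a whole
  interval of ranks belongs to one key, hence two inequalities instead of an equation.\<close>

definition rank_of :: "('b \<Rightarrow> 'k::linorder) \<Rightarrow> nat \<Rightarrow> 'b list \<Rightarrow> 'b \<Rightarrow> bool" where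
  "rank_of key k xs v \<longleftrightarrow> v \<in> set xs \<and> length (filter (\<lambda>x. key x < key v) xs) \<le> k \<and>
     k < length (filter (\<lambda>x. key x \<le> key v) xs)"

lemma rank_of_less:
  fixes key :: "'b \<Rightarrow> 'k::linorder"
  assumes "rank_of key k (filter (\<lambda>x. key x < key v) xs) u"
  shows "rank_of key k xs u"
proof -
  have u: "key u < key v" "u \<in> set xs"
    using assms by (auto simp: rank_of_def)
  have "length (filter (\<lambda>x. key x < key u) (filter (\<lambda>x. key x = key v) xs)) = 0"
    "length (filter (\<lambda>x. key x < key u) (filter (\<lambda>x. key v < key x) xs)) = 0"
    unfolding length_0_conv filter_empty_conv using u by auto
  then show ?thesis
    using assms u length_filter_split3[of "\<lambda>x. key x < key u" xs key v]
      length_filter_split3[of "\<lambda>x. key x \<le> key u" xs key v]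
    unfolding rank_of_def by (intro conjI; linarith)
qed

text \<open>The keys of the left and middle parts all lie below that of u, so these parts shift its
  rank by their number of elements; the second assumption keeps the subtractions from being
  truncated.\<close>

lemma rank_of_greater:
  fixes key :: "'b \<Rightarrow> 'k::linorder"
  assumes "rank_of key (k - length (filter (\<lambda>x. key x < key v) xs) - length (filter (\<lambda>x. key x = key v) xs))
    (filter (\<lambda>x. key v < key x) xs) u"
    and "length (filter (\<lambda>x. key x < key v) xs) + length (filter (\<lambda>x. key x = key v) xs) \<le> k"
  shows "rank_of key k xs u"
proof -
  have u: "key v < key u" "u \<in> set xs"
    using assms by (auto simp: rank_of_def)
  have le: "length (filter (\<lambda>x. key x < key u) (filter (\<lambda>x. key x < key v) xs)) \<le> length (filter (\<lambda>x. key x < key v) xs)"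
    "length (filter (\<lambda>x. key x < key u) (filter (\<lambda>x. key x = key v) xs)) \<le> length (filter (\<lambda>x. key x = key v) xs)"
    by (rule length_filter_le)+
  have eq: "filter (\<lambda>x. key x \<le> key u) (filter (\<lambda>x. key x < key v) xs) = filter (\<lambda>x. key x < key v) xs"
    "filter (\<lambda>x. key x \<le> key u) (filter (\<lambda>x. key x = key v) xs) = filter (\<lambda>x. key x = key v) xs"
    unfolding filter_id_conv using u by auto
  show ?thesis
    using assms u le length_filter_split3[of "\<lambda>x. key x < key u" xs key v]
      length_filter_split3[of "\<lambda>x. key x \<le> key u" xs key v]
    unfolding rank_of_def eq by (intro conjI; linarith)
qed

lemma rank_of_equal:
  fixes key :: "'b \<Rightarrow> 'k::linorder"
  assumes "v \<in> set xs" "length (filter (\<lambda>x. key x < key v) xs) \<le> k"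
    "k < length (filter (\<lambda>x. key x < key v) xs) + length (filter (\<lambda>x. key x = key v) xs)"
  shows "rank_of key k xs v"
proof -
  have eq: "filter (\<lambda>x. key x \<le> key v) (filter (\<lambda>x. key x < key v) xs) = filter (\<lambda>x. key x < key v) xs"
    "filter (\<lambda>x. key x \<le> key v) (filter (\<lambda>x. key x = key v) xs) = filter (\<lambda>x. key x = key v) xs"
    unfolding filter_id_conv by auto
  show ?thesis
    using assms length_filter_split3[of "\<lambda>x. key x \<le> key v" xs key v]
    unfolding rank_of_def eq by (intro conjI; linarith)
qed

text \<open>
  Every median on one side of \<open>v\<close> accounts for three elements on that side, so the recursive call
  misses three tenths of the list.  With \<open>33 l\<close> steps of non-recursive work, \<open>600 l\<close> solves the
  recurrence for the running time of the selection algorithm.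
\<close>

lemma median_of_medians_arith:
  fixes l a b :: nat
  assumes "3 * (l div 5 - l div 5 div 2) \<le> b" "a + b = l" "5 < l"
  shows "33 * l + 600 * (l div 5) + 600 * a \<le> 600 * l"
proof -
  define q p where "q = l div 5" and "p = q div 2"
  have "l \<le> 5 * q + 4" "1 \<le> q" "2 * p \<le> q"
    using assms(3) unfolding q_def p_def by linarith+
  \<comment> \<open>With b \<ge> 3 (q - p) and 2 p \<le> q, 600 a is at most 600 l - 900 q. What
    remains is 33 l \<le> 300 q, which follows from l \<le> 5 q + 4 \<le> 9 q; this nearly tight
    inequality is where 600 comes from.\<close>
  then show ?thesis
    using assms(1,2) unfolding q_def[symmetric] p_def[symmetric] by linarith
qed

text \<open>Both bounds start from q - q div 2 medians on the respective side of v, where q is their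
  number: at most q div 2 are smaller than v, and at least q div 2 + 1 are at most v.\<close>

lemma median_of_medians_bound:
  fixes key :: "'b \<Rightarrow> 'k::linorder"
  assumes v: "rank_of key (length xs div 5 div 2) ms v" and len: "length ms = length xs div 5"
    and le: "\<And>u. 3 * length (filter (\<lambda>x. key x \<le> u) ms) \<le> length (filter (\<lambda>x. key x \<le> u) xs)"
    and ge: "\<And>u. 3 * length (filter (\<lambda>x. u \<le> key x) ms) \<le> length (filter (\<lambda>x. u \<le> key x) xs)"
    and l: "5 < length xs"
  shows "33 * length xs + 600 * (length xs div 5) + 600 * length (filter (\<lambda>x. key x < key v) xs) \<le> 600 * length xs"
    and "33 * length xs + 600 * (length xs div 5) + 600 * length (filter (\<lambda>x. key v < key x) xs) \<le> 600 * length xs"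
proof -
  let ?n = "length xs" and ?q = "length xs div 5"
  have compl: "length (filter (\<lambda>x. key x < u) zs) + length (filter (\<lambda>x. u \<le> key x) zs) = length zs"
    "length (filter (\<lambda>x. u < key x) zs) + length (filter (\<lambda>x. key x \<le> u) zs) = length zs" for u and zs :: "'b list"
    using sum_length_filter_compl[of "\<lambda>x. key x < u" zs] sum_length_filter_compl[of "\<lambda>x. u < key x" zs]
    by (simp_all add: not_less not_le)
  have "3 * (?q - ?q div 2) \<le> length (filter (\<lambda>x. key v \<le> key x) xs)"
    using v len compl(1)[of "key v" ms] ge[of "key v"] unfolding rank_of_def by linarith
  from median_of_medians_arith[OF this compl(1) l]
  show "33 * ?n + 600 * ?q + 600 * length (filter (\<lambda>x. key x < key v) xs) \<le> 600 * ?n" .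
  have "3 * (?q - ?q div 2) \<le> length (filter (\<lambda>x. key x \<le> key v) xs)"
    using v len le[of "key v"] unfolding rank_of_def by linarith
  from median_of_medians_arith[OF this compl(2) l]
  show "33 * ?n + 600 * ?q + 600 * length (filter (\<lambda>x. key v < key x) xs) \<le> 600 * ?n" .
qed

text \<open>For l > 5 the work outside the recursive calls is at most 32 l + 6 \<le> 33 l: the
  medians cost 23 l, the split 7 l, the computed lengths 2 l. Both recursive lists are shorter, the
  outer parts because they miss the pivot. For lists of up to five elements, 4 l^2 \<le> 20
  l.\<close>

lemma spec_select:
  assumes cmp: "comparator lt key U m"
  shows "set xs \<subseteq> U \<Longrightarrow> k < length xs \<Longrightarrow>
    spec (select lt k xs) m (\<lambda>v m' t. m' = m \<and> rank_of key k xs v \<and> t \<le> 600 * length xs)"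
proof (induction "length xs" arbitrary: k xs rule: less_induct)
  case less
  let ?ls = "\<lambda>v. filter (\<lambda>x. key x < key v) xs" and ?es = "\<lambda>v. filter (\<lambda>x. key x = key v) xs"
    and ?gs = "\<lambda>v. filter (\<lambda>x. key v < key x) xs"
  show ?case
    apply (subst ext[where f = "select lt k xs", OF select.simps])
    apply (rule spec_bindI[OF spec_list_length])
    apply (elim conjE, hypsubst)
    apply (rule spec_ifI)
    subgoal
      apply (rule spec_bindI[OF spec_insertion_sort[OF cmp less.prems(1)]])
      apply (elim conjE, hypsubst)
      apply (rule spec_mono[OF spec_list_nth])
      using less.prems(2) apply (metis mset_eq_length)
      apply (elim conjE, hypsubst)
      subgoal premises prems for ys _ t1
      proof -
        have "4 * length xs * length xs \<le> 20 * length xs"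
          using prems(1) by (intro mult_le_mono1) simp
        then have "length xs + 1 + (t1 + (k + 1)) \<le> 600 * length xs"
          using prems(4) less.prems(2) by linarith
        then show ?thesis
          using sorted_nth_rank[of key ys k] less.prems(2) mset_eq_length[of ys xs] mset_eq_setD[of ys xs]
            length_filter_mset_eq[of ys xs] nth_mem[of k ys] prems
          by (simp add: rank_of_def)
      qed
      done
    subgoal
      apply (rule spec_bindI[OF spec_medians_of_five[OF cmp less.prems(1)]])
      apply (elim conjE, hypsubst)
      apply (rule spec_bindI[OF less.hyps])
         apply simp
      using less.prems(1) apply simp
       apply simp
      apply (elim conjE, hypsubst)
      apply (rule spec_bindI[OF spec_ternary_split[OF cmp _ less.prems(1)]])
      using less.prems(1) apply (auto simp: rank_of_def)[1]
      apply (elim conjE, hypsubst, unfold prod.case)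
      apply (rule spec_bindI[OF spec_list_length])
      apply (elim conjE, hypsubst)
      apply (rule spec_bindI[OF spec_list_length])
      apply (elim conjE, hypsubst)
      subgoal premises prems for ms _ t1 v _ t2 _ _ t3
      proof -
        note bound = median_of_medians_bound[OF prems(7,2) prems(4)[rule_format] prems(5)[rule_format]]
        have split: "length xs = length (?ls v) + length (?es v) + length (?gs v)"
          by (rule length_split3)
        have v: "v \<in> set xs"
          using prems(3,7) by (auto simp: rank_of_def)
        have pos: "0 < length (?es v)"
          using v by (auto simp: length_greater_0_conv filter_empty_conv simp del: length_greater_0_conv)
        have time: "t1 \<le> 23 * length xs + 1" "t2 \<le> 600 * (length xs div 5)" "t3 \<le> 7 * length xs + 1" "6 \<le> length xs"
          using prems by simp_all
        show ?thesis
          apply (rule spec_ifI)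
          subgoal
            apply (rule spec_mono[OF less.hyps])
            subgoal using split pos by linarith
            subgoal using less.prems(1) by auto
            subgoal .
            subgoal for y m' t'
              using rank_of_less[of key k v xs y] bound(1) split time by (elim conjE, intro conjI) (linarith | simp)+
            done
          apply (rule spec_ifI)
          subgoal
            unfolding spec_ret
            using rank_of_equal[OF v, of key k] bound(1) split time by (intro conjI) (linarith | simp)+
          subgoal
            apply (rule spec_mono[OF less.hyps])
            subgoal using split pos by linarith
            subgoal using less.prems(1) by auto
            subgoal using split less.prems(2) by linarith
            subgoal for y m' t'
              using rank_of_greater[of key k v xs y] bound(2) split time by (elim conjE, intro conjI) (linarith | simp)+
            done
          done
      qed
      done
    done
qed

section \<open>Blocks of equal keys and the cost of Quicksort\<close>

definition pot :: "'b list list \<Rightarrow> nat" where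
  "pot bs = (\<Sum>b\<leftarrow>bs. length b * floor_log (length b))"

lemma pot_simps [simp]:
  "pot [] = 0"
  "pot (b # bs) = length b * floor_log (length b) + pot bs"
  "pot (bs @ cs) = pot bs + pot cs"
  by (simp_all add: pot_def)

text \<open>The marks are what \<open>split_group\<close> later reads to recover the block ends. The
  formula for the last index presupposes nonempty blocks, hence the companion
  \<open>[] \<notin> set bs\<close>.\<close>

primrec blocks_at :: "'a mem \<Rightarrow> nat \<Rightarrow> nat list list \<Rightarrow> bool" where
  "blocks_at m f [] \<longleftrightarrow> True"
| "blocks_at m f (b # bs) \<longleftrightarrow>
     (\<forall>i<length b. val m SA (f + i) = b ! i) \<and>
     (\<forall>i. Suc i < length b \<longrightarrow> val m MARK (f + i) = 0) \<and>
     val m MARK (f + length b - 1) = 1 \<and> blocks_at m (f + length b) bs"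

lemma blocks_at_append:
  "blocks_at m f (bs @ cs) \<longleftrightarrow> blocks_at m f bs \<and> blocks_at m (f + length (concat bs)) cs"
  by (induction bs arbitrary: f) (auto simp: add.assoc)

lemma blocks_at_cong:
  assumes "[] \<notin> set bs"
    and "\<And>i. f \<le> i \<Longrightarrow> i < f + length (concat bs) \<Longrightarrow> val m' SA i = val m SA i \<and> val m' MARK i = val m MARK i"
  shows "blocks_at m f bs \<Longrightarrow> blocks_at m' f bs"
  using assms
proof (induction bs arbitrary: f)
  case (Cons b bs)
  have "blocks_at m' (f + length b) bs"
    by (rule Cons.IH) (use Cons.prems in auto)
  moreover obtain k where "length b = Suc k"
    using Cons.prems(2) by (cases b) auto
  ultimately show ?case
    using Cons.prems(1) Cons.prems(3)[of "f + _"] by auto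
qed simp

lemma blocks_at_mods:
  assumes "blocks_at m f bs" "[] \<notin> set bs" "mods X m m'"
    and "\<And>i. f \<le> i \<Longrightarrow> i < f + length (concat bs) \<Longrightarrow> (SA, i) \<notin> X \<and> (MARK, i) \<notin> X"
  shows "blocks_at m' f bs"
  by (rule blocks_at_cong[OF assms(2) _ assms(1)]) (use assms(3,4) in \<open>auto simp: mods_val\<close>)

lemma spec_read_block:
  "(\<And>i. i < length xs \<Longrightarrow> allocated m SA (f + i) \<and> val m SA (f + i) = xs ! i) \<Longrightarrow>
    spec (read_block f (length xs)) m (\<lambda>ys m' t. ys = xs \<and> m' = m \<and> t = 2 * length xs + 1)"
proof (induction xs arbitrary: f)
  case (Cons x xs)
  have *: "spec (read_block (Suc f) (length xs)) m (\<lambda>ys m' t. ys = xs \<and> m' = m \<and> t = 2 * length xs + 1)"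
  proof (rule Cons.IH)
    fix i assume "i < length xs"
    then show "allocated m SA (Suc f + i) \<and> val m SA (Suc f + i) = xs ! i"
      using Cons.prems[of "Suc i"] by simp
  qed
  show ?case
    using Cons.prems[of 0] by (simp, intro spec_mono[OF *]) simp
qed simp

lemma spec_write_block:
  "(\<And>i. f \<le> i \<Longrightarrow> i < f + length xs \<Longrightarrow> allocated m SA i) \<Longrightarrow> set xs \<subseteq> {..length (inp m) + 1} \<Longrightarrow>
    spec (write_block f xs) m (\<lambda>_ m' t. mods ({SA} \<times> {f..<f + length xs}) m m' \<and>
      (\<forall>i<length xs. val m' SA (f + i) = xs ! i) \<and> t = length xs + 1)"
proof (induction xs arbitrary: f m)
  case (Cons x xs)
  show ?case
    using Cons.prems
    apply (simp del: One_nat_def)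
    apply (rule spec_mono[OF Cons.IH])
      apply simp
     apply simp
    subgoal for _ m' t
      apply (intro conjI allI impI)
      subgoal
        by (rule mods_comp[OF mods_store[of SA f "{(SA, f)}"]]) auto
      subgoal for i
        by (cases i) (auto simp: mods_val)
      subgoal by simp
      done
    done
qed simp

text \<open>An outer part has k \<le> l / 2 elements, so 1 + floor_log k \<le> floor_log l for k >
  0, and its bound k (1 + floor_log k) fits into k floor_log l. The three parts together then leave
  l units of l (1 + floor_log l) free, and 630 l pays for the 612 l + 6 local steps: 600 l for the
  pivot, 7 l for the split, the rest for lengths and writing.\<close>

lemma quicksort_time:
  fixes l a b c :: nat
  assumes "l = a + b + c" "1 \<le> b" "2 * a \<le> l" "2 * c \<le> l"
    and "t1 + 630 * pl \<le> 630 * (a * (1 + floor_log a)) + 1"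
    and "t2 + 630 * pr \<le> 630 * (c * (1 + floor_log c)) + 1"
    and "t \<le> 612 * l + 6"
  shows "t + t1 + t2 + 630 * (pl + (b * floor_log b + pr)) \<le> 630 * (l * (1 + floor_log l)) + 1"
proof -
  have half: "k * (1 + floor_log k) \<le> k * floor_log l" if "2 * k \<le> l" for k
  proof (cases "k = 0")
    case False
    then have "1 + floor_log k = floor_log (2 * k)"
      by simp
    also have "\<dots> \<le> floor_log l"
      using that by (rule floor_log_le_iff)
    finally show ?thesis
      by (rule mult_le_mono2)
  qed simp
  have "b * floor_log b \<le> b * floor_log l"
    using assms(1) by (intro mult_le_mono2 floor_log_le_iff) simp
  moreover have "l * (1 + floor_log l) = l + a * floor_log l + b * floor_log l + c * floor_log l"
    by (simp add: assms(1) algebra_simps)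
  moreover note half[OF assms(3)] half[OF assms(4)]
  moreover have arith: "t + t1 + t2 + 630 * (pl + (B + pr)) \<le> 630 * L + 1"
    if "B \<le> y" "L = l + x + y + z" "A \<le> x" "C \<le> z" "t1 + 630 * pl \<le> 630 * A + 1" "t2 + 630 * pr \<le> 630 * C + 1"
    for A B C L x y z
    using that assms(1,2,7) by simp
  ultimately show ?thesis
    using assms(5,6) by (intro arith)
qed

text \<open>Only block ends are ever marked, so the marks inside the segment must be 0 beforehand;
  the last index is exempt because a block ends there in any case. The comparator is assumed for
  every memory reachable by writes to \<open>SA\<close> and \<open>MARK\<close>, which keeps it
  usable in the recursive calls. The potential left in the blocks is credited in the time
  bound.\<close>

lemma spec_quicksort:
  assumes cmp: "\<And>m'. mods ({SA, MARK} \<times> UNIV) m m' \<Longrightarrow> comparator lt key U m'"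
    and "set xs \<subseteq> U" "set xs \<subseteq> {..length (inp m) + 1}"
    and "\<And>i. f \<le> i \<Longrightarrow> i < f + length xs \<Longrightarrow> allocated m SA i \<and> allocated m MARK i"
    and "\<And>i. f \<le> i \<Longrightarrow> Suc i < f + length xs \<Longrightarrow> val m MARK i = 0"
  shows "spec (quicksort lt f xs) m (\<lambda>_ m' t. mods ({SA, MARK} \<times> {f..<f + length xs}) m m' \<and>
    (\<exists>bs. mset (concat bs) = mset xs \<and> [] \<notin> set bs \<and>
       (\<forall>b\<in>set bs. \<forall>x\<in>set b. \<forall>y\<in>set b. key x = key y) \<and> blocks_at m' f bs \<and>
       t + 630 * pot bs \<le> 630 * (length xs * (1 + floor_log (length xs))) + 1))"
  using assms
proof (induction "length xs" arbitrary: f xs m rule: less_induct)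
  case less
  note cmp = less.prems(1)
  show ?case
  proof (cases "xs = []")
    case True
    have "quicksort lt f xs m = ret () m"
      by (subst quicksort.simps) (simp add: True)
    then show ?thesis
      by (intro spec_unfold[of "quicksort lt f xs" m "ret ()"]) (auto simp: True intro: exI[of _ "[]"])
  next
    case False
    let ?ls = "\<lambda>v. filter (\<lambda>x. key x < key v) xs" and ?es = "\<lambda>v. filter (\<lambda>x. key x = key v) xs"
      and ?gs = "\<lambda>v. filter (\<lambda>x. key v < key x) xs"
    show ?thesis
      apply (subst ext[where f = "quicksort lt f xs", OF quicksort.simps])
      apply (rule spec_ifI)
      using False apply simp
      apply (rule spec_bindI[OF spec_list_length])
      apply (elim conjE, hypsubst)
      apply (rule spec_bindI[OF spec_select[OF cmp less.prems(2)]])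
        apply simp
      using False apply simp
      apply (elim conjE, hypsubst)
      apply (rule spec_bindI[OF spec_ternary_split[OF cmp _ less.prems(2)]])
        apply simp
      using less.prems(2) apply (auto simp: rank_of_def)[1]
      apply (elim conjE, hypsubst, unfold prod.case)
      apply (rule spec_bindI[OF spec_list_length])
      apply (elim conjE, hypsubst)
      apply (rule spec_bindI[OF spec_list_length])
      apply (elim conjE, hypsubst)
      subgoal premises prems for _ _ _ v _ t1 _ _ t2
      proof -
        let ?a = "length (?ls v)" and ?b = "length (?es v)" and ?c = "length (?gs v)"
        have split: "length xs = ?a + ?b + ?c"
          by (rule length_split3)
        have v: "v \<in> set xs"
          using prems(2) by (simp add: rank_of_def)
        have pos: "0 < ?b"
          using v by (auto simp: length_greater_0_conv filter_empty_conv simp del: length_greater_0_conv)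
        \<comment> \<open>The pivot has rank l div 2: at most l div 2 keys are smaller, and more
          than l div 2 keys are at most its own, which leaves at most l div 2 greater ones.\<close>
        have half: "2 * ?a \<le> length xs" "2 * ?c \<le> length xs"
          using prems(2) sum_length_filter_compl[of "\<lambda>x. key x \<le> key v" xs]
          unfolding rank_of_def not_le by linarith+
        show ?thesis
          apply (rule spec_bindI[OF less.hyps])
          subgoal using split pos by linarith
          subgoal by (rule cmp)
          subgoal using less.prems(2) by auto
          subgoal using less.prems(3) by auto
          subgoal using less.prems(4) split by auto
          subgoal using less.prems(5) split by auto
          apply (elim conjE exE)
          subgoal for _ m1 t3 bl
            apply (rule spec_bindI[OF spec_write_block])
            subgoal for i using less.prems(4)[of i] split mods_allocated[of _ m m1 SA i] by auto
            subgoal using less.prems(3) mods_inp[of _ m m1] by auto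
            apply (elim conjE, unfold spec_bind spec_wr)
            subgoal for _ m2 t4
              apply (intro conjI)
              subgoal premises q
              proof -
                have "allocated m MARK (f + ?a + ?b - 1)"
                  using less.prems(4)[of "f + ?a + ?b - 1"] split pos by linarith
                then show ?thesis
                  by (intro mods_allocated[OF q(7)] mods_allocated[OF q(1)])
              qed
              subgoal by simp
              subgoal premises q
              proof -
                let ?m3 = "store m2 MARK (f + ?a + ?b - 1) 1"
                have m1m3: "mods ({SA, MARK} \<times> {f + ?a..<f + ?a + ?b}) m1 ?m3"
                  using q(7) pos by (intro mods_trans_store) (auto simp del: length_greater_0_conv elim: mods_mono)
                have mm3: "mods ({SA, MARK} \<times> {f..<f + ?a + ?b}) m ?m3"
                  by (rule mods_comp[OF q(1) m1m3]) auto
                show ?thesis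
                  apply (rule spec_mono[OF less.hyps])
                  subgoal using split pos by linarith
                  subgoal for m'
                    by (rule cmp, rule mods_comp[OF mm3]) auto
                  subgoal using less.prems(2) by auto
                  subgoal using less.prems(3) mods_inp[OF mm3] by auto
                  subgoal for i using less.prems(4)[of i] split mods_allocated[OF mm3, of SA i]
                    mods_allocated[OF mm3, of MARK i] by auto
                  subgoal for i using less.prems(5)[of i] split mods_val[OF mm3, of MARK i] by auto
                  apply (elim conjE exE)
                  subgoal premises r for _ m4 t5 br
                  proof (intro conjI exI)
                    have m3m4: "mods ({SA, MARK} \<times> {f + ?a + ?b..<f + length xs}) ?m3 m4"
                      by (rule mods_mono[OF r(1)]) (use split in auto)
                    show "mods ({SA, MARK} \<times> {f..<f + length xs}) m m4"
                      by (rule mods_comp[OF mm3 m3m4]) (use split in auto)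
                    show "mset (concat (bl @ [?es v] @ br)) = mset xs"
                    proof -
                      have "mset (?ls v) + mset (?es v) + mset (?gs v) = mset xs"
                        by (induction xs) auto
                      then show ?thesis
                        using q(2) r(2) by (simp add: add.assoc)
                    qed
                    show "[] \<notin> set (bl @ [?es v] @ br)"
                      using q(3) r(3) pos by auto
                    show "\<forall>b\<in>set (bl @ [?es v] @ br). \<forall>x\<in>set b. \<forall>y\<in>set b. key x = key y"
                      using q(4) r(4) by auto
                    have la: "length (concat bl) = ?a"
                      using mset_eq_length[OF q(2)] .
                    show "blocks_at m4 f (bl @ [?es v] @ br)"
                      unfolding blocks_at_append la
                    proof (intro conjI)
                      show "blocks_at m4 f bl"
                      proof (rule blocks_at_mods[OF q(5,3)])
                        show "mods ({SA, MARK} \<times> {f + ?a..<f + length xs}) m1 m4"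
                          by (rule mods_comp[OF m1m3 m3m4]) (use split in auto)
                      qed (use la in auto)
                      have SA: "val m4 SA (f + ?a + i) = ?es v ! i" if "i < ?b" for i
                        using q(8) that by (simp add: mods_val[OF m3m4])
                      have MARK0: "val m4 MARK (f + ?a + i) = 0" if "Suc i < ?b" for i
                        using less.prems(5)[of "f + ?a + i"] that split
                        by (simp add: mods_val[OF m3m4] mods_val[OF q(7)] mods_val[OF q(1)])
                      have MARK1: "val m4 MARK (f + ?a + ?b - 1) = 1"
                      proof -
                        have "f + ?a + ?b - 1 < f + ?a + ?b"
                          using pos by linarith
                        then have "val m4 MARK (f + ?a + ?b - 1) = val ?m3 MARK (f + ?a + ?b - 1)"
                          by (intro mods_val[OF m3m4]) simp
                        then show ?thesis
                          by simp
                      qed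
                      show "blocks_at m4 (f + ?a) [?es v]"
                        using SA MARK0 MARK1 by simp
                      show "blocks_at m4 (f + ?a + length (concat [?es v])) br"
                        using r(5) by simp
                    qed
                    show "length xs + 1 + (t1 + (t2 + (?a + 1 + (?b + 1 + (t3 + (t4 + (1 + t5))))))) + 630 * pot (bl @ [?es v] @ br)
                      \<le> 630 * (length xs * (1 + floor_log (length xs))) + 1"
                      using quicksort_time[OF split _ half q(6) r(6), of "length xs + t1 + t2 + ?a + ?b + t4 + 4"]
                        prems(3,4) pos split q(9)
                      by (simp add: algebra_simps del: length_greater_0_conv)
                  qed
                  done
              qed
              done
            done
          done
      qed
      done
  qed
qed

section \<open>Prefix doubling\<close>

text \<open>
  An item \<open>(d, xs)\<close> describes a segment \<open>xs\<close> of the suffix array: a run of sorted suffixes if \<open>d\<close>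
  holds, an unsorted group otherwise.  The flag \<open>E\<close> tells whether the group numbers of the unsorted
  groups are already correct; they are not before the first sorting pass.
\<close>

type_synonym items = "(bool \<times> nat list) list"

text \<open>Group numbers follow Larsson and Sadakane: the last index of the group, which for a
  sorted suffix is its own index. Inside an unsorted group the marks are 0, as
  \<open>spec_quicksort\<close> expects; the mark at its last index may be left over from the pass
  that created it.\<close>

fun items_at :: "bool \<Rightarrow> 'a mem \<Rightarrow> nat \<Rightarrow> items \<Rightarrow> bool" where
  "items_at E m f [] \<longleftrightarrow> True"
| "items_at E m f ((d, xs) # its) \<longleftrightarrow>
     xs \<noteq> [] \<and> val m LEN f = length xs \<and> val m SORTED f = (if d then 1 else 0) \<and>
     (\<forall>i<length xs. val m SA (f + i) = xs ! i) \<and>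
     (if d then \<forall>i<length xs. val m GRP (xs ! i) = f + i
      else (\<forall>i. Suc i < length xs \<longrightarrow> val m MARK (f + i) = 0) \<and>
        (E \<longrightarrow> (\<forall>x\<in>set xs. val m GRP x = f + length xs - 1))) \<and>
     items_at E m (f + length xs) its"

definition elems :: "items \<Rightarrow> nat list" where
  "elems its = concat (map snd its)"

lemma elems_simps [simp]:
  "elems [] = []"
  "elems (it # its) = snd it @ elems its"
  "elems (its @ its') = elems its @ elems its'"
  by (simp_all add: elems_def)

text \<open>Items after a sorting pass, with each unsorted group split into blocks of equal keys.\<close>

type_synonym pieces = "(bool \<times> nat list list) list"

text \<open>A run is carried along as a single block, so that \<open>concat\<close> yields the
  elements in both cases. The group numbers of split groups are left open: they are outdated until
  \<open>update_groups\<close> has run.\<close>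

fun pieces_at :: "'a mem \<Rightarrow> nat \<Rightarrow> pieces \<Rightarrow> bool" where
  "pieces_at m f [] \<longleftrightarrow> True"
| "pieces_at m f ((d, bs) # ps) \<longleftrightarrow>
     concat bs \<noteq> [] \<and> [] \<notin> set bs \<and> val m LEN f = length (concat bs) \<and>
     val m SORTED f = (if d then 1 else 0) \<and>
     (if d then \<exists>xs. bs = [xs] \<and> (\<forall>i<length xs. val m SA (f + i) = xs ! i \<and> val m GRP (xs ! i) = f + i)
      else blocks_at m f bs) \<and>
     pieces_at m (f + length (concat bs)) ps"

definition piece_elems :: "pieces \<Rightarrow> nat list" where
  "piece_elems ps = concat (map (concat \<circ> snd) ps)"

lemma piece_elems_simps [simp]:
  "piece_elems [] = []"
  "piece_elems (p # ps) = concat (snd p) @ piece_elems ps"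
  by (simp_all add: piece_elems_def)

lemma items_at_append:
  "items_at E m f (its @ its') \<longleftrightarrow> items_at E m f its \<and> items_at E m (f + length (elems its)) its'"
  by (induction E m f its rule: items_at.induct) (auto simp: add.assoc)

text \<open>\<open>SA\<close>, \<open>LEN\<close>, \<open>SORTED\<close> and \<open>MARK\<close> are
  addressed by array index but \<open>GRP\<close> by suffix, hence two separate conditions.\<close>

lemma items_at_cong:
  assumes "\<And>i. f \<le> i \<Longrightarrow> i < f + length (elems its) \<Longrightarrow>
      val m' SA i = val m SA i \<and> val m' LEN i = val m LEN i \<and> val m' SORTED i = val m SORTED i \<and>
      val m' MARK i = val m MARK i"
    and "\<And>x. x \<in> set (elems its) \<Longrightarrow> val m' GRP x = val m GRP x"
  shows "items_at E m f its \<Longrightarrow> items_at E m' f its"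
  using assms
proof (induction E m f its rule: items_at.induct)
  case (2 E m f d xs its)
  have "items_at E m' (f + length xs) its"
    by (rule 2(1)) (use 2(2-4) in auto)
  moreover have "0 < length xs"
    using 2(2) by simp
  ultimately show ?case
    using 2(2) 2(3)[of f] 2(3)[of "f + _"] 2(4) by auto
qed simp

lemma pieces_at_cong:
  assumes "\<And>i. f \<le> i \<Longrightarrow> i < f + length (piece_elems ps) \<Longrightarrow>
      val m' SA i = val m SA i \<and> val m' LEN i = val m LEN i \<and> val m' SORTED i = val m SORTED i \<and>
      val m' MARK i = val m MARK i"
    and "\<And>x. x \<in> set (piece_elems ps) \<Longrightarrow> val m' GRP x = val m GRP x"
  shows "pieces_at m f ps \<Longrightarrow> pieces_at m' f ps"
  using assms
proof (induction m f ps rule: pieces_at.induct)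
  case (2 m f d bs ps)
  have "pieces_at m' (f + length (concat bs)) ps"
    by (rule 2(1)) (use 2(2-4) in auto)
  moreover have "0 < length (concat bs)"
    using 2(2) by (simp del: length_concat)
  moreover have "blocks_at m f bs \<Longrightarrow> blocks_at m' f bs"
    by (rule blocks_at_cong) (use 2(2) 2(3) in \<open>auto simp del: length_concat\<close>)
  ultimately show ?case
    using 2(2) 2(3)[of f] 2(3)[of "f + _"] 2(4) by (auto simp del: length_concat)
qed simp

lemma items_at_mods:
  assumes "items_at E m f its" "mods X m m'"
    and "\<And>i A. f \<le> i \<Longrightarrow> i < f + length (elems its) \<Longrightarrow> A \<noteq> GRP \<Longrightarrow> (A, i) \<notin> X"
    and "\<And>x. x \<in> set (elems its) \<Longrightarrow> (GRP, x) \<notin> X"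
  shows "items_at E m' f its"
  by (rule items_at_cong[OF _ _ assms(1)]) (use assms(2-4) in \<open>auto simp: mods_val\<close>)

lemma pieces_at_mods:
  assumes "pieces_at m f ps" "mods X m m'"
    and "\<And>i A. f \<le> i \<Longrightarrow> i < f + length (piece_elems ps) \<Longrightarrow> A \<noteq> GRP \<Longrightarrow> (A, i) \<notin> X"
    and "\<And>x. x \<in> set (piece_elems ps) \<Longrightarrow> (GRP, x) \<notin> X"
  shows "pieces_at m' f ps"
  by (rule pieces_at_cong[OF _ _ assms(1)]) (use assms(2-4) in \<open>auto simp: mods_val\<close>)

subsection \<open>Sorting the groups\<close>

text \<open>A suffix inside a run is a group of its own, with logarithm 0, whatever the length of
  the run.\<close>

definition item_pot :: "items \<Rightarrow> nat" where
  "item_pot its = (\<Sum>(d, xs)\<leftarrow>its. if d then 0 else length xs * floor_log (length xs))"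

definition piece_pot :: "pieces \<Rightarrow> nat" where
  "piece_pot ps = (\<Sum>(d, bs)\<leftarrow>ps. if d then 0 else pot bs)"

lemma item_pot_simps [simp]:
  "item_pot [] = 0"
  "item_pot ((d, xs) # its) = (if d then 0 else length xs * floor_log (length xs)) + item_pot its"
  "item_pot (its @ its') = item_pot its + item_pot its'"
  by (simp_all add: item_pot_def)

lemma piece_pot_simps [simp]:
  "piece_pot [] = 0"
  "piece_pot ((d, bs) # ps) = (if d then 0 else pot bs) + piece_pot ps"
  by (simp_all add: piece_pot_def)

definition splits :: "(nat \<Rightarrow> 'k) \<Rightarrow> bool \<times> nat list \<Rightarrow> bool \<times> nat list list \<Rightarrow> bool" where
  "splits key it p \<longleftrightarrow> fst p = fst it \<and> mset (concat (snd p)) = mset (snd it) \<and>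
     (if fst it then snd p = [snd it]
      else \<forall>b\<in>set (snd p). \<forall>x\<in>set b. \<forall>y\<in>set b. key x = key y)"

definition suffix_sort_arrays :: "nat \<Rightarrow> 'a mem \<Rightarrow> bool" where
  "suffix_sort_arrays n m \<longleftrightarrow> length (inp m) = n \<and>
     (\<forall>A\<in>{SA, GRP, LEN, SORTED, MARK}. \<forall>i\<le>n + 1. allocated m A i)"

lemma suffix_sort_arrays_mods: "suffix_sort_arrays n m \<Longrightarrow> mods X m m' \<Longrightarrow> suffix_sort_arrays n m'"
  by (auto simp: suffix_sort_arrays_def mods_inp mods_allocated)

lemma suffix_sort_arraysD:
  assumes "suffix_sort_arrays n m"
  shows "length (inp m) = n" "A \<in> {SA, GRP, LEN, SORTED, MARK} \<Longrightarrow> i \<le> n + 1 \<Longrightarrow> allocated m A i"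
  using assms by (auto simp: suffix_sort_arrays_def)

text \<open>Induction over the items from index f on. Apart from the released potential, an unsorted
  item of length l takes at most 632 l + 6 steps: 630 l is the linear part of the Quicksort bound, 2
  l the reading; with l \<ge> 1 this is below 640 l. The comparator is demanded on unsorted items,
  whose keys are known to lie in range.\<close>

lemma spec_sort_groups_loop:
  assumes "\<And>m'. mods ({SA, MARK} \<times> UNIV) m m' \<Longrightarrow>
      comparator lt key (\<Union>(d, xs)\<in>set its. if d then {} else set xs) m'"
    and "suffix_sort_arrays n m" "items_at E m f its"
    and "f + length (elems its) = n + 1" "set (elems its) \<subseteq> {..n + 1}"
  shows "spec (while_loop (\<lambda>f. ret (f \<le> n)) (\<lambda>f. do {
       l \<leftarrow> rd LEN f;
       s \<leftarrow> rd SORTED f;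
       if s = 1 then ret (f + l)
       else do {
         xs \<leftarrow> read_block f l;
         quicksort lt f xs;
         ret (f + l)
       }
     }) f) m (\<lambda>_ m' t. mods ({SA, MARK} \<times> {f..<f + length (elems its)}) m m' \<and>
       (\<exists>ps. list_all2 (splits key) its ps \<and> pieces_at m' f ps \<and>
         t + 630 * piece_pot ps \<le> 630 * item_pot its + 640 * length (elems its) + 2))"
    (is "spec (while_loop ?b ?c f) m _")
  using assms
proof (induction its arbitrary: f m)
  case Nil
  then show ?case
    by (subst spec_while_unfold) auto
next
  case (Cons it its)
  obtain d xs where it: "it = (d, xs)"
    by (cases it)
  note cmp = Cons.prems(1) and arrays = Cons.prems(2)
  have xs: "xs \<noteq> []" "val m LEN f = length xs" "val m SORTED f = (if d then 1 else 0)"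
    "\<And>i. i < length xs \<Longrightarrow> val m SA (f + i) = xs ! i" and rest: "items_at E m (f + length xs) its"
    using Cons.prems(3) by (auto simp: it)
  have marks: "val m MARK (f + i) = 0" if "\<not> d" "Suc i < length xs" for i
    using Cons.prems(3) that by (simp add: it)
  have len: "0 < length xs"
    using xs(1) by simp
  have sum: "f + length xs + length (elems its) = n + 1"
    using Cons.prems(4) by (simp add: it)
  have f: "f \<le> n" "f + length xs \<le> n + 1" "f \<le> Suc n"
    using sum len by linarith+
  note alloc = suffix_sort_arraysD(2)[OF arrays]
  have IH: "spec (while_loop ?b ?c (f + length xs)) m1 (\<lambda>_ m' t.
      mods ({SA, MARK} \<times> {f + length xs..<f + length xs + length (elems its)}) m1 m' \<and>
      (\<exists>ps. list_all2 (splits key) its ps \<and> pieces_at m' (f + length xs) ps \<and>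
        t + 630 * piece_pot ps \<le> 630 * item_pot its + 640 * length (elems its) + 2))"
    if m1: "mods ({SA, MARK} \<times> {f..<f + length xs}) m m1" for m1
  proof (rule Cons.IH)
    show "comparator lt key (\<Union>(d, xs)\<in>set its. if d then {} else set xs) m'"
      if "mods ({SA, MARK} \<times> UNIV) m1 m'" for m'
      using cmp[OF mods_comp[OF m1 that]] by (rule comparator_subset) auto
    show "items_at E m1 (f + length xs) its"
      by (rule items_at_mods[OF rest m1]) auto
  qed (use suffix_sort_arrays_mods[OF arrays m1] Cons.prems(5) sum in \<open>auto simp: it\<close>)
  show ?case
  proof (cases d)
    case True
    have "spec (?c f) m (\<lambda>f' m1 t. f' = f + length xs \<and> m1 = m \<and> t = 3)"
      by (simp add: alloc f xs True)
    then show ?thesis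
      apply (subst spec_while_unfold)
      apply (simp only: spec_ret f if_True)
      apply (erule spec_mono)
      apply (elim conjE, hypsubst)
      apply (rule spec_mono[OF IH])
       apply simp
      apply (elim conjE exE)
      subgoal premises prems for _ _ _ _ m' t ps
      proof (intro conjI exI)
        show "mods ({SA, MARK} \<times> {f..<f + length (elems (it # its))}) m m'"
          by (rule mods_mono[OF prems(1)]) (auto simp: it)
        show "list_all2 (splits key) (it # its) ((d, [xs]) # ps)"
          using prems(2) by (simp add: splits_def True it)
        show "pieces_at m' f ((d, [xs]) # ps)"
          using prems(3) Cons.prems(3) by (auto simp: it True mods_val[OF prems(1)])
        show "1 + 3 + t + 630 * piece_pot ((d, [xs]) # ps)
          \<le> 630 * item_pot (it # its) + 640 * length (elems (it # its)) + 2"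
          using prems(4) len by (simp add: it True del: length_greater_0_conv)
      qed
      done
  next
    case False
    have "spec (?c f) m (\<lambda>f' m1 t. f' = f + length xs \<and> mods ({SA, MARK} \<times> {f..<f + length xs}) m m1 \<and>
      (\<exists>bs. mset (concat bs) = mset xs \<and> [] \<notin> set bs \<and>
         (\<forall>b\<in>set bs. \<forall>x\<in>set b. \<forall>y\<in>set b. key x = key y) \<and> blocks_at m1 f bs \<and>
         t + 630 * pot bs \<le> 632 * length xs + 630 * (length xs * floor_log (length xs)) + 5))"
      apply (simp add: alloc f xs False)
      apply (rule spec_mono[OF spec_read_block])
      subgoal for i using alloc[of SA "f + i"] xs(4)[of i] f by simp
      apply (elim conjE, hypsubst)
      apply (rule spec_mono[OF spec_quicksort[where key = key and
            U = "\<Union>(d, xs)\<in>set (it # its). if d then {} else set xs"]])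
      subgoal by (rule cmp)
      subgoal by (simp add: it False)
      subgoal using Cons.prems(5) suffix_sort_arraysD(1)[OF arrays] by (auto simp: it)
      subgoal for _ _ _ i using alloc[of SA i] alloc[of MARK i] f by simp
      subgoal for _ _ _ i using marks[of "i - f"] False by auto
      apply (elim conjE exE)
      subgoal for _ _ _ _ m1 t bs
        by (intro conjI exI[of _ bs]) (assumption | simp)+
      done
    then show ?thesis
      apply (subst spec_while_unfold)
      apply (simp only: spec_ret f if_True)
      apply (erule spec_mono)
      apply (elim conjE exE, hypsubst)
      apply (rule spec_mono[OF IH])
       apply assumption
      apply (elim conjE exE)
      subgoal premises prems for _ m1 t1 bs _ m' t ps
      proof (intro conjI exI)
        have bs: "length (concat bs) = length xs"
          using mset_eq_length[OF prems(2)] .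
        have ne: "concat bs \<noteq> []"
          using bs xs(1) by (metis length_0_conv)
        show "mods ({SA, MARK} \<times> {f..<f + length (elems (it # its))}) m m'"
          by (rule mods_comp[OF prems(1,7)]) (auto simp: it)
        show "list_all2 (splits key) (it # its) ((d, bs) # ps)"
        proof -
          have "splits key it (d, bs)"
            using prems(2,4) False unfolding splits_def it by (simp only: fst_conv snd_conv if_False simp_thms)
          then show ?thesis
            using prems(8) by simp
        qed
        have "blocks_at m' f bs"
          by (rule blocks_at_mods[OF prems(5,3,7)]) (use bs in auto)
        then show "pieces_at m' f ((d, bs) # ps)"
          using prems(3,9) bs ne xs False
          by (simp add: mods_val[OF prems(1)] mods_val[OF prems(7)] del: length_concat concat_eq_Nil_conv)
        show "1 + t1 + t + 630 * piece_pot ((d, bs) # ps)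
          \<le> 630 * item_pot (it # its) + 640 * length (elems (it # its)) + 2"
          using prems(6,10) len by (simp add: it False del: length_greater_0_conv)
      qed
      done
  qed
qed

lemma spec_sort_groups:
  assumes "\<And>m'. mods ({SA, MARK} \<times> UNIV) m m' \<Longrightarrow>
      comparator lt key (\<Union>(d, xs)\<in>set its. if d then {} else set xs) m'"
    and "suffix_sort_arrays n m" "items_at E m 1 its" "length (elems its) = n" "set (elems its) \<subseteq> {..n + 1}"
  shows "spec (sort_groups lt n) m (\<lambda>_ m' t. mods ({SA, MARK} \<times> {1..n}) m m' \<and>
       (\<exists>ps. list_all2 (splits key) its ps \<and> pieces_at m' 1 ps \<and>
         t + 630 * piece_pot ps \<le> 630 * item_pot its + 640 * n + 3))"
  unfolding sort_groups_def
  apply (rule spec_bindI[OF spec_sort_groups_loop[where its = its and key = key and E = E]])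
  subgoal by (rule assms(1))
  subgoal by (rule assms(2))
  subgoal by (rule assms(3))
  subgoal using assms(4) by simp
  subgoal using assms(5) .
  apply (elim conjE exE)
  subgoal for _ _ _ ps
    by (simp add: assms(4) atLeastLessThanSuc_atLeastAtMost) (rule exI[of _ ps], simp)
  done

subsection \<open>Updating the groups\<close>

text \<open>Mirrors \<open>add_sorted\<close> on lists: a run that follows a run is absorbed by it.
  Correspondingly, \<open>run_start\<close> mirrors the variable s of the programs.\<close>

definition append_item :: "items \<Rightarrow> bool \<times> nat list \<Rightarrow> items" where
  "append_item its it = (if fst it \<and> its \<noteq> [] \<and> fst (last its)
     then butlast its @ [(True, snd (last its) @ snd it)] else its @ [it])"

definition run_start :: "items \<Rightarrow> nat" where
  "run_start its = (if its \<noteq> [] \<and> fst (last its) then Suc (length (elems (butlast its))) else 0)"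

definition block_item :: "nat list \<Rightarrow> bool \<times> nat list" where
  "block_item b = (length b = 1, b)"

definition piece_items :: "bool \<times> nat list list \<Rightarrow> items" where
  "piece_items p = (if fst p then map (Pair True) (snd p) else map block_item (snd p))"

lemma append_item_cases:
  obtains (merge) its' ys where "its = its' @ [(True, ys)]" "fst it"
      "append_item its it = its' @ [(True, ys @ snd it)]" "run_start its = Suc (length (elems its'))"
  | (new) "append_item its it = its @ [it]" "fst it \<Longrightarrow> run_start its = 0"
proof (cases "fst it \<and> its \<noteq> [] \<and> fst (last its)")
  case True
  then obtain its' ys where "its = its' @ [(True, ys)]"
    by (cases its rule: rev_cases) auto
  then show ?thesis
    using True by (intro merge) (auto simp: append_item_def run_start_def)
next
  case False
  then show ?thesis
    by (intro new) (auto simp: append_item_def run_start_def)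
qed

lemma elems_append_item [simp]: "elems (append_item its it) = elems its @ snd it"
  by (rule append_item_cases[of its it]) auto

lemma run_start_snoc [simp]: "run_start (its @ [(d, xs)]) = (if d then Suc (length (elems its)) else 0)"
  by (simp add: run_start_def)

lemma item_pot_append_item:
  "item_pot (append_item its (d, xs)) = item_pot its + (if d then 0 else length xs * floor_log (length xs))"
  by (rule append_item_cases[of its "(d, xs)"]) auto

lemma elems_foldl_append_item: "elems (foldl append_item its its') = elems its @ elems its'"
  by (induction its' arbitrary: its) auto

lemma elems_piece_items: "elems (piece_items p) = concat (snd p)"
  by (cases p) (simp add: elems_def piece_items_def block_item_def comp_def)

lemma item_pot_foldl_append_item: "item_pot (foldl append_item its its') = item_pot its + item_pot its'"
  by (induction its' arbitrary: its) (auto simp: item_pot_append_item)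

lemma item_pot_piece_items: "item_pot (piece_items (d, bs)) = (if d then 0 else pot bs)"
proof -
  have "item_pot (map (Pair True) bs) = 0"
    by (induction bs) auto
  moreover have "item_pot (map block_item bs) = pot bs"
    by (induction bs) (auto simp: block_item_def)
  ultimately show ?thesis
    by (simp add: piece_items_def)
qed

lemma unsorted_append_item: "(False, xs) \<in> set (append_item its it) \<longleftrightarrow> (False, xs) \<in> set its \<or> it = (False, xs)"
  by (rule append_item_cases[of its it]) auto

lemma unsorted_foldl_append_item:
  "(False, xs) \<in> set (foldl append_item its its') \<longleftrightarrow> (False, xs) \<in> set its \<or> (False, xs) \<in> set its'"
  by (induction its' arbitrary: its) (auto simp: unsorted_append_item)

text \<open>Adjacent runs get merged, hence the sorting loop recognises that everything is sorted.\<close>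

definition merged :: "items \<Rightarrow> bool" where
  "merged its \<longleftrightarrow> (\<forall>it\<in>set its. fst it) \<longrightarrow> length its \<le> 1"

text \<open>Absorbing a run keeps the number of items. A run is appended as a new item only if no
  run is open at the end, so a list consisting of runs alone grows this way only from the empty
  list.\<close>

lemma merged_append_item: "merged its \<Longrightarrow> merged (append_item its it)"
proof (rule append_item_cases[of its it])
  assume "append_item its it = its @ [it]" "fst it \<Longrightarrow> run_start its = 0" "merged its"
  then show ?thesis
    by (cases its rule: rev_cases) (auto simp: merged_def run_start_def)
qed (auto simp: merged_def)

lemma merged_foldl_append_item: "merged its \<Longrightarrow> merged (foldl append_item its its')"
  by (induction its' arbitrary: its) (auto simp: merged_append_item)

text \<open>Extending an open run takes just a new \<open>LEN\<close> entry at its start: f is the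
  index following the run, and the group numbers of \<open>xs\<close> are already the right
  indices.\<close>

lemma spec_add_sorted:
  assumes "suffix_sort_arrays n m" "items_at True m 1 its" "f = Suc (length (elems its))"
    and "xs \<noteq> []" "f + length xs \<le> n + 1"
    and "\<And>i. i < length xs \<Longrightarrow> val m SA (f + i) = xs ! i \<and> val m GRP (xs ! i) = f + i"
  shows "spec (add_sorted (run_start its) f (length xs)) m (\<lambda>s' m' t.
    mods ({LEN, SORTED} \<times> {1..f}) m m' \<and> items_at True m' 1 (append_item its (True, xs)) \<and>
    s' = run_start (append_item its (True, xs)) \<and> t \<le> 3)"
proof -
  have len: "0 < length xs"
    using assms(4) by simp
  have f: "f \<le> n" "f \<le> Suc n"
    using assms(5) len by linarith+
  note alloc = suffix_sort_arraysD[OF assms(1)]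
  show ?thesis
  proof (cases rule: append_item_cases[of its "(True, xs)"])
    case (merge its' ys)
    let ?s = "Suc (length (elems its'))"
    have at: "items_at True m 1 its'" "val m LEN ?s = length ys" "val m SORTED ?s = 1" "ys \<noteq> []"
      "\<And>i. i < length ys \<Longrightarrow> val m SA (?s + i) = ys ! i" "\<And>i. i < length ys \<Longrightarrow> val m GRP (ys ! i) = ?s + i"
      using assms(2) by (auto simp: merge(1) items_at_append)
    have f_eq: "f = ?s + length ys"
      by (simp add: assms(3) merge(1))
    let ?m = "store m LEN ?s (length ys + length xs)"
    have mods: "mods ({LEN, SORTED} \<times> {1..f}) m ?m"
      by (rule mods_store) (simp add: f_eq)
    have "items_at True ?m 1 its'"
      by (rule items_at_mods[OF at(1) mods_store[of LEN ?s "{(LEN, ?s)}"]]) auto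
    moreover have "val m SA (?s + i) = (ys @ xs) ! i \<and> val m GRP ((ys @ xs) ! i) = ?s + i"
      if "i < length (ys @ xs)" for i
      using that at(5,6)[of i] assms(6)[of "i - length ys"] by (auto simp: nth_append f_eq)
    ultimately have "items_at True ?m 1 (its' @ [(True, ys @ xs)])"
      using at by (auto simp: items_at_append)
    then show ?thesis
      using mods f assms(5) at by (simp add: add_sorted_def merge(3,4) alloc f_eq)
  next
    case new
    let ?m = "store (store m LEN f (length xs)) SORTED f 1"
    have mods: "mods ({LEN, SORTED} \<times> {f}) m ?m"
      by (auto simp: mods_def)
    have "items_at True ?m 1 its"
      by (rule items_at_mods[OF assms(2) mods]) (auto simp: assms(3))
    then have "items_at True ?m 1 (its @ [(True, xs)])"
      using assms(4,6) by (auto simp: items_at_append assms(3))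
    moreover have "mods ({LEN, SORTED} \<times> {1..f}) m ?m"
      by (rule mods_mono[OF mods]) (auto simp: assms(3))
    moreover have "length xs \<le> Suc n" "f \<noteq> 0"
      using assms(3,5) by simp_all
    ultimately show ?thesis
      using f new by (simp add: add_sorted_def alloc assms(3))
  qed
qed

lemma spec_find_mark:
  assumes "suffix_sort_arrays n m" "val m MARK e = 1" "j \<le> e" "e \<le> n" "\<And>i. j \<le> i \<Longrightarrow> i < e \<Longrightarrow> val m MARK i = 0"
  shows "spec (while_loop (\<lambda>e. do {b \<leftarrow> rd MARK e; ret (b = 0)}) (\<lambda>e. ret (e + 1)) j) m
    (\<lambda>e' m' t. (e' = e \<and> m' = m) \<and> t \<le> 3 * (e - j) + 3)"
proof (rule spec_while[where I = "\<lambda>i m'. m' = m \<and> j \<le> i \<and> i \<le> e" and \<Phi> = "\<lambda>i. 3 * (e - i) + 3"])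
  show "spec (do {b \<leftarrow> rd MARK i; ret (b = 0)}) m' (\<lambda>x m1 t1.
    if x then spec (ret (i + 1)) m1 (\<lambda>s' m2 t2. (m2 = m \<and> j \<le> s' \<and> s' \<le> e) \<and> 0 < t1 + t2 \<and>
      t1 + t2 + (3 * (e - s') + 3) \<le> 3 * (e - i) + 3)
    else (i = e \<and> m1 = m) \<and> t1 + 1 \<le> 3 * (e - i) + 3)"
    if "m' = m \<and> j \<le> i \<and> i \<le> e" for i m'
    using that assms suffix_sort_arraysD(2)[OF assms(1), of MARK i] by (cases "i = e") auto
qed (use assms in auto)

lemma spec_number_block:
  assumes "suffix_sort_arrays n m" "e \<le> n" "b \<noteq> []" "j + length b = Suc e" "set b \<subseteq> {..n}"
    and "\<And>i. i < length b \<Longrightarrow> val m SA (j + i) = b ! i"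
  shows "spec (for_loop j e (\<lambda>k. do {x \<leftarrow> rd SA k; wr GRP x e})) m
    (\<lambda>_ m' t. (mods ({GRP} \<times> set b) m m' \<and> (\<forall>x\<in>set b. val m' GRP x = e)) \<and> t \<le> 4 * length b + 3)"
proof -
  have "spec (for_loop j e (\<lambda>k. do {x \<leftarrow> rd SA k; wr GRP x e})) m
    (\<lambda>_ m' t. (mods ({GRP} \<times> set b) m m' \<and> (\<forall>i<Suc e - j. val m' GRP (b ! i) = e)) \<and>
      t \<le> (2 + 2) * (Suc e - j) + 3)"
  proof (rule spec_for_uniform[where I = "\<lambda>k m'. mods ({GRP} \<times> set b) m m' \<and> (\<forall>i<k - j. val m' GRP (b ! i) = e)"])
    fix k m'
    assume k: "j \<le> k" "k \<le> e" and I: "mods ({GRP} \<times> set b) m m' \<and> (\<forall>i<k - j. val m' GRP (b ! i) = e)"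
    then have k': "k - j < length b"
      using assms(4) by linarith
    note arr = suffix_sort_arrays_mods[OF assms(1) conjunct1[OF I]]
    have x: "b ! (k - j) \<in> set b"
      using k' by simp
    have "val m' SA k = b ! (k - j)"
      using assms(6)[OF k'] k(1) mods_val[OF conjunct1[OF I], of SA k] by simp
    moreover have "val (store m' GRP (b ! (k - j)) e) GRP (b ! i) = e" if "i < Suc k - j" for i
      using I that k(1) by (cases "i = k - j") auto
    moreover have "b ! (k - j) \<le> n"
      using x assms(5) by auto
    ultimately show "spec (do {x \<leftarrow> rd SA k; wr GRP x e}) m' (\<lambda>_ m'' t.
      (mods ({GRP} \<times> set b) m m'' \<and> (\<forall>i<Suc k - j. val m'' GRP (b ! i) = e)) \<and> t \<le> 2)"
      using I x k assms(2) suffix_sort_arraysD[OF arr] by (auto intro: mods_trans_store)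
  qed (use assms(3,4) in \<open>auto simp: Suc_le_eq\<close>)
  then show ?thesis
  proof (rule spec_mono)
    have "Suc e - j = length b"
      using assms(4) by simp
    then show "(mods ({GRP} \<times> set b) m m' \<and> (\<forall>x\<in>set b. val m' GRP x = e)) \<and> t \<le> 4 * length b + 3"
      if "(mods ({GRP} \<times> set b) m m' \<and> (\<forall>i<Suc e - j. val m' GRP (b ! i) = e)) \<and> t \<le> (2 + 2) * (Suc e - j) + 3" for m' t
      using that by (auto simp: in_set_conv_nth)
  qed
qed

lemma block_item_single: "length b = 1 \<Longrightarrow> block_item b = (True, b)"
  by (simp add: block_item_def)

text \<open>Blocks are nonempty, so the constant overhead per block is absorbed: 7 l + 13 \<le> 25
  l. Distinctness guarantees that renumbering one block leaves the numbers of the finished items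
  intact.\<close>

lemma spec_split_group_loop:
  assumes "suffix_sort_arrays n m" "items_at True m 1 its" "j = Suc (length (elems its))"
    and "blocks_at m j bs" "[] \<notin> set bs" "j + length (concat bs) = Suc g" "g \<le> n"
    and "distinct (elems its @ concat bs)" "set (concat bs) \<subseteq> {..n}"
  shows "spec (while_loop (\<lambda>(j, s). ret (j \<le> g)) (\<lambda>(j, s). do {
       e \<leftarrow> while_loop (\<lambda>e. do {b \<leftarrow> rd MARK e; ret (b = 0)}) (\<lambda>e. ret (e + 1)) j;
       for_loop j e (\<lambda>k. do {x \<leftarrow> rd SA k; wr GRP x e});
       if e = j then do {
         s' \<leftarrow> add_sorted s j 1;
         ret (e + 1, s')
       } else do {
         wr LEN j (e - j + 1);
         wr SORTED j 0;
         ret (e + 1, 0)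
       }
     }) (j, run_start its)) m (\<lambda>r m' t.
       mods ({LEN, SORTED} \<times> {1..g} \<union> {GRP} \<times> set (concat bs)) m m' \<and>
       items_at True m' 1 (foldl append_item its (map block_item bs)) \<and>
       snd r = run_start (foldl append_item its (map block_item bs)) \<and> t \<le> 25 * length (concat bs) + 2)"
    (is "spec (while_loop ?b ?c _) m _")
  using assms
proof (induction bs arbitrary: its j m)
  case Nil
  then show ?case
    by (subst spec_while_unfold) simp
next
  case (Cons b bs)
  note arr = Cons.prems(1)
  define e where "e = j + length b - 1"
  have ne: "b \<noteq> []" and len: "0 < length b" and bs: "[] \<notin> set bs"
    using Cons.prems(5) by auto
  have e: "j + length b = Suc e" "j \<le> e"
    using len unfolding e_def by linarith+
  have eg: "e \<le> g" "e \<le> n" "Suc e + length (concat bs) = Suc g" "j \<le> g" "j \<le> n" "j \<le> Suc n" "e \<le> Suc n"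
    using Cons.prems(6,7) e by (simp_all del: length_concat)
  have at: "\<And>i. i < length b \<Longrightarrow> val m SA (j + i) = b ! i" "val m MARK e = 1"
    "\<And>i. Suc i < length b \<Longrightarrow> val m MARK (j + i) = 0" "blocks_at m (Suc e) bs"
    using Cons.prems(4) unfolding blocks_at.simps e_def[symmetric] e(1) by simp_all
  have mark: "val m MARK i = 0" if "j \<le> i" "i < e" for i
    using at(3)[of "i - j"] that e by simp
  have disj: "set (elems its) \<inter> set b = {}"
    using Cons.prems(8) by auto
  have le: "set b \<subseteq> {..n}"
    using Cons.prems(9) by simp
  let ?it = "block_item b"
  have step: "spec (?c (j, run_start its)) m (\<lambda>r m' t. r = (Suc e, run_start (append_item its ?it)) \<and>
      mods ({LEN, SORTED} \<times> {1..e} \<union> {GRP} \<times> set b) m m' \<and> items_at True m' 1 (append_item its ?it) \<and>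
      t \<le> 7 * length b + 12)"
    unfolding prod.case
    apply (rule spec_bindI[OF spec_find_mark[OF arr at(2) e(2) eg(2) mark]])
      apply assumption
     apply assumption
    apply (elim conjE, hypsubst)
    apply (rule spec_bindI[OF spec_number_block[OF arr eg(2) ne e(1) le at(1)]])
     apply assumption
    apply (elim conjE)
    subgoal premises prems for _ _ t1 _ m1 t2
    proof -
      have arr1: "suffix_sort_arrays n m1"
        by (rule suffix_sort_arrays_mods[OF arr prems(3)])
      have its1: "items_at True m1 1 its"
        by (rule items_at_mods[OF Cons.prems(2) prems(3)]) (use disj in auto)
      have t: "t1 + t2 \<le> 7 * length b + 6"
        using prems(1,2) e by linarith
      show ?thesis
      proof (cases "e = j")
        case True
        then have one: "length b = 1"
          using e by simp
        then obtain x where b: "b = [x]"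
          by (auto simp: length_Suc_conv)
        have add: "spec (add_sorted (run_start its) j (length b)) m1 (\<lambda>s' m' t.
          mods ({LEN, SORTED} \<times> {1..j}) m1 m' \<and> items_at True m' 1 (append_item its (True, b)) \<and>
          s' = run_start (append_item its (True, b)) \<and> t \<le> 3)"
        proof (rule spec_add_sorted[OF arr1 its1 Cons.prems(3) ne])
          \<comment> \<open>A block of one suffix has e = j, so the number e just written is its own
            index, as a run demands.\<close>
          show "val m1 SA (j + i) = b ! i \<and> val m1 GRP (b ! i) = j + i" if "i < length b" for i
            using that at(1)[OF that] prems(4) True one by (simp add: mods_val[OF prems(3)] b)
        qed (use e eg in simp)
        show ?thesis
          apply (simp only: True refl if_True spec_bind spec_ret)
          apply (rule spec_mono[OF add[unfolded one]])
          apply (elim conjE)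
          subgoal premises q for s' m2 t3
          proof (intro conjI)
            show "mods ({LEN, SORTED} \<times> {1..j} \<union> {GRP} \<times> set b) m m2"
              by (rule mods_comp[OF prems(3) q(1)]) auto
          qed (use q t block_item_single[OF one] in \<open>simp_all\<close>)
          done
      next
        case False
        then have b: "block_item b = (False, b)"
          using e by (simp add: block_item_def)
        let ?m2 = "store (store m1 LEN j (Suc (e - j))) SORTED j 0"
        have m2: "mods ({LEN, SORTED} \<times> {j}) m1 ?m2"
          by (auto simp: mods_def)
        have "items_at True ?m2 1 its"
          by (rule items_at_mods[OF its1 m2]) (auto simp: Cons.prems(3))
        moreover have "Suc (e - j) = length b" "j + length b - Suc 0 = e"
          using e by simp_all
        moreover have "append_item its (False, b) = its @ [(False, b)]"
          by (simp add: append_item_def)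
        ultimately have "items_at True ?m2 1 (append_item its ?it)"
          using at prems(4) ne
          by (simp add: b items_at_append Cons.prems(3)[symmetric] mods_val[OF prems(3)])
        moreover have "mods ({LEN, SORTED} \<times> {1..e} \<union> {GRP} \<times> set b) m ?m2"
          by (rule mods_comp[OF prems(3) m2]) (use e Cons.prems(3) in auto)
        moreover have "run_start (append_item its ?it) = 0"
          by (simp add: append_item_def b)
        moreover have "Suc (e - j) \<le> Suc n"
          using eg by simp
        ultimately show ?thesis
          using False t suffix_sort_arraysD[OF arr1] eg by simp
      qed
    qed
    done
  have IH: "spec (while_loop ?b ?c (Suc e, run_start (append_item its ?it))) m1 (\<lambda>r m' t.
       mods ({LEN, SORTED} \<times> {1..g} \<union> {GRP} \<times> set (concat bs)) m1 m' \<and>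
       items_at True m' 1 (foldl append_item (append_item its ?it) (map block_item bs)) \<and>
       snd r = run_start (foldl append_item (append_item its ?it) (map block_item bs)) \<and>
       t \<le> 25 * length (concat bs) + 2)"
    if m1: "mods ({LEN, SORTED} \<times> {1..e} \<union> {GRP} \<times> set b) m m1" "items_at True m1 1 (append_item its ?it)" for m1
  proof (rule Cons.IH)
    show "suffix_sort_arrays n m1"
      by (rule suffix_sort_arrays_mods[OF arr m1(1)])
    show "blocks_at m1 (Suc e) bs"
      by (rule blocks_at_mods[OF at(4) bs m1(1)]) auto
    show "Suc e = Suc (length (elems (append_item its ?it)))"
      using e Cons.prems(3) by (simp add: block_item_def)
  qed (use m1 bs eg Cons.prems(7-9) in \<open>auto simp: block_item_def simp del: length_concat\<close>)
  show ?case
    apply (subst spec_while_unfold)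
    apply (simp only: prod.case spec_ret eg if_True)
    apply (rule spec_mono[OF step[unfolded prod.case]])
    apply (elim conjE, hypsubst)
    apply (rule spec_mono[OF IH])
      apply assumption
     apply assumption
    apply (elim conjE)
    subgoal premises prems for _ m1 t1 r m' t
    proof (intro conjI)
      show "mods ({LEN, SORTED} \<times> {1..g} \<union> {GRP} \<times> set (concat (b # bs))) m m'"
        by (rule mods_comp[OF prems(1,4)]) (use eg in auto)
      show "1 + t1 + t \<le> 25 * length (concat (b # bs)) + 2"
        using prems(3,7) len by (simp del: length_concat length_greater_0_conv)
    qed (use prems in simp_all)
    done
qed

lemma spec_split_group:
  assumes "suffix_sort_arrays n m" "items_at True m 1 its" "f = Suc (length (elems its))"
    and "blocks_at m f bs" "[] \<notin> set bs" "f + length (concat bs) = Suc g" "g \<le> n"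
    and "distinct (elems its @ concat bs)" "set (concat bs) \<subseteq> {..n}"
  shows "spec (split_group f g (run_start its)) m (\<lambda>s' m' t.
       mods ({LEN, SORTED} \<times> {1..g} \<union> {GRP} \<times> set (concat bs)) m m' \<and>
       items_at True m' 1 (foldl append_item its (map block_item bs)) \<and>
       s' = run_start (foldl append_item its (map block_item bs)) \<and> t \<le> 25 * length (concat bs) + 3)"
  unfolding split_group_def
  by (rule spec_bindI[OF spec_split_group_loop[OF assms]]) (auto split: prod.splits)

text \<open>Here \<open>its\<close> is the rebuilt prefix and \<open>ps\<close> the part still to be
  read. An open run may be extended by writing \<open>LEN\<close> at its first index, left of f; all
  such writes stay left of the next piece, and distinctness keeps the renumbering away from the
  other items. A piece costs at most 25 l + 7 steps, within 35 l.\<close>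

lemma spec_update_groups_loop:
  assumes "suffix_sort_arrays n m" "items_at True m 1 its" "f = Suc (length (elems its))"
    and "pieces_at m f ps" "f + length (piece_elems ps) = n + 1"
    and "distinct (elems its @ piece_elems ps)" "set (piece_elems ps) \<subseteq> {..n}"
  shows "spec (while_loop (\<lambda>(f, s). ret (f \<le> n)) (\<lambda>(f, s). do {
       l \<leftarrow> rd LEN f;
       d \<leftarrow> rd SORTED f;
       s' \<leftarrow> (if d = 1 then add_sorted s f l else split_group f (f + l - 1) s);
       ret (f + l, s')
     }) (f, run_start its)) m (\<lambda>_ m' t.
       mods ({LEN, SORTED} \<times> UNIV \<union> {GRP} \<times> set (piece_elems ps)) m m' \<and>
       items_at True m' 1 (foldl append_item its (concat (map piece_items ps))) \<and>
       t \<le> 35 * length (piece_elems ps) + 2)"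
    (is "spec (while_loop ?b ?c _) m _")
  using assms
proof (induction ps arbitrary: its f m)
  case Nil
  then show ?case
    by (subst spec_while_unfold) simp
next
  case (Cons p ps)
  obtain d bs where p: "p = (d, bs)"
    by (cases p)
  note arr = Cons.prems(1) and f_eq = Cons.prems(3)
  define xs where "xs = concat bs"
  have at: "xs \<noteq> []" "[] \<notin> set bs" "val m LEN f = length xs" "val m SORTED f = (if d then 1 else 0)"
    "\<not> d \<Longrightarrow> blocks_at m f bs" "pieces_at m (f + length xs) ps"
    using Cons.prems(4) by (simp_all add: p xs_def del: length_concat concat_eq_Nil_conv)
  have len: "0 < length xs"
    using at(1) by simp
  have ub: "b < f + length xs" if "b \<le> f \<or> b \<le> f + length xs - Suc 0" for b
    using len that by linarith
  have sum: "f + length xs + length (piece_elems ps) = n + 1"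
    using Cons.prems(5) by (simp add: p xs_def)
  have f: "f \<le> n" "f \<le> Suc n" "f + length xs \<le> n + 1" "f + length xs = Suc (f + length xs - 1)" "f + length xs - 1 \<le> n"
    using sum len by linarith+
  have dist: "distinct (elems its @ xs)" "set xs \<subseteq> {..n}" "set xs \<inter> set (piece_elems ps) = {}"
    using Cons.prems(6,7) by (auto simp: p xs_def)
  define its' where "its' = foldl append_item its (piece_items p)"
  have elems': "elems its' = elems its @ xs"
    by (simp add: its'_def elems_foldl_append_item elems_piece_items p xs_def)
  have step: "spec (?c (f, run_start its)) m (\<lambda>r m' t. r = (f + length xs, run_start its') \<and>
      mods ({LEN, SORTED} \<times> {..<f + length xs} \<union> {GRP} \<times> set xs) m m' \<and> items_at True m' 1 its' \<and>
      t \<le> 25 * length xs + 6)"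
  proof (cases d)
    case True
    then obtain ys where "bs = [ys]" "\<forall>i<length ys. val m SA (f + i) = ys ! i \<and> val m GRP (ys ! i) = f + i"
      using Cons.prems(4) by (auto simp: p)
    then have bs: "bs = [xs]" and xs: "\<And>i. i < length xs \<Longrightarrow> val m SA (f + i) = xs ! i \<and> val m GRP (xs ! i) = f + i"
      by (simp_all add: xs_def)
    have its': "its' = append_item its (True, xs)"
      by (simp add: its'_def piece_items_def p True bs)
    show ?thesis
      using suffix_sort_arraysD[OF arr] f at(3,4) True
      apply simp
      apply (rule spec_mono[OF spec_add_sorted[OF arr Cons.prems(2) f_eq at(1) f(3) xs]])
       apply assumption
      apply (elim conjE)
      subgoal premises prems for s' m' t
      proof -
        have "mods ({LEN, SORTED} \<times> {1..f}) m m'"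
          by (rule prems)
        then have "mods ({LEN, SORTED} \<times> {..<f + length xs} \<union> {GRP} \<times> set xs) m m'"
          by (rule mods_mono) (auto intro: ub)
        then show ?thesis
          using prems by (simp add: its')
      qed
      done
  next
    case False
    have its': "its' = foldl append_item its (map block_item bs)"
      by (simp add: its'_def piece_items_def p False)
    show ?thesis
      using suffix_sort_arraysD[OF arr] f(1,2) at(3,4) False
      apply simp
      apply (rule spec_mono[OF spec_split_group[OF arr Cons.prems(2) f_eq at(5)[OF False] at(2)]])
          apply (use f dist in \<open>simp_all add: xs_def[symmetric] del: length_concat set_concat\<close>)
      apply (elim conjE)
      subgoal premises prems for m' t
      proof -
        have "mods ({LEN, SORTED} \<times> {1..f + length xs - 1} \<union> {GRP} \<times> set xs) m m'"
          using prems by simp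
        then have "mods ({LEN, SORTED} \<times> {..<f + length xs} \<union> {GRP} \<times> set xs) m m'"
          by (rule mods_mono) (auto intro: ub)
        then show ?thesis
          using prems by (simp add: its')
      qed
      done
  qed
  have IH: "spec (while_loop ?b ?c (f + length xs, run_start its')) m1 (\<lambda>_ m' t.
       mods ({LEN, SORTED} \<times> UNIV \<union> {GRP} \<times> set (piece_elems ps)) m1 m' \<and>
       items_at True m' 1 (foldl append_item its' (concat (map piece_items ps))) \<and>
       t \<le> 35 * length (piece_elems ps) + 2)"
    if m1: "mods ({LEN, SORTED} \<times> {..<f + length xs} \<union> {GRP} \<times> set xs) m m1" "items_at True m1 1 its'" for m1
  proof (rule Cons.IH)
    show "suffix_sort_arrays n m1"
      by (rule suffix_sort_arrays_mods[OF arr m1(1)])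
    show "pieces_at m1 (f + length xs) ps"
      by (rule pieces_at_mods[OF at(6) m1(1)]) (use dist(3) in auto)
    show "f + length xs = Suc (length (elems its'))"
      by (simp add: elems' f_eq)
  qed (use m1 sum Cons.prems(6,7) in \<open>auto simp: elems' p xs_def\<close>)
  show ?case
    apply (subst spec_while_unfold)
    apply (simp only: prod.case spec_ret f if_True)
    apply (rule spec_mono[OF step[unfolded prod.case]])
    apply (elim conjE, hypsubst)
    apply (rule spec_mono[OF IH])
      apply assumption
     apply assumption
    apply (elim conjE)
    subgoal premises prems for _ m1 t1 _ m' t
    proof (intro conjI)
      show "mods ({LEN, SORTED} \<times> UNIV \<union> {GRP} \<times> set (piece_elems (p # ps))) m m'"
        by (rule mods_comp[OF prems(1,4)]) (auto simp: p xs_def)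
      show "1 + t1 + t \<le> 35 * length (piece_elems (p # ps)) + 2"
        using prems(3,6) len by (simp add: p xs_def del: length_greater_0_conv)
      show "items_at True m' 1 (foldl append_item its (concat (map piece_items (p # ps))))"
        using prems(5) by (simp add: its'_def)
    qed
    done
qed

lemma spec_update_groups:
  assumes "suffix_sort_arrays n m" "pieces_at m 1 ps" "length (piece_elems ps) = n"
    and "distinct (piece_elems ps)" "set (piece_elems ps) \<subseteq> {..n}"
  shows "spec (update_groups n) m (\<lambda>_ m' t.
       mods ({LEN, SORTED} \<times> UNIV \<union> {GRP} \<times> set (piece_elems ps)) m m' \<and>
       items_at True m' 1 (foldl append_item [] (concat (map piece_items ps))) \<and>
       t \<le> 35 * n + 3)"
proof -
  have start: "run_start [] = 0"
    by (simp add: run_start_def)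
  show ?thesis
    unfolding update_groups_def
    by (rule spec_bindI[OF spec_update_groups_loop[of n m "[]" 1 ps, unfolded start]]) (use assms in auto)
qed

subsection \<open>Progress of a pass\<close>

text \<open>A number is an index of the segment: its own index for a suffix in a run, the last index
  of the group otherwise. For f = 1 the numbers are positive, which tells the nonempty suffixes from
  the empty one.\<close>

lemma items_at_GRP_bounds:
  "items_at True m f its \<Longrightarrow> x \<in> set (elems its) \<Longrightarrow> f \<le> val m GRP x \<and> val m GRP x < f + length (elems its)"
proof (induction its arbitrary: f)
  case (Cons it its)
  obtain d xs where it: "it = (d, xs)"
    by (cases it)
  show ?case
  proof (cases "x \<in> set xs")
    case True
    then obtain i where i: "i < length xs" "x = xs ! i"
      by (auto simp: in_set_conv_nth)
    have "f \<le> val m GRP x \<and> val m GRP x < f + length xs"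
      using Cons.prems(1) i True by (cases d) (auto simp: it)
    then show ?thesis
      by (auto simp: it)
  next
    case False
    then show ?thesis
      using Cons.IH[of "f + length xs"] Cons.prems by (auto simp: it)
  qed
qed simp

text \<open>Different items have disjoint ranges of numbers, and the numbers inside a run are
  pairwise different, so a collision can only come from an unsorted group.\<close>

lemma items_at_GRP_eq:
  "items_at True m f its \<Longrightarrow> x \<in> set (elems its) \<Longrightarrow> y \<in> set (elems its) \<Longrightarrow> x \<noteq> y \<Longrightarrow>
    val m GRP x = val m GRP y \<Longrightarrow> \<exists>xs. (False, xs) \<in> set its \<and> x \<in> set xs \<and> y \<in> set xs"
proof (induction its arbitrary: f)
  case (Cons it its)
  obtain d xs where it: "it = (d, xs)"
    by (cases it)
  have head: "val m GRP z < f + length xs" if "z \<in> set xs" for z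
    using items_at_GRP_bounds[of m f "[(d, xs)]" z] Cons.prems(1) that by (auto simp: it)
  have tail: "f + length xs \<le> val m GRP z" if "z \<in> set (elems its)" for z
    using items_at_GRP_bounds[of m "f + length xs" its z] Cons.prems(1) that by (auto simp: it)
  consider "x \<in> set xs" "y \<in> set xs" | "x \<in> set (elems its)" "y \<in> set (elems its)"
    using Cons.prems(2,3,5) head[of x] head[of y] tail[of x] tail[of y] by (auto simp: it)
  then show ?case
  proof cases
    case 1
    have "\<not> d"
    proof
      assume d
      then have val: "\<forall>i<length xs. val m GRP (xs ! i) = f + i"
        using Cons.prems(1) by (simp add: it)
      obtain i j where "i < length xs" "x = xs ! i" "j < length xs" "y = xs ! j"
        using 1 by (auto simp: in_set_conv_nth)
      then show False
        using val Cons.prems(4,5) by auto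
    qed
    then show ?thesis
      using 1 by (auto simp: it)
  next
    case 2
    then show ?thesis
      using Cons.IH[of "f + length xs"] Cons.prems by (auto simp: it)
  qed
qed simp

lemma unsorted_piece_items:
  "(False, b) \<in> set (piece_items (d, bs)) \<longleftrightarrow> \<not> d \<and> b \<in> set bs \<and> length b \<noteq> 1"
  by (auto simp: piece_items_def block_item_def)

lemma elems_concat: "elems (concat xss) = concat (map elems xss)"
  by (induction xss) auto

lemma item_pot_concat: "item_pot (concat (map piece_items ps)) = piece_pot ps"
  by (induction ps) (auto simp: item_pot_piece_items)

lemma mset_piece_elems:
  "list_all2 (splits key) its ps \<Longrightarrow> mset (piece_elems ps) = mset (elems its)"
  by (induction rule: list_all2_induct) (auto simp: splits_def mset_concat simp del: mset_concat)

definition sorting_state :: "nat \<Rightarrow> bool \<Rightarrow> items \<Rightarrow> 'a mem \<Rightarrow> bool" where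
  "sorting_state n E its m \<longleftrightarrow> suffix_sort_arrays n m \<and> items_at E m 1 its \<and> distinct (elems its) \<and>
     set (elems its) = {1..n} \<and> val m GRP (n + 1) = 0"

lemma sorting_state_length: "sorting_state n E its m \<Longrightarrow> length (elems its) = n"
  by (auto simp: sorting_state_def dest!: distinct_card)

text \<open>The 675 per suffix are 640 for sorting and 35 for renumbering. Turning singletons into
  runs and merging runs leaves the potential unchanged, as both contribute 0.\<close>

lemma spec_pass:
  assumes "\<And>m'. mods ({SA, MARK} \<times> UNIV) m m' \<Longrightarrow>
      comparator lt key (\<Union>(d, xs)\<in>set its. if d then {} else set xs) m'"
    and state: "sorting_state n E its m"
  shows "spec (sort_groups lt n) m (\<lambda>_ m1 t1. spec (update_groups n) m1 (\<lambda>_ m2 t2.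
    \<exists>its'. sorting_state n True its' m2 \<and> merged its' \<and>
      (\<forall>b. (False, b) \<in> set its' \<longrightarrow> length b \<noteq> 1 \<and>
        (\<exists>xs. (False, xs) \<in> set its \<and> set b \<subseteq> set xs \<and> (\<forall>x\<in>set b. \<forall>y\<in>set b. key x = key y))) \<and>
      t1 + t2 + 630 * item_pot its' \<le> 630 * item_pot its + 675 * n + 6))"
proof -
  note st = state[unfolded sorting_state_def]
  have len: "length (elems its) = n"
    by (rule sorting_state_length[OF state])
  show ?thesis
    apply (rule spec_mono[OF spec_sort_groups[where its = its and key = key and E = E]])
    subgoal by (rule assms(1))
    subgoal using st by simp
    subgoal using st by simp
    subgoal by (rule len)
    subgoal using st by auto
    apply (elim conjE exE)
    subgoal premises prems for _ m1 t1 ps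
    proof -
      have mset: "mset (piece_elems ps) = mset (elems its)"
        by (rule mset_piece_elems[OF prems(2)])
      have dist: "distinct (piece_elems ps)"
        using st mset by (metis mset_eq_imp_distinct_iff)
      have set: "set (piece_elems ps) = {1..n}"
        using mset_eq_setD[OF mset] st by simp
      have arr: "suffix_sort_arrays n m1"
        using st prems(1) by (blast intro: suffix_sort_arrays_mods)
      let ?its = "foldl append_item [] (concat (map piece_items ps))"
      have elems: "elems ?its = piece_elems ps"
        by (simp add: elems_foldl_append_item elems_concat comp_def elems_piece_items piece_elems_def)
      show ?thesis
        apply (rule spec_mono[OF spec_update_groups[OF arr prems(3) _ dist]])
        subgoal using mset_eq_length[OF mset] len by simp
        subgoal using set by auto
        apply (elim conjE)
        subgoal premises q for _ m2 t2
        proof (rule exI[of _ ?its], intro conjI allI impI)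
          \<comment> \<open>Position n + 1 is an element of no item, so its number 0 survives both
            programs.\<close>
          have "val m2 GRP (n + 1) = 0"
            using st mods_val[OF q(1), of GRP "n + 1"] mods_val[OF prems(1), of GRP "n + 1"] set by auto
          then show "sorting_state n True ?its m2"
            using q(2) suffix_sort_arrays_mods[OF arr q(1)] dist set by (simp add: sorting_state_def elems)
          show "merged ?its"
            by (rule merged_foldl_append_item) (simp add: merged_def)
          show "t1 + t2 + 630 * item_pot ?its \<le> 630 * item_pot its + 675 * n + 6"
            using prems(4) q(3) by (simp add: item_pot_foldl_append_item item_pot_concat)
          fix b assume "(False, b) \<in> set ?its"
          then obtain d bs where p: "(d, bs) \<in> set ps" "(False, b) \<in> set (piece_items (d, bs))"
            by (auto simp: unsorted_foldl_append_item)
          then have b: "\<not> d" "b \<in> set bs" "length b \<noteq> 1"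
            by (auto simp: unsorted_piece_items)
          obtain it where it: "it \<in> set its" "splits key it (d, bs)"
            using p(1) prems(2) by (metis list_all2_conv_all_nth in_set_conv_nth)
          obtain xs where it_eq: "it = (False, xs)"
            using it(2) b(1) by (cases it) (auto simp: splits_def)
          have "mset (concat bs) = mset xs" "\<forall>b\<in>set bs. \<forall>x\<in>set b. \<forall>y\<in>set b. key x = key y"
            using it(2) unfolding splits_def it_eq fst_conv snd_conv if_False by blast+
          moreover from this(1) have "set b \<subseteq> set xs"
            using b(2) mset_eq_setD[of "concat bs" xs] by auto
          ultimately show "\<exists>xs. (False, xs) \<in> set its \<and> set b \<subseteq> set xs \<and> (\<forall>x\<in>set b. \<forall>y\<in>set b. key x = key y)"
            using b(2) it(1) unfolding it_eq by blast
          show "length b \<noteq> 1"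
            by (rule b(3))
        qed
        done
    qed
    done
qed

text \<open>
  Distinct suffixes in one group agree on their first \<open>h\<close> symbols, the end marker included; for the
  running time it is enough that, consequently, they have length at least \<open>h\<close>.
\<close>

definition long_unsorted :: "nat \<Rightarrow> nat \<Rightarrow> items \<Rightarrow> bool" where
  "long_unsorted n h its \<longleftrightarrow> (\<forall>xs x. (False, xs) \<in> set its \<longrightarrow> x \<in> set xs \<longrightarrow> x + h \<le> n + 1)"

text \<open>Let y be a second element of the group of x. Were x + h the empty suffix n + 1, its
  number 0 would equal that of the nonempty suffix y + h, which is positive; likewise with x and y
  exchanged. So x + h and y + h are distinct nonempty suffixes with equal numbers, hence share an
  unsorted group of the previous stage, and the length bound for that group applies to x +
  h.\<close>

lemma long_unsorted_double:
  assumes state: "sorting_state n True its m" "sorting_state n True its' m'" and "long_unsorted n h its"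
    and refine: "\<And>b. (False, b) \<in> set its' \<Longrightarrow> length b \<noteq> 1 \<and>
        (\<exists>xs. (False, xs) \<in> set its \<and> set b \<subseteq> set xs \<and> (\<forall>x\<in>set b. \<forall>y\<in>set b. val m GRP (x + h) = val m GRP (y + h)))"
  shows "long_unsorted n (2 * h) its'"
  unfolding long_unsorted_def
proof (intro allI impI)
  fix b x assume b: "(False, b) \<in> set its'" and x: "x \<in> set b"
  note st = state[unfolded sorting_state_def]
  have at: "items_at True m 1 its"
    using st by blast
  obtain xs where xs: "(False, xs) \<in> set its" "set b \<subseteq> set xs" "\<forall>x\<in>set b. \<forall>y\<in>set b. val m GRP (x + h) = val m GRP (y + h)"
    and one: "length b \<noteq> 1"
    using refine[OF b] by blast
  have "distinct b"
    using b st(2) by (auto simp: elems_def distinct_concat_iff in_set_conv_decomp)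
  moreover have "length b \<noteq> 0"
    using x by auto
  ultimately have "1 < card (set b)"
    using one distinct_card[of b] by linarith
  then have "\<not> set b \<subseteq> {x}"
    using card_mono[of "{x}" "set b"] by auto
  then obtain y where y: "y \<in> set b" "y \<noteq> x"
    by blast
  have le: "z + h \<le> n + 1" "1 \<le> z" if "z \<in> set b" for z
  proof -
    have "z \<in> set xs"
      using xs(2) that by blast
    then show "z + h \<le> n + 1"
      using assms(3) xs(1) by (auto simp: long_unsorted_def)
    have "z \<in> set (elems its)"
      using \<open>z \<in> set xs\<close> xs(1) by (force simp: elems_def)
    then show "1 \<le> z"
      using st(1) by auto
  qed
  have eq: "val m GRP (x + h) = val m GRP (y + h)"
    using xs(3) x y(1) by blast
  have pos: "1 \<le> val m GRP z" if "1 \<le> z" "z \<le> n" for z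
    using items_at_GRP_bounds[OF at, of z] st(1) that by auto
  have zero: "val m GRP (n + 1) = 0"
    using st(1) by blast
  have "x + h \<noteq> n + 1"
  proof
    assume "x + h = n + 1"
    then have "y + h \<le> n" "val m GRP (y + h) = 0"
      using le(1)[OF y(1)] y(2) eq zero by auto
    then show False
      using pos[of "y + h"] le(2)[OF y(1)] by simp
  qed
  moreover have "y + h \<noteq> n + 1"
  proof
    assume "y + h = n + 1"
    then have "x + h \<le> n" "val m GRP (x + h) = 0"
      using le(1)[OF x] y(2) eq zero by auto
    then show False
      using pos[of "x + h"] le(2)[OF x] by simp
  qed
  ultimately have "x + h \<in> set (elems its)" "y + h \<in> set (elems its)"
    using le[OF x] le[OF y(1)] st(1) by auto
  then obtain zs where "(False, zs) \<in> set its" "x + h \<in> set zs"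
    using items_at_GRP_eq[OF at _ _ _ eq] y(2) by auto
  then have "x + h + h \<le> n + 1"
    using assms(3) by (auto simp: long_unsorted_def)
  then show "x + 2 * h \<le> n + 1"
    by simp
qed

text \<open>Keys are read off the memory at the start of the sorting pass: writes to
  \<open>SA\<close> and \<open>MARK\<close> leave \<open>GRP\<close> alone, so the keys stay
  constant while the groups are rearranged.\<close>

lemma comparator_key_less:
  assumes "suffix_sort_arrays n m" "mods ({SA, MARK} \<times> UNIV) m m'" "\<And>x. x \<in> U \<Longrightarrow> x + h \<le> n + 1"
  shows "comparator (key_less h) (\<lambda>x. val m GRP (x + h)) U m'"
proof -
  have "allocated m' GRP (x + h)" if "x \<in> U" for x
    using suffix_sort_arraysD(2)[OF suffix_sort_arrays_mods[OF assms(1,2)]] assms(3)[OF that] by simp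
  then show ?thesis
    by (auto simp: comparator_def key_less_def mods_val[OF assms(2)])
qed

section \<open>Number of doubling passes and the bound for suffix sorting\<close>

lemma sorting_state_finished:
  assumes "sorting_state n True its m" "merged its" "2 \<le> n"
    and "\<And>xs. (False, xs) \<notin> set its"
  shows "val m LEN 1 = n \<and> val m SORTED 1 = 1"
proof -
  have "\<forall>it\<in>set its. fst it"
    using assms(4) by (metis (full_types) prod.collapse)
  then have len: "length its \<le> 1"
    using assms(2) by (auto simp: merged_def)
  moreover have "length (elems its) = n"
    by (rule sorting_state_length[OF assms(1)])
  ultimately obtain d xs where its: "its = [(d, xs)]"
    using assms(3) by (cases its) auto
  then show ?thesis
    using assms(1) \<open>length (elems its) = n\<close> \<open>\<forall>it\<in>set its. fst it\<close> by (auto simp: sorting_state_def)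
qed

text \<open>Induction on k, the number of passes still possible. For k = 0, h exceeds n, whereas an
  element x \<ge> 1 of an unsorted group would satisfy x + h \<le> n + 1; so no such group is left
  and the test fails. Each pass adds 10 to the 675 n: 6 for its overhead, 1 for doubling h, 3 for
  the test.\<close>

lemma spec_doubling_loop:
  assumes "sorting_state n True its m" "merged its" "long_unsorted n h its" "2 \<le> n" "n < h * 2 ^ k"
  shows "spec (while_loop (\<lambda>h. do {l \<leftarrow> rd LEN 1; d \<leftarrow> rd SORTED 1; ret (\<not> (d = 1 \<and> l = n))}) (\<lambda>h. do {
       sort_groups (key_less h) n;
       update_groups n;
       ret (2 * h)
     }) h) m (\<lambda>_ m' t. (\<exists>its. sorting_state n True its m') \<and>
       t \<le> 630 * item_pot its + k * (675 * n + 10) + 4)"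
    (is "spec (while_loop ?b ?c h) m _")
  using assms
proof (induction k arbitrary: h its m)
  have cond: "spec (?b h) m (\<lambda>x m1 t1. x = (\<not> (val m SORTED 1 = 1 \<and> val m LEN 1 = n)) \<and> m1 = m \<and> t1 = 3)"
    if "sorting_state n True its m" for h :: nat and m :: "'a mem" and its
    using that suffix_sort_arraysD(2)[of n m] by (auto simp: sorting_state_def)
  {
    case 0
    have "(False, xs) \<notin> set its" for xs
    proof
      assume xs: "(False, xs) \<in> set its"
      then obtain us vs where its: "its = us @ (False, xs) # vs"
        by (auto simp: in_set_conv_decomp)
      then have "xs \<noteq> []"
        using 0(1) by (auto simp: sorting_state_def items_at_append)
      then obtain x where "x \<in> set xs"
        by (cases xs) auto
      moreover have "set xs \<subseteq> {1..n}"
        using 0(1) its by (auto simp: sorting_state_def)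
      ultimately show False
        using 0(3,5) xs by (fastforce simp: long_unsorted_def)
    qed
    then have "val m LEN 1 = n \<and> val m SORTED 1 = 1"
      using 0 by (intro sorting_state_finished)
    then show ?case
      using 0(1) by (subst spec_while_unfold) (rule spec_mono[OF cond[OF 0(1)]], auto)
  next
    case (Suc k)
    have arr: "suffix_sort_arrays n m"
      using Suc.prems(1) by (simp add: sorting_state_def)
    have step: "spec (?c h) m (\<lambda>h' m1 t1. h' = 2 * h \<and> (\<exists>its'. sorting_state n True its' m1 \<and> merged its' \<and>
      long_unsorted n (2 * h) its' \<and> t1 + 630 * item_pot its' \<le> 630 * item_pot its + 675 * n + 7))"
    proof -
      have cmp: "comparator (key_less h) (\<lambda>x. val m GRP (x + h)) (\<Union>(d, xs)\<in>set its. if d then {} else set xs) m'"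
        if "mods ({SA, MARK} \<times> UNIV) m m'" for m'
        by (rule comparator_key_less[OF arr that])
          (use Suc.prems(3) in \<open>auto simp: long_unsorted_def split: if_splits\<close>)
      show ?thesis
        apply (simp only: spec_bind)
        apply (rule spec_mono[OF spec_pass[OF cmp Suc.prems(1)]])
         apply assumption
        apply (erule spec_mono)
        apply (elim exE conjE)
        subgoal premises prems for _ m1 t1 _ m2 t2 its'
          unfolding spec_ret
          apply (rule conjI[OF refl], rule exI[of _ its'], intro conjI)
          subgoal by (rule prems(1))
          subgoal by (rule prems(2))
          subgoal
            by (rule long_unsorted_double[OF Suc.prems(1) prems(1) Suc.prems(3)]) (rule prems(3)[rule_format])
          subgoal using prems(4) by simp
          done
        done
    qed
    show ?case
      apply (subst spec_while_unfold)
      apply (rule spec_mono[OF cond[OF Suc.prems(1)]])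
      apply (elim conjE, hypsubst)
      apply (split if_split, intro conjI impI)
      subgoal
        apply (rule spec_mono[OF step])
        apply (elim conjE exE, hypsubst)
        subgoal premises prems
          apply (rule spec_mono[OF Suc.IH[OF prems(2,3,4)]])
          subgoal by (rule Suc.prems(4))
          subgoal using Suc.prems(5) by (simp add: mult.assoc mult.left_commute)
          subgoal using prems(5) by auto
          done
        done
      subgoal using Suc.prems(1) by auto
      subgoal by simp
      done
  }
qed

lemma spec_initial_order:
  assumes "suffix_sort_arrays n m"
  shows "spec (for_loop 1 n (\<lambda>i. wr SA i i)) m (\<lambda>_ m' t.
    (mods ({SA} \<times> {1..n}) m m' \<and> (\<forall>i. 1 \<le> i \<and> i < Suc n \<longrightarrow> val m' SA i = i)) \<and> t \<le> (1 + 2) * (Suc n - 1) + 3)"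
proof (rule spec_for_uniform[where I = "\<lambda>k m'. mods ({SA} \<times> {1..n}) m m' \<and> (\<forall>i. 1 \<le> i \<and> i < k \<longrightarrow> val m' SA i = i)"])
  fix i m'
  assume i: "1 \<le> i" "i \<le> n" and I: "mods ({SA} \<times> {1..n}) m m' \<and> (\<forall>j. 1 \<le> j \<and> j < i \<longrightarrow> val m' SA j = j)"
  note arr = suffix_sort_arraysD[OF suffix_sort_arrays_mods[OF assms conjunct1[OF I]]]
  have "mods ({SA} \<times> {1..n}) m (store m' SA i i)"
    using I i by (auto intro: mods_trans_store)
  then show "spec (wr SA i i) m' (\<lambda>_ m'' t. (mods ({SA} \<times> {1..n}) m m'' \<and> (\<forall>j. 1 \<le> j \<and> j < Suc i \<longrightarrow> val m'' SA j = j)) \<and> t \<le> 1)"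
    using I i by (auto simp: arr less_Suc_eq)
qed auto

lemma sorting_state_SA:
  assumes "sorting_state n E its m" "1 \<le> i" "i \<le> n"
  shows "1 \<le> val m SA i \<and> val m SA i \<le> n"
proof -
  have SA: "val m SA (f + j) = elems its ! j" if "items_at E m f its" "j < length (elems its)" for f j and its :: items
    using that
  proof (induction its arbitrary: f j)
    case (Cons it its)
    obtain d xs where it: "it = (d, xs)"
      by (cases it)
    show ?case
      using Cons.prems Cons.IH[of "f + length xs" "j - length xs"] by (auto simp: it nth_append)
  qed simp
  have "i - 1 < length (elems its)"
    using assms sorting_state_length[OF assms(1)] by auto
  then have "val m SA i \<in> set (elems its)"
    using SA[of 1 its "i - 1"] assms by (auto simp: sorting_state_def)
  then show ?thesis
    using assms(1) by (simp add: sorting_state_def)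
qed

text \<open>With L = floor_log n, the initial group of n suffixes has potential n L, which accounts
  for 630 n L over all passes; the first pass and at most L + 1 doubling passes add 675 n each. The
  time \<open>t1\<close> collects allocation and initialisation.\<close>

lemma suffix_sort_time:
  fixes n L :: nat
  assumes "t1 \<le> 8 * n + 25" "t2 + 630 * p \<le> 630 * (n * L) + 675 * n + 6"
    "t3 \<le> 630 * p + (L + 1) * (675 * n + 10) + 4"
  shows "t1 + t2 + t3 \<le> 1400 * ((n + 2) * (L + 3))"
  using assms by (simp add: algebra_simps)

lemma spec_suffix_sort:
  assumes "length (inp m) = n"
  shows "spec (suffix_sort n) m (\<lambda>_ m' t. suffix_sort_arrays n m' \<and>
    (\<forall>i. 1 \<le> i \<and> i \<le> n \<longrightarrow> 1 \<le> val m' SA i \<and> val m' SA i \<le> n) \<and> t \<le> 1400 * ((n + 2) * (floor_log n + 3)))"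
proof -
  define m0 where "m0 = new_array (new_array (new_array (new_array (new_array m SA (n + 2)) GRP (n + 2)) LEN (n + 2)) SORTED (n + 2)) MARK (n + 2)"
  have m0: "suffix_sort_arrays n m0" "\<And>i. i \<le> n + 1 \<Longrightarrow> val m0 GRP i = 0 \<and> val m0 MARK i = 0"
    by (auto simp: suffix_sort_arrays_def m0_def assms)
  show ?thesis
    unfolding suffix_sort_def
    apply (simp only: spec_bind spec_alloc)
    apply (fold m0_def)
    apply (rule spec_mono[OF spec_initial_order[OF m0(1)]])
    apply (elim conjE)
    subgoal premises prems for _ m1 t1
    proof -
      let ?m2 = "store (store m1 LEN 1 n) SORTED 1 (if n \<le> 1 then 1 else 0)"
      note arr1 = suffix_sort_arraysD[OF suffix_sort_arrays_mods[OF m0(1) prems(2)]]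
      have arr: "suffix_sort_arrays n ?m2"
        using arr1 by (simp add: suffix_sort_arrays_def)
      have SA: "val ?m2 SA i = i" if "1 \<le> i" "i \<le> n" for i
        using prems(3) that by simp
      have zero: "val ?m2 GRP i = 0" "val ?m2 MARK i = 0" if "i \<le> n + 1" for i
        using m0(2)[OF that] by (simp_all add: mods_val[OF prems(2)])
      show ?thesis
      \<comment> \<open>For n = 1 the initial entry is flagged as a run although its group number is
        still 0, so it is no run in the sense of \<open>items_at\<close>. The two small cases are
        executed symbolically instead.\<close>
      proof (cases "n \<le> 1")
        case True
        then consider "n = 0" | "n = 1"
          by linarith
        then show ?thesis
        proof cases
          case 1
          show ?thesis
            using arr1 prems(1)
            by (simp add: sort_groups_def update_groups_def spec_while_unfold suffix_sort_arrays_def 1)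
        next
          case 2
          show ?thesis
            using arr1 prems
            by (simp add: sort_groups_def update_groups_def spec_while_unfold add_sorted_def suffix_sort_arrays_def 2)
        qed
      next
        case False
        let ?its = "[(False, [1..<Suc n])] :: items"
        have state: "sorting_state n False ?its ?m2"
          using False SA zero arr by (auto simp: sorting_state_def nth_append simp del: upt_Suc)
        have cmp: "comparator sym_less (\<lambda>x. inp m ! (x - 1)) (\<Union>(d, xs)\<in>set ?its. if d then {} else set xs) m'"
          if "mods ({SA, MARK} \<times> UNIV) ?m2 m'" for m'
        proof -
          have "inp m' = inp m"
            using mods_inp[OF that] mods_inp[OF prems(2)] by (simp add: m0_def)
          then show ?thesis
            using assms by (auto simp: comparator_def position_def)
        qed
        show ?thesis
          apply (simp only: spec_wr)
          apply (intro conjI)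
          subgoal using arr1 by simp
          subgoal using arr1 by simp
          subgoal using arr1 by simp
          subgoal using arr1 by simp
          apply (rule spec_mono[OF spec_pass[OF cmp state]])
           apply assumption
          apply (erule spec_mono)
          apply (elim exE conjE)
          subgoal premises q for _ m3 t3 _ m4 t4 its'
          proof -
            have "long_unsorted n 1 its'"
              unfolding long_unsorted_def
            proof (intro allI impI)
              fix b x assume b: "(False, b) \<in> set its'" and x: "x \<in> set b"
              then obtain xs where "(False, xs) \<in> set ?its" "set b \<subseteq> set xs"
                using q(3) by blast
              then have "x \<in> set [1..<Suc n]"
                using x by (auto simp del: upt_Suc)
              then show "x + 1 \<le> n + 1"
                by auto
            qed
            \<comment> \<open>This supplies k = floor_log n + 1 for the doubling loop started with h
              = 1.\<close>
            moreover have "n < 1 * 2 ^ (floor_log n + 1)"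
              using floor_log_exp2_gt[of n] by simp
            moreover have "2 \<le> n"
              using False by simp
            ultimately show ?thesis
              apply (intro spec_mono[OF spec_doubling_loop[OF q(1,2)]])
                 apply assumption+
              apply (elim conjE exE)
              unfolding spec_ret
              apply (intro conjI allI impI)
              subgoal by (simp add: sorting_state_def)
              subgoal using sorting_state_SA by blast
              subgoal using sorting_state_SA by blast
              subgoal for _ m5 t5
                using suffix_sort_time[of "5 * (n + 3) + t1 + 3" n "t3 + t4" "item_pot its'" "floor_log n" t5] q(4) prems(1)
                by (simp del: upt_Suc)
              done
          qed
          done
      qed
    qed
    done
qed

section \<open>Inverse suffix array and LCP array\<close>

definition suffix_array_at :: "nat \<Rightarrow> 'a mem \<Rightarrow> bool" where
  "suffix_array_at n m \<longleftrightarrow> length (inp m) = n \<and> (\<forall>i\<le>n + 1. allocated m SA i) \<and>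
     (\<forall>i. 1 \<le> i \<and> i \<le> n \<longrightarrow> 1 \<le> val m SA i \<and> val m SA i \<le> n)"

definition inverse_at :: "nat \<Rightarrow> 'a mem \<Rightarrow> bool" where
  "inverse_at n m \<longleftrightarrow> suffix_array_at n m \<and> (\<forall>i\<le>n + 1. allocated m ISA i)"

text \<open>The bound on the entries makes each of them an admissible bucket number.\<close>

definition lcp_at :: "nat \<Rightarrow> 'a mem \<Rightarrow> bool" where
  "lcp_at n m \<longleftrightarrow> inverse_at n m \<and> (\<forall>i\<le>n + 1. allocated m LCP i \<and> val m LCP i \<le> n)"

lemma suffix_array_at_mods: "suffix_array_at n m \<Longrightarrow> mods ({ISA, LCP, TREE, HEAD, NEXT} \<times> UNIV) m m' \<Longrightarrow> suffix_array_at n m'"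
  by (auto simp: suffix_array_at_def mods_inp mods_allocated mods_val)

lemma inverse_at_mods: "inverse_at n m \<Longrightarrow> mods ({ISA, LCP, TREE, HEAD, NEXT} \<times> UNIV) m m' \<Longrightarrow> inverse_at n m'"
  by (auto simp: inverse_at_def suffix_array_at_mods mods_allocated)

lemma lcp_at_mods: "lcp_at n m \<Longrightarrow> mods ({TREE, HEAD, NEXT} \<times> UNIV) m m' \<Longrightarrow> lcp_at n m'"
  using inverse_at_mods[of n m m'] mods_mono[of "{TREE, HEAD, NEXT} \<times> UNIV" m m' "{ISA, LCP, TREE, HEAD, NEXT} \<times> UNIV"]
  by (auto simp: lcp_at_def mods_allocated mods_val)

lemma spec_invert_suffix_array:
  assumes "suffix_array_at n m"
  shows "spec (invert_suffix_array n) m (\<lambda>_ m' t. inverse_at n m' \<and> t \<le> 5 * n + 6)"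
proof -
  let ?m = "new_array m ISA (n + 2)"
  have m: "inverse_at n ?m"
    using assms by (auto simp: inverse_at_def suffix_array_at_def)
  have loop: "spec (for_loop 1 n (\<lambda>i. do {x \<leftarrow> rd SA i; wr ISA x i})) ?m
    (\<lambda>_ m' t. inverse_at n m' \<and> t \<le> (2 + 2) * (Suc n - 1) + 3)"
  proof (rule spec_for_uniform[where I = "\<lambda>_. inverse_at n"])
    fix i m' assume i: "1 \<le> i" "i \<le> n" and I: "inverse_at n m'"
    then have SA: "1 \<le> val m' SA i" "val m' SA i \<le> n" "val m' SA i \<le> Suc n" "i \<le> Suc n"
      by (auto simp: inverse_at_def suffix_array_at_def le_SucI)
    have "inverse_at n (store m' ISA (val m' SA i) i)"
      by (rule inverse_at_mods[OF I]) (auto intro: mods_store)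
    then show "spec (do {x \<leftarrow> rd SA i; wr ISA x i}) m' (\<lambda>_ m'' t. inverse_at n m'' \<and> t \<le> 2)"
      using I SA by (simp add: inverse_at_def suffix_array_at_def)
  qed (use m in auto)
  show ?thesis
    unfolding invert_suffix_array_def
    apply (simp only: spec_bind spec_alloc)
    by (rule spec_mono[OF loop]) auto
qed

text \<open>The suffix array need not be correct here: the matching length never exceeds \<open>n\<close>.\<close>

lemma spec_kasai:
  assumes "inverse_at n m"
  shows "spec (kasai n) m (\<lambda>_ m' t. lcp_at n m' \<and> t \<le> 15 * n + 6)"
proof -
  let ?m = "new_array m LCP (n + 2)"
  have m: "lcp_at n ?m"
    using assms by (auto simp: lcp_at_def inverse_at_def suffix_array_at_def)
  \<comment> \<open>A successful comparison takes 2 steps with the increment and lowers 2 (n - h) by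
    2; the additive 2 is the failing test and the final \<open>ret\<close>.\<close>
  have extend: "spec (while_loop (\<lambda>h. if i + h \<le> n \<and> j + h \<le> n then sym_eq (i + h) (j + h) else ret False)
      (\<lambda>h. ret (h + 1)) h) m' (\<lambda>h' m'' t. (m'' = m' \<and> h' \<le> n) \<and> t + 2 * (n - h') \<le> 2 * (n - h) + 2)"
    if "lcp_at n m'" "1 \<le> i" "1 \<le> j" "h \<le> n" for i j h and m' :: "'a mem"
  proof (rule spec_while_amortized[where I = "\<lambda>h m''. m'' = m' \<and> h \<le> n" and \<Phi> = "\<lambda>h. 2 * (n - h)"])
    fix h m'' assume I: "m'' = m' \<and> h \<le> n"
    have "length (inp m') = n"
      using that(1) by (simp add: lcp_at_def inverse_at_def suffix_array_at_def)
    then show "spec (if i + h \<le> n \<and> j + h \<le> n then sym_eq (i + h) (j + h) else ret False) m''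
      (\<lambda>x m1 t1. if x then spec (ret (h + 1)) m1 (\<lambda>s' m2 t2. (m2 = m' \<and> s' \<le> n) \<and> 0 < t1 + t2 \<and>
        t1 + t2 + 2 * (n - s') \<le> 2 * (n - h)) else (m1 = m' \<and> h \<le> n) \<and> t1 + 1 \<le> 2)"
      using I that(2,3) by (auto simp: position_def)
  qed (use that in auto)
  have loop: "spec (while_loop (\<lambda>(i, h). ret (i \<le> n)) (\<lambda>(i, h). do {
       q \<leftarrow> rd ISA i;
       if q < n then do {
         j \<leftarrow> rd SA (q + 1);
         h' \<leftarrow> while_loop (\<lambda>h. if i + h \<le> n \<and> j + h \<le> n then sym_eq (i + h) (j + h) else ret False)
           (\<lambda>h. ret (h + 1)) h;
         wr LCP q h';
         ret (i + 1, if h' > 0 then h' - 1 else 0)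
       } else ret (i + 1, h)
     }) (1, 0)) ?m (\<lambda>_ m' t. lcp_at n m' \<and> t \<le> (\<lambda>(i, h). 12 * (Suc n - i) + 2 * (n - h) + 2) (1, 0))"
    \<comment> \<open>Continuing with h' - 1 raises 2 (n - h) by at most 2; together with the fixed
      work of a round this is covered by the 12 per index.\<close>
    apply (rule spec_while[where I = "\<lambda>(i, h) m'. 1 \<le> i \<and> h \<le> n \<and> lcp_at n m'" and Q = "\<lambda>_. lcp_at n"
      and \<Phi> = "\<lambda>(i, h). 12 * (Suc n - i) + 2 * (n - h) + 2"])
    subgoal using m by simp
    subgoal premises inv for s m'
    proof (cases s)
      case (Pair i h)
      have I: "1 \<le> i" "h \<le> n" "lcp_at n m'"
        using inv by (simp_all add: Pair)
      have ISA: "i \<le> n \<Longrightarrow> allocated m' ISA i"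
        using I(3) by (auto simp: lcp_at_def inverse_at_def)
      have SA: "q < n \<Longrightarrow> allocated m' SA (q + 1) \<and> 1 \<le> val m' SA (q + 1)" for q
        using I(3) by (auto simp: lcp_at_def inverse_at_def suffix_array_at_def)
      have upd: "allocated m' LCP q \<and> h' \<le> length (inp m') + 1 \<and> lcp_at n (store m' LCP q h')" if "q < n" "h' \<le> n" for q h'
        using I(3) that inverse_at_mods[of n m' "store m' LCP q h'"]
        by (auto simp: lcp_at_def inverse_at_def suffix_array_at_def intro: mods_store)
      show ?thesis
        unfolding Pair prod.case spec_ret
        apply (split if_split, intro conjI impI)
        subgoal premises i
          unfolding spec_bind spec_rd
          apply (intro conjI ISA i spec_ifI)
          subgoal premises q
            unfolding spec_bind spec_rd
            apply (intro conjI SA[OF q, THEN conjunct1])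
            apply (rule spec_mono[OF extend[OF I(3,1) SA[OF q, THEN conjunct2] I(2)]])
            apply (elim conjE, hypsubst)
            subgoal for h' _ t
              using upd[OF q, of h'] i I by auto
            done
          subgoal using i I by auto
          done
        subgoal using I by simp
        subgoal by simp
        done
    qed
    done
  show ?thesis
    unfolding kasai_def
    apply (simp only: spec_bind spec_alloc)
    by (rule spec_mono[OF loop]) auto
qed

section \<open>The bit tree\<close>

lemma spec_leaf_count:
  "spec (leaf_count n) m (\<lambda>N m' t. ((\<exists>K. N = 2 ^ K) \<and> n + 2 \<le> N \<and> N \<le> 2 * (n + 2) \<and> m' = m) \<and>
    t \<le> 2 * (Suc (floor_log (n + 2)) - floor_log 1) + 2)"
  unfolding leaf_count_def
proof (rule spec_while[where I = "\<lambda>k m'. (\<exists>K. k = 2 ^ K) \<and> k \<le> 2 * (n + 2) \<and> m' = m"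
    and \<Phi> = "\<lambda>k. 2 * (Suc (floor_log (n + 2)) - floor_log k) + 2"])
  fix k m' assume I: "(\<exists>K. k = 2 ^ K) \<and> k \<le> 2 * (n + 2) \<and> m' = m"
  then have "k \<noteq> 0" "\<exists>K. 2 * k = 2 ^ K"
    by (auto intro: exI[of _ "Suc _"])
  moreover have "floor_log k \<le> floor_log (n + 2)" if "k < n + 2"
    using that by (intro floor_log_le_iff) simp
  ultimately show "spec (ret (k < n + 2)) m' (\<lambda>x m1 t1. if x then spec (ret (2 * k)) m1 (\<lambda>s' m2 t2.
      ((\<exists>K. s' = 2 ^ K) \<and> s' \<le> 2 * (n + 2) \<and> m2 = m) \<and> 0 < t1 + t2 \<and>
      t1 + t2 + (2 * (Suc (floor_log (n + 2)) - floor_log s') + 2) \<le> 2 * (Suc (floor_log (n + 2)) - floor_log k) + 2)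
    else ((\<exists>K. k = 2 ^ K) \<and> n + 2 \<le> k \<and> k \<le> 2 * (n + 2) \<and> m1 = m) \<and>
      t1 + 1 \<le> 2 * (Suc (floor_log (n + 2)) - floor_log k) + 2)"
    using I by auto
qed (auto intro: exI[of _ 0])

text \<open>A 1 at an inner node promises a 1 below it, so a descent ends in a marked leaf; the last
  clause confines marked leaves to elements up to n. The upward direction, from a leaf to its
  ancestors, is stated for single elements by \<open>on_path\<close>.\<close>

definition tree_inv :: "nat \<Rightarrow> nat \<Rightarrow> 'a mem \<Rightarrow> bool" where
  "tree_inv n K m \<longleftrightarrow> (\<forall>v<2 * 2 ^ K. allocated m TREE v \<and> val m TREE v \<le> 1) \<and>
     (\<forall>v. 1 \<le> v \<and> v < 2 ^ K \<and> val m TREE v = 1 \<longrightarrow> val m TREE (2 * v) = 1 \<or> val m TREE (2 * v + 1) = 1) \<and>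
     (\<forall>u. 2 ^ K \<le> u \<and> u < 2 * 2 ^ K \<and> val m TREE u = 1 \<longrightarrow> u \<le> 2 ^ K + n)"

definition on_path :: "nat \<Rightarrow> nat \<Rightarrow> 'a mem \<Rightarrow> bool" where
  "on_path K x m \<longleftrightarrow> (\<forall>k\<le>K. val m TREE ((2 ^ K + x) div 2 ^ k) = 1)"

lemma on_path_mono:
  "on_path K x m \<Longrightarrow> (\<And>v. val m TREE v = 1 \<Longrightarrow> val m' TREE v = 1) \<Longrightarrow> on_path K x m'"
  by (auto simp: on_path_def)

lemma tree_inv_cong:
  "tree_inv n K m \<Longrightarrow> (\<And>v. val m' TREE v = val m TREE v) \<Longrightarrow>
    (\<And>v. allocated m TREE v \<Longrightarrow> allocated m' TREE v) \<Longrightarrow> tree_inv n K m'"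
  by (simp add: tree_inv_def)

lemma tree_inv_mods: "tree_inv n K m \<Longrightarrow> mods X m m' \<Longrightarrow> X \<inter> {TREE} \<times> UNIV = {} \<Longrightarrow> tree_inv n K m'"
  by (erule tree_inv_cong) (auto simp: mods_allocated intro!: mods_val)

lemma on_path_mods: "on_path K x m \<Longrightarrow> mods X m m' \<Longrightarrow> X \<inter> {TREE} \<times> UNIV = {} \<Longrightarrow> on_path K x m'"
  by (erule on_path_mono, subst mods_val) auto

section \<open>Node numbers, heights and halving\<close>

lemma floor_log_less: "v < 2 * 2 ^ K \<Longrightarrow> floor_log v \<le> K"
proof (cases "v = 0")
  case False
  assume "v < 2 * 2 ^ K"
  then have "2 ^ floor_log v < (2::nat) ^ Suc K"
    using floor_log_exp2_le[of v] False by (auto intro: order_le_less_trans)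
  then have "floor_log v < Suc K"
    by (rule power_less_imp_less_exp[rotated]) simp
  then show ?thesis
    by simp
qed simp

lemma tree_path_step: "(a :: nat) div 2 ^ k div 2 = a div 2 ^ Suc k"
  by (simp add: div_mult2_eq[symmetric] mult.commute)

lemma half_cases: "(v :: nat) = w div 2 \<Longrightarrow> w = 2 * v \<or> w = 2 * v + 1"
  by presburger

text \<open>Two nodes of one level that are not siblings keep their order when passing to the
  parents; as l is even, v = l + 1 is the only sibling case. The primed version serves the search to
  the right.\<close>

lemma half_less: "even (l :: nat) \<Longrightarrow> l < v \<Longrightarrow> v \<noteq> l + 1 \<Longrightarrow> l div 2 < v div 2"
  by presburger

lemma half_less': "(v :: nat) < r \<Longrightarrow> \<not> (even v \<and> r = v + 1) \<Longrightarrow> v div 2 < r div 2"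
  by presburger

text \<open>Marking proceeds upwards, so when an inner node receives its 1, the child on the path
  already has one; this keeps \<open>tree_inv\<close> true during the climb. The climb marks K + 1
  nodes at 3 steps each and ends at 0, one step past the root.\<close>

lemma spec_tree_insert:
  assumes "tree_inv n K m" "x \<le> n" "n < 2 ^ K"
  shows "spec (tree_insert (2 ^ K) x) m (\<lambda>_ m' t. tree_inv n K m' \<and> on_path K x m' \<and>
    mods ({TREE} \<times> UNIV) m m' \<and> (\<forall>v. val m TREE v = 1 \<longrightarrow> val m' TREE v = 1) \<and> t \<le> 3 * K + 6)"
proof -
  let ?p = "\<lambda>k. (2 ^ K + x) div 2 ^ k" and ?\<Phi> = "\<lambda>v. if v = 0 then 2 else 3 * Suc (floor_log v) + 2"
  have lt: "2 ^ K + x < 2 * 2 ^ K"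
    using assms(2,3) by simp
  have "spec (while_loop (\<lambda>v. ret (v \<ge> 1)) (\<lambda>v. do {wr TREE v 1; ret (v div 2)}) (2 ^ K + x)) m
    (\<lambda>v m' t. (v = 0 \<and> tree_inv n K m' \<and> mods ({TREE} \<times> UNIV) m m' \<and> (\<forall>v. val m TREE v = 1 \<longrightarrow> val m' TREE v = 1) \<and>
      (\<exists>k. v = ?p k \<and> (\<forall>j<k. val m' TREE (?p j) = 1))) \<and> t \<le> ?\<Phi> (2 ^ K + x))"
  proof (rule spec_while[where I = "\<lambda>v m'. tree_inv n K m' \<and> mods ({TREE} \<times> UNIV) m m' \<and>
      (\<forall>v. val m TREE v = 1 \<longrightarrow> val m' TREE v = 1) \<and> (\<exists>k. v = ?p k \<and> (\<forall>j<k. val m' TREE (?p j) = 1))"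
      and \<Phi> = ?\<Phi>])
    fix v m'
    assume I: "tree_inv n K m' \<and> mods ({TREE} \<times> UNIV) m m' \<and>
      (\<forall>v. val m TREE v = 1 \<longrightarrow> val m' TREE v = 1) \<and> (\<exists>k. v = ?p k \<and> (\<forall>j<k. val m' TREE (?p j) = 1))"
    then obtain k where k: "v = ?p k" "\<And>j. j < k \<Longrightarrow> val m' TREE (?p j) = 1"
      by blast
    have v_lt: "v < 2 * 2 ^ K"
      using lt div_le_dividend[of "2 ^ K + x" "2 ^ k"] unfolding k(1) by linarith
    let ?m = "store m' TREE v 1"
    have child: "val m' TREE (2 * v) = 1 \<or> val m' TREE (2 * v + 1) = 1" if "v < 2 ^ K"
    proof -
      have "k \<noteq> 0"
        using k(1) that by (cases k) auto
      then obtain k' where k': "k = Suc k'"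
        by (cases k) auto
      then have "?p k' = 2 * v \<or> ?p k' = 2 * v + 1"
        using tree_path_step[of "2 ^ K + x" k'] by (intro half_cases) (simp add: k(1))
      then show ?thesis
        using k(2)[of k'] k' by auto
    qed
    have leaf: "v \<le> 2 ^ K + n"
      using div_le_dividend[of "2 ^ K + x" "2 ^ k"] assms(2) unfolding k(1) by linarith
    have "tree_inv n K ?m"
      using I child leaf unfolding tree_inv_def by auto
    moreover have "mods ({TREE} \<times> UNIV) m ?m"
      using I by (auto intro: mods_trans_store)
    moreover have "v div 2 = ?p (Suc k)" "\<forall>j<Suc k. val ?m TREE (?p j) = 1"
      using k tree_path_step[of "2 ^ K + x" k] by (auto simp: less_Suc_eq)
    then have "\<exists>k. v div 2 = ?p k \<and> (\<forall>j<k. val ?m TREE (?p j) = 1)"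
      by blast
    moreover have "allocated m' TREE v"
      using I v_lt by (simp add: tree_inv_def)
    moreover have "3 + ?\<Phi> (v div 2) \<le> ?\<Phi> v" if "1 \<le> v"
      using that floor_log_rec[of v] by (cases "v = 1") auto
    ultimately show "spec (ret (v \<ge> 1)) m' (\<lambda>x m1 t1. if x then spec (do {wr TREE v 1; ret (v div 2)}) m1
      (\<lambda>s' m2 t2. (tree_inv n K m2 \<and> mods ({TREE} \<times> UNIV) m m2 \<and>
      (\<forall>v. val m TREE v = 1 \<longrightarrow> val m2 TREE v = 1) \<and> (\<exists>k. s' = ?p k \<and> (\<forall>j<k. val m2 TREE (?p j) = 1))) \<and>
        0 < t1 + t2 \<and> t1 + t2 + ?\<Phi> s' \<le> ?\<Phi> v)
      else (v = 0 \<and> tree_inv n K m1 \<and> mods ({TREE} \<times> UNIV) m m1 \<and> (\<forall>v. val m TREE v = 1 \<longrightarrow> val m1 TREE v = 1) \<and>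
      (\<exists>k. v = ?p k \<and> (\<forall>j<k. val m1 TREE (?p j) = 1))) \<and> t1 + 1 \<le> ?\<Phi> v)"
      using I by auto
  qed (use assms in \<open>auto intro: exI[of _ 0]\<close>)
  then show ?thesis
    unfolding tree_insert_def spec_bind spec_ret
  proof (rule spec_mono)
    fix v m' t
    assume post: "(v = 0 \<and> tree_inv n K m' \<and> mods ({TREE} \<times> UNIV) m m' \<and> (\<forall>v. val m TREE v = 1 \<longrightarrow> val m' TREE v = 1) \<and>
      (\<exists>k. v = ?p k \<and> (\<forall>j<k. val m' TREE (?p j) = 1))) \<and> t \<le> ?\<Phi> (2 ^ K + x)"
    then obtain k where k: "?p k = 0" "\<And>j. j < k \<Longrightarrow> val m' TREE (?p j) = 1"
      by auto
    \<comment> \<open>Reaching 0 takes more than K halvings, hence all K + 1 nodes of the path have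
      been marked.\<close>
    have "2 ^ K + x < 2 ^ k"
      using k(1) by (simp add: div_eq_0_iff)
    then have "(2::nat) ^ K < 2 ^ k"
      by linarith
    then have "K < k"
      by simp
    then have "on_path K x m'"
      using k(2) by (auto simp: on_path_def)
    then show "tree_inv n K m' \<and> on_path K x m' \<and> mods ({TREE} \<times> UNIV) m m' \<and>
      (\<forall>v. val m TREE v = 1 \<longrightarrow> val m' TREE v = 1) \<and> t + 1 \<le> 3 * K + 6"
      using post floor_log_less[OF lt] by (auto split: if_splits)
  qed
qed

text \<open>
  The leaves below node \<open>u\<close> at height \<open>j\<close> are those from \<open>u * 2 ^ j\<close> to \<open>(u + 1) * 2 ^ j - 1\<close>.
\<close>

lemma spec_descend:
  assumes tree: "tree_inv n K m" and "val m TREE u = 1" "1 \<le> u" "u < 2 * 2 ^ K"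
    and c: "\<And>u. 1 \<le> u \<Longrightarrow> u < 2 ^ K \<Longrightarrow> val m TREE u = 1 \<Longrightarrow>
      spec (c u) m (\<lambda>u' m' t. m' = m \<and> t = 2 \<and> (u' = 2 * u \<or> u' = 2 * u + 1) \<and> val m TREE u' = 1)"
    and range: "lo \<le> u * 2 ^ j" "(u + 1) * 2 ^ j \<le> hi" "2 ^ K \<le> lo" "hi \<le> 2 * 2 ^ K"
  shows "spec (while_loop (\<lambda>u. ret (u < 2 ^ K)) c u) m (\<lambda>u' m' t. (m' = m \<and> lo \<le> u' \<and> u' < hi \<and>
    val m TREE u' = 1) \<and> t \<le> 3 * (K - floor_log u) + 2)"
proof (rule spec_while[where I = "\<lambda>u m'. m' = m \<and> val m TREE u = 1 \<and> 1 \<le> u \<and> u < 2 * 2 ^ K \<and>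
    (\<exists>j. lo \<le> u * 2 ^ j \<and> (u + 1) * 2 ^ j \<le> hi)" and \<Phi> = "\<lambda>u. 3 * (K - floor_log u) + 2"])
  fix u m' assume I: "m' = m \<and> val m TREE u = 1 \<and> 1 \<le> u \<and> u < 2 * 2 ^ K \<and> (\<exists>j. lo \<le> u * 2 ^ j \<and> (u + 1) * 2 ^ j \<le> hi)"
  then obtain j where j: "lo \<le> u * 2 ^ j" "(u + 1) * 2 ^ j \<le> hi"
    by blast
  show "spec (ret (u < 2 ^ K)) m' (\<lambda>x m1 t1. if x then spec (c u) m1 (\<lambda>u' m2 t2.
      (m2 = m \<and> val m TREE u' = 1 \<and> 1 \<le> u' \<and> u' < 2 * 2 ^ K \<and> (\<exists>j. lo \<le> u' * 2 ^ j \<and> (u' + 1) * 2 ^ j \<le> hi)) \<and>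
      0 < t1 + t2 \<and> t1 + t2 + (3 * (K - floor_log u') + 2) \<le> 3 * (K - floor_log u) + 2)
    else (m1 = m \<and> lo \<le> u \<and> u < hi \<and> val m TREE u = 1) \<and> t1 + 1 \<le> 3 * (K - floor_log u) + 2)"
  proof (cases "u < 2 ^ K")
    case True
    have u: "1 \<le> u" "val m TREE u = 1" "m' = m"
      using I by blast+
    \<comment> \<open>At height 0 the node would itself be at least \<open>lo\<close>, hence at
      least 2 ^ K, and the loop would have ended.\<close>
    have "j \<noteq> 0"
      using j(1) True range(3) by (cases j) auto
    then obtain i where i: "j = Suc i"
      by (cases j) auto
    have K: "Suc (floor_log u) \<le> K"
    proof -
      have "2 ^ floor_log u \<le> u"
        using I by (intro floor_log_exp2_le) simp
      then have "(2::nat) ^ floor_log u < 2 ^ K"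
        using True by linarith
      then show ?thesis
        by simp
    qed
    show ?thesis
      apply (simp only: spec_ret True if_True u(3))
      apply (rule spec_mono[OF c[OF u(1) True u(2)]])
      subgoal premises prems for u' m2 t2
      proof -
        have "lo \<le> u' * 2 ^ i" "(u' + 1) * 2 ^ i \<le> hi"
          using prems j unfolding i by auto
        moreover have "floor_log u' = Suc (floor_log u)"
          using prems u(1) floor_log_rec[of "2 * u + 1"] by auto
        ultimately show ?thesis
          using prems K True u(1) by auto
      qed
      done
  next
    case False
    have "j = 0"
    proof (rule ccontr)
      assume "j \<noteq> 0"
      then have "(2::nat) ^ 1 \<le> 2 ^ j"
        by (intro power_increasing) auto
      then have "(u + 1) * 2 \<le> (u + 1) * 2 ^ j"
        by (intro mult_le_mono2) simp
      also have "\<dots> \<le> 2 * 2 ^ K"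
        using j(2) range(4) by (rule order_trans)
      finally show False
        using False by simp
    qed
    then show ?thesis
      using False I j by auto
  qed
qed (use assms in auto)

text \<open>
  The climb stops below the first common ancestor of the leaves of \<open>x\<close> and of a member \<open>y\<close> of the
  set.  The sibling on the side of \<open>y\<close> then lies on the path of \<open>y\<close>.
\<close>

lemma paths_meet: "x < 2 ^ K \<Longrightarrow> (2 ^ K + x) div 2 ^ K = (1 :: nat)"
  by simp

lemma tree_children:
  assumes "tree_inv n K m" "1 \<le> u" "u < 2 ^ K" "val m TREE u = 1"
  shows "allocated m TREE (2 * u) \<and> allocated m TREE (2 * u + 1) \<and>
    (val m TREE (2 * u) = 1 \<or> val m TREE (2 * u + 1) = 1)"
  using assms by (simp add: tree_inv_def)

lemma climb_measure: "v \<noteq> 0 \<Longrightarrow> v div 2 \<noteq> 0 \<Longrightarrow> 3 + 3 * floor_log (v div 2) \<le> 3 * floor_log v"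
  using floor_log_rec[of v] by (cases "v = 1") auto

text \<open>The invariant compares x with the member 0, whose ancestor at height k is the leftmost
  node 2^(K - k): the ancestor of x stays strictly to its right. This leftmost node carries a 1 and
  is even unless it is the root. So if v is a left child, or its left sibling carries 0, the two
  nodes are not siblings and the strict order passes to the parents. At the root they coincide, so
  the climb ends earlier.\<close>

lemma spec_tree_pred:
  assumes tree: "tree_inv n K m" and path: "on_path K 0 m" and x: "0 < x" "x < 2 ^ K"
  shows "spec (tree_pred (2 ^ K) x) m (\<lambda>j m' t. m' = m \<and> j < x \<and> t \<le> 6 * K + 10)"
proof -
  let ?p = "\<lambda>k. (2 ^ K + x) div 2 ^ k" and ?l = "\<lambda>k. 2 ^ K div 2 ^ k :: nat"
  have lt: "2 ^ K + x < 2 * 2 ^ K"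
    using x by simp
  have alloc: "allocated m TREE v" if "v < 2 * 2 ^ K" for v
    using tree that by (simp add: tree_inv_def)
  have climb: "spec (while_loop (\<lambda>v. if odd v then do {b \<leftarrow> rd TREE (v - 1); ret (b = 0)} else ret True)
       (\<lambda>v. ret (v div 2)) (2 ^ K + x)) m
    (\<lambda>v m' t. (m' = m \<and> odd v \<and> val m TREE (v - 1) = 1 \<and> (\<exists>k\<le>K. v = ?p k \<and> ?l k < v)) \<and>
      t \<le> 3 * floor_log (2 ^ K + x) + 3)"
  proof (rule spec_while[where I = "\<lambda>v m'. m' = m \<and> (\<exists>k\<le>K. v = ?p k \<and> ?l k < v)"
      and \<Phi> = "\<lambda>v. 3 * floor_log v + 3"])
    fix v m' assume I: "m' = m \<and> (\<exists>k\<le>K. v = ?p k \<and> ?l k < v)"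
    then obtain k where k: "k \<le> K" "v = ?p k" "?l k < v"
      by blast
    have v_lt: "v < 2 * 2 ^ K"
      using lt div_le_dividend[of "2 ^ K + x" "2 ^ k"] unfolding k(2) by linarith
    have "k \<noteq> K"
      using k(2,3) paths_meet[OF x(2)] by auto
    then have kK: "Suc k \<le> K"
      using k(1) by simp
    then have "?l k = 2 ^ (K - k)"
      by (simp add: power_diff)
    then have l: "even (?l k)" "val m TREE (?l k) = 1"
      using kK path k(1) unfolding on_path_def by (simp, metis add_0_right)
    have up: "v div 2 = ?p (Suc k)"
      unfolding k(2) by (rule tree_path_step)
    have above: "?l (Suc k) < v div 2" if "\<not> (odd v \<and> val m TREE (v - 1) \<noteq> 0)"
    proof -
      have "v \<noteq> ?l k + 1"
        using that l by auto
      then have "?l k div 2 < v div 2"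
        by (intro half_less l(1) k(3))
      then show ?thesis
        by (simp only: tree_path_step)
    qed
    have "v div 2 \<noteq> 0" if "?l (Suc k) < v div 2"
      using that by simp
    then have meas: "3 + 3 * floor_log (v div 2) \<le> 3 * floor_log v" if "?l (Suc k) < v div 2"
      using that k(3) by (intro climb_measure) auto
    have le: "val m TREE (v - 1) \<le> 1"
      using tree v_lt by (simp add: tree_inv_def)
    show "spec (if odd v then do {b \<leftarrow> rd TREE (v - 1); ret (b = 0)} else ret True) m'
      (\<lambda>x m1 t1. if x then spec (ret (v div 2)) m1 (\<lambda>v' m2 t2. (m2 = m \<and> (\<exists>k\<le>K. v' = ?p k \<and> ?l k < v')) \<and>
          0 < t1 + t2 \<and> t1 + t2 + (3 * floor_log v' + 3) \<le> 3 * floor_log v + 3)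
        else (m1 = m \<and> odd v \<and> val m TREE (v - 1) = 1 \<and> (\<exists>k\<le>K. v = ?p k \<and> ?l k < v)) \<and> t1 + 1 \<le> 3 * floor_log v + 3)"
    proof (cases "odd v \<and> val m TREE (v - 1) \<noteq> 0")
      case True
      then have "val m TREE (v - 1) = 1"
        using le by linarith
      then show ?thesis
        using True I alloc[of "v - 1"] v_lt by auto
    next
      case False
      have "\<exists>k\<le>K. v div 2 = ?p k \<and> ?l k < v div 2"
        using up above[OF False] kK by metis
      then show ?thesis
        using False I alloc[of "v - 1"] v_lt meas[OF above[OF False]] by auto
    qed
  qed (use x in \<open>auto intro: exI[of _ 0]\<close>)
  show ?thesis
    unfolding tree_pred_def
    apply (rule spec_bindI[OF climb])
    apply (elim conjE exE, hypsubst)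
    subgoal premises prems for _ _ t1 k
    proof -
      let ?u = "?p k - 1"
      have l: "?l k * 2 ^ k = 2 ^ K"
        by (rule dvd_div_mult_self) (simp add: le_imp_power_dvd prems(4))
      have "?l k * 2 ^ k \<le> ?u * 2 ^ k"
        using prems(5) by (intro mult_le_mono1) linarith
      then have lo: "2 ^ K \<le> ?u * 2 ^ k"
        unfolding l .
      \<comment> \<open>The leaves below the left sibling end where those below the ancestor of x
        begin, at or before the leaf of x; this makes the result smaller than x.\<close>
      have "?u + 1 = ?p k"
        using prems(5) by linarith
      then have hi: "(?u + 1) * 2 ^ k \<le> 2 ^ K + x"
        by (simp only: div_times_less_eq_dividend)
      have u: "1 \<le> ?u" "?u < 2 * 2 ^ K"
      proof -
        have "0 < ?l k * 2 ^ k"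
          unfolding l by simp
        then have "0 < ?l k"
          by (simp only: nat_0_less_mult_iff)
        then show "1 \<le> ?u" "?u < 2 * 2 ^ K"
          using prems(5) lt div_le_dividend[of "2 ^ K + x" "2 ^ k"] by linarith+
      qed
      show ?thesis
        apply (rule spec_bindI[OF spec_descend[OF tree prems(3) u _ lo hi]])
        subgoal for u using tree_children[OF tree, of u] by auto
        subgoal by simp
        subgoal using lt by simp
        subgoal for u' m' t'
          using prems(1) floor_log_less[OF lt] x(1) by auto
        done
    qed
    done
qed

text \<open>Mirror image with the member n: until a nonempty right sibling is met, the ancestor of x
  stays strictly to the left of the ancestor of n.\<close>

lemma spec_tree_succ:
  assumes tree: "tree_inv n K m" and path: "on_path K n m" and x: "x < n" "n < 2 ^ K"
  shows "spec (tree_succ (2 ^ K) x) m (\<lambda>j m' t. m' = m \<and> x < j \<and> j \<le> n \<and> t \<le> 6 * K + 10)"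
proof -
  let ?p = "\<lambda>k. (2 ^ K + x) div 2 ^ k" and ?r = "\<lambda>k. (2 ^ K + n) div 2 ^ k"
  have lt: "2 ^ K + x < 2 * 2 ^ K" "2 ^ K + n < 2 * 2 ^ K"
    using x by simp_all
  have alloc: "allocated m TREE v" if "v < 2 * 2 ^ K" for v
    using tree that by (simp add: tree_inv_def)
  have climb: "spec (while_loop (\<lambda>v. if even v then do {b \<leftarrow> rd TREE (v + 1); ret (b = 0)} else ret True)
       (\<lambda>v. ret (v div 2)) (2 ^ K + x)) m
    (\<lambda>v m' t. (m' = m \<and> even v \<and> val m TREE (v + 1) = 1 \<and> (\<exists>k\<le>K. v = ?p k \<and> v < ?r k)) \<and>
      t \<le> 3 * floor_log (2 ^ K + x) + 3)"
  proof (rule spec_while[where I = "\<lambda>v m'. m' = m \<and> (\<exists>k\<le>K. v = ?p k \<and> v < ?r k)"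
      and \<Phi> = "\<lambda>v. 3 * floor_log v + 3"])
    fix v m' assume I: "m' = m \<and> (\<exists>k\<le>K. v = ?p k \<and> v < ?r k)"
    then obtain k where k: "k \<le> K" "v = ?p k" "v < ?r k"
      by blast
    have v_lt: "v < 2 * 2 ^ K"
      using lt div_le_dividend[of "2 ^ K + x" "2 ^ k"] unfolding k(2) by linarith
    have "k \<noteq> K"
      using k(2,3) paths_meet[of x K] paths_meet[of n K] x by auto
    then have kK: "Suc k \<le> K"
      using k(1) by simp
    have r: "val m TREE (?r k) = 1"
      using path k(1) by (simp add: on_path_def)
    have up: "v div 2 = ?p (Suc k)"
      unfolding k(2) by (rule tree_path_step)
    have "(2::nat) ^ Suc k \<le> 2 ^ K"
      using kK by (intro power_increasing) auto
    then have "?p (Suc k) \<noteq> 0"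
      by (simp add: div_eq_0_iff)
    then have meas: "3 + 3 * floor_log (v div 2) \<le> 3 * floor_log v"
      unfolding up[symmetric] by (intro climb_measure) auto
    have above: "v div 2 < ?r (Suc k)" if "\<not> (even v \<and> val m TREE (v + 1) \<noteq> 0)"
    proof -
      have "\<not> (even v \<and> ?r k = v + 1)"
        using that r by auto
      then have "v div 2 < ?r k div 2"
        by (intro half_less' k(3))
      then show ?thesis
        by (simp only: tree_path_step)
    qed
    have v1: "even v \<Longrightarrow> v + 1 < 2 * 2 ^ K"
      using v_lt by presburger
    have le: "even v \<Longrightarrow> val m TREE (v + 1) \<le> 1"
      using tree v1 by (simp add: tree_inv_def)
    show "spec (if even v then do {b \<leftarrow> rd TREE (v + 1); ret (b = 0)} else ret True) m'
      (\<lambda>x m1 t1. if x then spec (ret (v div 2)) m1 (\<lambda>v' m2 t2. (m2 = m \<and> (\<exists>k\<le>K. v' = ?p k \<and> v' < ?r k)) \<and>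
          0 < t1 + t2 \<and> t1 + t2 + (3 * floor_log v' + 3) \<le> 3 * floor_log v + 3)
        else (m1 = m \<and> even v \<and> val m TREE (v + 1) = 1 \<and> (\<exists>k\<le>K. v = ?p k \<and> v < ?r k)) \<and> t1 + 1 \<le> 3 * floor_log v + 3)"
    proof (cases "even v \<and> val m TREE (v + 1) \<noteq> 0")
      case True
      then have "val m TREE (v + 1) = 1"
        using le by linarith
      then show ?thesis
        using True I alloc[of "v + 1"] v1 by auto
    next
      case False
      have "\<exists>k\<le>K. v div 2 = ?p k \<and> v div 2 < ?r k"
        using up above[OF False] kK by metis
      then show ?thesis
        using False I alloc[of "v + 1"] v1 meas by auto
    qed
  qed (use x in \<open>auto intro: exI[of _ 0]\<close>)
  show ?thesis
    unfolding tree_succ_def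
    apply (rule spec_bindI[OF climb])
    apply (elim conjE exE, hypsubst)
    subgoal premises prems for _ _ t1 k
    proof -
      let ?u = "?p k + 1"
      have "2 ^ K + x < ?u * 2 ^ k"
        by (simp add: dividend_less_div_times)
      then have lo: "2 ^ K + x + 1 \<le> ?u * 2 ^ k"
        by simp
      \<comment> \<open>The right sibling is at most the ancestor of n at the same height, which is
        below 2^(K - k + 1); hence its subtree does not reach past the last leaf.\<close>
      have K: "(2::nat) * 2 ^ K = 2 ^ Suc (K - k) * 2 ^ k"
        using prems(4) by (simp add: power_add[symmetric])
      then have "?r k < 2 ^ Suc (K - k)"
        using lt(2) by (simp only: less_mult_imp_div_less)
      then have "?u + 1 \<le> 2 ^ Suc (K - k)"
        using prems(5) by linarith
      then have hi: "(?u + 1) * 2 ^ k \<le> 2 * 2 ^ K"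
        unfolding K by (rule mult_le_mono1)
      have "?u + 1 \<le> 2 * 2 ^ K"
        using order_trans[OF mult_le_mono2[of 1 "2 ^ k" "?u + 1"] hi] unfolding mult_1_right by simp
      then have u: "1 \<le> ?u" "?u < 2 * 2 ^ K"
        by linarith+
      have eq: "floor_log (2 ^ K + x) \<le> K"
        by (rule floor_log_less[OF lt(1)])
      show ?thesis
        apply (rule spec_bindI[OF spec_descend[OF tree prems(3) u _ lo hi]])
        subgoal for u using tree_children[OF tree, of u] by auto
        subgoal by simp
        subgoal by simp
        subgoal premises q for u' m' t'
        proof -
          \<comment> \<open>The descent alone yields some marked leaf to the right of x; the last
            clause of \<open>tree_inv\<close> bounds it by the leaf of n.\<close>
          have "u' \<le> 2 ^ K + n"
            using q tree x by (simp add: tree_inv_def)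
          then show ?thesis
            using q prems(1) eq by auto
        qed
        done
    qed
    done
qed

section \<open>Processing the indices\<close>

definition searchable :: "nat \<Rightarrow> nat \<Rightarrow> 'a mem \<Rightarrow> bool" where
  "searchable n K m \<longleftrightarrow> lcp_at n m \<and> n < 2 ^ K \<and> tree_inv n K m \<and> on_path K 0 m \<and> on_path K n m"

lemma searchable_mods:
  assumes "searchable n K m" "mods ({HEAD, NEXT} \<times> UNIV) m m'"
  shows "searchable n K m'"
proof -
  have "mods ({TREE, HEAD, NEXT} \<times> UNIV) m m'"
    by (rule mods_mono[OF assms(2)]) auto
  then show ?thesis
    using assms lcp_at_mods[of n m m'] tree_inv_mods[OF _ assms(2), of n K] on_path_mods[OF _ assms(2), of K]
    by (auto simp: searchable_def)
qed

lemma spec_insert_searchable: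
  assumes "searchable n K m" "x \<le> n"
  shows "spec (tree_insert (2 ^ K) x) m (\<lambda>_ m' t. searchable n K m' \<and> mods ({TREE} \<times> UNIV) m m' \<and> t \<le> 3 * K + 6)"
proof -
  have "tree_inv n K m" "n < 2 ^ K"
    using assms(1) by (simp_all add: searchable_def)
  from spec_tree_insert[OF this(1) assms(2) this(2)] show ?thesis
  proof (rule spec_mono)
    fix u :: unit and m' t
    assume post: "tree_inv n K m' \<and> on_path K x m' \<and> mods ({TREE} \<times> UNIV) m m' \<and>
      (\<forall>v. val m TREE v = 1 \<longrightarrow> val m' TREE v = 1) \<and> t \<le> 3 * K + 6"
    have "lcp_at n m'"
      by (rule lcp_at_mods[of n m]) (use assms(1) post in \<open>auto simp: searchable_def elim: mods_mono\<close>)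
    moreover have "on_path K 0 m'" "on_path K n m'"
      using post assms(1) by (auto simp: searchable_def elim!: on_path_mono)
    ultimately show "searchable n K m' \<and> mods ({TREE} \<times> UNIV) m m' \<and> t \<le> 3 * K + 6"
      using post assms(1) by (auto simp: searchable_def)
  qed
qed

lemma spec_left_diverse:
  assumes "lcp_at n m" "1 \<le> a" "a \<le> n" "1 \<le> b" "b \<le> n"
  shows "spec (left_diverse a b) m (\<lambda>_ m' t. m' = m \<and> t \<le> 6)"
proof -
  have SA: "1 \<le> val m SA i \<and> val m SA i \<le> n" if "1 \<le> i" "i \<le> n" for i
    using assms(1) that by (simp add: lcp_at_def inverse_at_def suffix_array_at_def)
  have "allocated m SA a" "allocated m SA b" "length (inp m) = n" "\<And>i. i \<le> Suc n \<Longrightarrow> allocated m ISA i"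
    using assms by (auto simp: lcp_at_def inverse_at_def suffix_array_at_def)
  then show ?thesis
    using SA[OF assms(2,3)] SA[OF assms(4,5)] by (auto simp: left_diverse_def position_def)
qed

lemma spec_and_also:
  assumes "spec p m (\<lambda>_ m' t. m' = m \<and> t \<le> j)" "spec q m (\<lambda>_ m' t. m' = m \<and> t \<le> k)"
  shows "spec (and_also p q) m (\<lambda>_ m' t. m' = m \<and> t \<le> j + k + 1)"
  unfolding and_also_def
  apply (rule spec_bindI[OF assms(1)])
  apply (elim conjE, hypsubst)
  apply (rule spec_ifI)
  subgoal by (rule spec_mono[OF assms(2)]) auto
  subgoal by simp
  done

text \<open>All accesses stay in range because the neighbours found satisfy j < i < b \<le> n. The
  15 K collect two searches at 6 K and one insertion at 3 K.\<close>

lemma spec_process_index: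
  assumes "searchable n K m" "1 \<le> i" "i < n"
  shows "spec (process_index (2 ^ K) n i) m (\<lambda>_ m' t. searchable n K m' \<and> mods ({TREE} \<times> UNIV) m m' \<and> t \<le> 15 * K + 50)"
proof -
  have inv: "tree_inv n K m" "on_path K 0 m" "on_path K n m" "n < 2 ^ K"
    using assms(1) by (simp_all add: searchable_def)
  have i: "0 < i" "i < 2 ^ K" "i \<le> n"
    using assms(2,3) inv(4) by simp_all
  show ?thesis
    unfolding process_index_def
    apply (rule spec_bindI[OF spec_tree_pred[OF inv(1,2) i(1,2)]])
    apply (elim conjE, hypsubst)
    unfolding spec_bind[of "ret _"] spec_ret
    apply (rule spec_bindI[OF spec_tree_succ[OF inv(1,3) assms(3) inv(4)]])
    apply (elim conjE, hypsubst)
    apply (rule spec_bindI[OF spec_insert_searchable[OF assms(1) i(3)]])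
    apply (elim conjE)
    subgoal premises prems for j _ t1 b _ t2 _ m1 t3
    proof -
      have lcp: "lcp_at n m1"
        using prems(6) by (simp add: searchable_def)
      have LCP: "allocated m1 LCP k" if "k \<le> n" for k
        using lcp that by (simp add: lcp_at_def)
      have test: "spec (or_else (ret c) (do {x \<leftarrow> rd LCP k; ret (x \<noteq> l)})) m1 (\<lambda>_ m' t. m' = m1 \<and> t \<le> 3)" if "k \<le> n" for c k l
        using LCP[OF that] by (simp add: or_else_def)
      have diverse: "spec (left_diverse (j + 1) b) m1 (\<lambda>_ m' t. m' = m1 \<and> t \<le> 6)"
        using prems i assms by (intro spec_left_diverse[OF lcp]) auto
      have jn: "j + 1 - 1 \<le> n" "b \<le> n"
        using prems i by auto
      show ?thesis
        unfolding spec_bind[of "rd _ _"] spec_rd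
        apply (intro conjI LCP i(3))
        apply (rule spec_bindI[OF spec_and_also[OF test[OF jn(1)] spec_and_also[OF test[OF jn(2)] diverse]]])
        apply (elim conjE, hypsubst)
        apply (rule spec_ifI)
        subgoal premises q for _ _ t4
        proof (rule spec_report)
          fix m' assume m': "mods {} m1 m'"
          have "searchable n K m'"
            by (rule searchable_mods[OF prems(6)]) (use m' in \<open>auto elim: mods_mono\<close>)
          moreover have "mods ({TREE} \<times> UNIV) m m'"
            by (rule mods_comp[OF prems(7) m']) simp
          ultimately show "searchable n K m' \<and> mods ({TREE} \<times> UNIV) m m' \<and> t1 + (1 + (t2 + (t3 + (1 + (t4 + 1))))) \<le> 15 * K + 50"
            using prems q by auto
        qed
        subgoal using prems by auto
        done
    qed
    done
qed

text \<open>The indices below t have been treated. New indices are put in front of their bucket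
  while t grows, so links lead to smaller indices or to 0: every chain is finite and free of
  repetitions, and its members share one LCP value.\<close>

definition buckets_upto :: "nat \<Rightarrow> nat \<Rightarrow> 'a mem \<Rightarrow> bool" where
  "buckets_upto n t m \<longleftrightarrow> (\<forall>l\<le>n + 1. allocated m HEAD l \<and> allocated m NEXT l) \<and>
     (\<forall>l\<le>n. val m HEAD l < t \<and> (val m HEAD l \<noteq> 0 \<longrightarrow> val m LCP (val m HEAD l) = l)) \<and>
     (\<forall>s. 1 \<le> s \<and> s < t \<longrightarrow> val m NEXT s < s \<and> (val m NEXT s \<noteq> 0 \<longrightarrow> val m LCP (val m NEXT s) = val m LCP s))"

lemma buckets_upto_mods: "buckets_upto n t m \<Longrightarrow> mods ({TREE} \<times> UNIV) m m' \<Longrightarrow> buckets_upto n t m'"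
  by (auto simp: buckets_upto_def mods_allocated mods_val)

text \<open>The potential counts the indices up to t with LCP value l. The link leads to a smaller
  such index or to 0, so at least one is used up; 52 is \<open>process_index\<close> at 15 K + 50
  less its 15 K, plus the test and the reading of the link. Processing changes only
  \<open>TREE\<close>, so the chain can be described in the initial memory.\<close>

lemma spec_process_bucket:
  assumes "searchable n K m" "buckets_upto n n m" "t < n" "t \<noteq> 0 \<Longrightarrow> val m LCP t = l"
  shows "spec (while_loop (\<lambda>t. ret (t \<noteq> 0)) (\<lambda>t. do {process_index (2 ^ K) n t; rd NEXT t}) t) m
    (\<lambda>_ m' t'. (searchable n K m' \<and> mods ({TREE} \<times> UNIV) m m') \<and>
      t' \<le> (15 * K + 52) * card {s \<in> {1..t}. val m LCP s = l} + 2)"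
proof (rule spec_while[where I = "\<lambda>t m'. searchable n K m' \<and> mods ({TREE} \<times> UNIV) m m' \<and> t < n \<and> (t \<noteq> 0 \<longrightarrow> val m LCP t = l)"
    and \<Phi> = "\<lambda>t. (15 * K + 52) * card {s \<in> {1..t}. val m LCP s = l} + 2"])
  fix t m'
  assume I: "searchable n K m' \<and> mods ({TREE} \<times> UNIV) m m' \<and> t < n \<and> (t \<noteq> 0 \<longrightarrow> val m LCP t = l)"
  let ?C = "\<lambda>t. {s \<in> {1..t}. val m LCP s = l}"
  show "spec (ret (t \<noteq> 0)) m' (\<lambda>x m1 t1. if x
      then spec (do {process_index (2 ^ K) n t; rd NEXT t}) m1 (\<lambda>t' m2 t2.
        (searchable n K m2 \<and> mods ({TREE} \<times> UNIV) m m2 \<and> t' < n \<and> (t' \<noteq> 0 \<longrightarrow> val m LCP t' = l)) \<and>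
        0 < t1 + t2 \<and> t1 + t2 + ((15 * K + 52) * card (?C t') + 2) \<le> (15 * K + 52) * card (?C t) + 2)
      else (searchable n K m1 \<and> mods ({TREE} \<times> UNIV) m m1) \<and> t1 + 1 \<le> (15 * K + 52) * card (?C t) + 2)"
  proof (cases "t = 0")
    case False
    have proc: "spec (process_index (2 ^ K) n t) m' (\<lambda>_ m2 t2. searchable n K m2 \<and> mods ({TREE} \<times> UNIV) m' m2 \<and> t2 \<le> 15 * K + 50)"
      using I False by (intro spec_process_index) auto
    show ?thesis
      using False
      apply (simp only: spec_ret not_False_eq_True if_True)
      apply (rule spec_bindI[OF proc])
      apply (elim conjE)
      subgoal premises prems for _ m2 t2
      proof -
        have mods: "mods ({TREE} \<times> UNIV) m m2"
          using I prems(3) by (blast intro: mods_trans)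
        define t' where "t' = val m NEXT t"
        have t': "val m2 NEXT t = t'" "t' < t" "t' \<noteq> 0 \<longrightarrow> val m LCP t' = l" "allocated m2 NEXT t"
          using assms(2) I False by (auto simp: buckets_upto_def t'_def mods_val[OF mods] intro!: mods_allocated[OF mods])
        have "insert t (?C t') \<subseteq> ?C t"
          using t'(2) False I by auto
        then have "card (insert t (?C t')) \<le> card (?C t)"
          by (intro card_mono) auto
        then have "Suc (card (?C t')) \<le> card (?C t)"
          using t'(2) by simp
        then have "(15 * K + 52) * Suc (card (?C t')) \<le> (15 * K + 52) * card (?C t)"
          by (rule mult_le_mono2)
        then show ?thesis
          using t' prems mods I by simp
      qed
      done
  next
    case True
    then show ?thesis
      using I by simp
  qed
qed (use assms in auto)

text \<open>Bucket l is charged to the indices with LCP value exactly l, which leave the set of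
  those with value at least l on passing to l + 1; all buckets together thus draw on the n indices
  once. The value \<open>max 1 n\<close> equals \<open>Suc (n - 1)\<close>, where the filling loop
  stops, also for n = 0 with its truncated subtraction.\<close>

lemma spec_process_buckets:
  assumes "searchable n K m" "buckets_upto n t0 m" "t0 = max 1 n"
  shows "spec (for_loop 0 n (\<lambda>l. do {
       t \<leftarrow> rd HEAD l;
       _ \<leftarrow> while_loop (\<lambda>t. ret (t \<noteq> 0)) (\<lambda>t. do {process_index (2 ^ K) n t; rd NEXT t}) t;
       ret ()
     })) m (\<lambda>_ m' t. t \<le> (15 * K + 52) * n + 6 * (n + 1) + 3)"
proof -
  let ?D = "\<lambda>l. {s \<in> {1..n}. l \<le> val m LCP s}"
  have "spec (for_loop 0 n (\<lambda>l. do {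
       t \<leftarrow> rd HEAD l;
       _ \<leftarrow> while_loop (\<lambda>t. ret (t \<noteq> 0)) (\<lambda>t. do {process_index (2 ^ K) n t; rd NEXT t}) t;
       ret ()
     })) m (\<lambda>_ m' t. (searchable n K m' \<and> mods ({TREE} \<times> UNIV) m m') \<and> t \<le> (15 * K + 52) * card (?D 0) + (4 + 2) * (Suc n - 0) + 3)"
  proof (rule spec_for[where I = "\<lambda>l m'. searchable n K m' \<and> mods ({TREE} \<times> UNIV) m m'"
      and P = "\<lambda>l. (15 * K + 52) * card (?D l)"])
    fix l m' assume l: "l \<le> n" and I: "searchable n K m' \<and> mods ({TREE} \<times> UNIV) m m'"
    let ?t = "val m' HEAD l"
    have b: "buckets_upto n t0 m'"
      using buckets_upto_mods[OF assms(2)] I by blast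
    have head: "allocated m' HEAD l" "?t \<noteq> 0 \<Longrightarrow> val m' LCP ?t = l" "?t < t0"
      using b l by (auto simp: buckets_upto_def)
    let ?C = "{s \<in> {1..?t}. val m' LCP s = l}"
    have "?C \<union> ?D (Suc l) \<subseteq> ?D l"
      using head(3) I assms(3) by (auto simp: mods_val)
    then have "card (?C \<union> ?D (Suc l)) \<le> card (?D l)"
      by (intro card_mono) auto
    moreover have "card (?C \<union> ?D (Suc l)) = card ?C + card (?D (Suc l))"
      using I by (intro card_Un_disjoint) (auto simp: mods_val)
    ultimately have "(15 * K + 52) * (card ?C + card (?D (Suc l))) \<le> (15 * K + 52) * card (?D l)"
      by (intro mult_le_mono2) simp
    then have card: "(15 * K + 52) * card ?C + (15 * K + 52) * card (?D (Suc l)) \<le> (15 * K + 52) * card (?D l)"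
      by (simp only: add_mult_distrib2)
    have bucket: "spec (while_loop (\<lambda>t. ret (t \<noteq> 0)) (\<lambda>t. do {process_index (2 ^ K) n t; rd NEXT t}) ?t) m'
      (\<lambda>_ m'' t'. (searchable n K m'' \<and> mods ({TREE} \<times> UNIV) m' m'') \<and> t' \<le> (15 * K + 52) * card ?C + 2)"
    proof (cases "n = 0")
      case True
      then have "?t = 0"
        using head(3) assms(3) by simp
      then show ?thesis
        using I by (simp add: spec_while_unfold)
    next
      case False
      then have "t0 = n"
        using assms(3) by simp
      then show ?thesis
        using b head I by (intro spec_process_bucket) auto
    qed
    show "spec (do {
       t \<leftarrow> rd HEAD l;
       _ \<leftarrow> while_loop (\<lambda>t. ret (t \<noteq> 0)) (\<lambda>t. do {process_index (2 ^ K) n t; rd NEXT t}) t;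
       ret ()
     }) m' (\<lambda>_ m'' t. (searchable n K m'' \<and> mods ({TREE} \<times> UNIV) m m'') \<and>
       t + (15 * K + 52) * card (?D (Suc l)) \<le> (15 * K + 52) * card (?D l) + 4)"
      unfolding spec_bind[of "rd _ _"] spec_rd
      apply (intro conjI head(1))
      apply (rule spec_bindI[OF bucket])
      using I card by (auto intro: mods_trans)
  qed (use assms in auto)
  then show ?thesis
  proof (rule spec_mono)
    fix u :: unit and m' t
    assume "(searchable n K m' \<and> mods ({TREE} \<times> UNIV) m m') \<and> t \<le> (15 * K + 52) * card (?D 0) + (4 + 2) * (Suc n - 0) + 3"
    moreover have "?D 0 = {1..n}"
      by auto
    then have "card (?D 0) = n"
      by simp
    ultimately show "t \<le> (15 * K + 52) * n + 6 * (n + 1) + 3"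
      by simp
  qed
qed

text \<open>An index with LCP value below \<open>ml\<close> gets no link, but
  \<open>buckets_upto\<close> speaks about its \<open>NEXT\<close> entry too. Hence the invariant
  that entries not yet treated are 0.\<close>

lemma spec_fill_buckets:
  assumes "searchable n K m" "buckets_upto n 1 m" "\<And>s. s \<le> n \<Longrightarrow> val m NEXT s = 0"
  shows "spec (for_loop 1 (n - 1) (\<lambda>t. do {
       l \<leftarrow> rd LCP t;
       if l < ml then ret ()
       else do {x \<leftarrow> rd HEAD l; wr NEXT t x; wr HEAD l t}
     })) m (\<lambda>_ m' t. (searchable n K m' \<and> buckets_upto n (Suc (n - 1)) m' \<and> (\<forall>s. Suc (n - 1) \<le> s \<and> s \<le> n \<longrightarrow> val m' NEXT s = 0)) \<and>
       t \<le> (4 + 2) * (Suc (n - 1) - 1) + 3)"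
proof (rule spec_for_uniform[where I = "\<lambda>t m'. searchable n K m' \<and> buckets_upto n t m' \<and> (\<forall>s. t \<le> s \<and> s \<le> n \<longrightarrow> val m' NEXT s = 0)"])
  fix t m'
  assume t: "1 \<le> t" "t \<le> n - 1"
    and I: "searchable n K m' \<and> buckets_upto n t m' \<and> (\<forall>s. t \<le> s \<and> s \<le> n \<longrightarrow> val m' NEXT s = 0)"
  let ?l = "val m' LCP t"
  have tn: "t \<le> n"
    using t by linarith
  have lcp: "allocated m' LCP t" "?l \<le> n" "length (inp m') = n"
    using I tn by (auto simp: searchable_def lcp_at_def inverse_at_def suffix_array_at_def)
  have b: "allocated m' HEAD ?l" "allocated m' NEXT t" "val m' HEAD ?l < t"
    "val m' HEAD ?l \<noteq> 0 \<longrightarrow> val m' LCP (val m' HEAD ?l) = ?l" "val m' NEXT t = 0"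
    using I lcp(2) tn by (auto simp: buckets_upto_def)
  let ?m = "store (store m' NEXT t (val m' HEAD ?l)) HEAD ?l t"
  have "searchable n K ?m"
    by (rule searchable_mods[of n K m']) (use I in \<open>auto intro!: mods_trans_store mods_store\<close>)
  moreover have "buckets_upto n (Suc t) ?m"
    using I b unfolding buckets_upto_def by (auto simp: less_Suc_eq)
  moreover have "buckets_upto n (Suc t) m'"
    using I b t unfolding buckets_upto_def by (auto simp: less_Suc_eq)
  ultimately show "spec (do {
       l \<leftarrow> rd LCP t;
       if l < ml then ret ()
       else do {x \<leftarrow> rd HEAD l; wr NEXT t x; wr HEAD l t}
     }) m' (\<lambda>_ m'' t'. (searchable n K m'' \<and> buckets_upto n (Suc t) m'' \<and>
       (\<forall>s. Suc t \<le> s \<and> s \<le> n \<longrightarrow> val m'' NEXT s = 0)) \<and> t' \<le> 4)"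
    using I b lcp tn by auto
qed (use assms in auto)

lemma spec_insert_small:
  assumes "searchable n K m"
  shows "spec (for_loop 1 (n - 1) (\<lambda>t. do {
       l \<leftarrow> rd LCP t;
       if l < ml then tree_insert (2 ^ K) t else ret ()
     })) m (\<lambda>_ m' t. searchable n K m' \<and> t \<le> ((3 * K + 7) + 2) * (Suc (n - 1) - 1) + 3)"
proof (rule spec_for_uniform[where I = "\<lambda>_. searchable n K"])
  fix t m' assume t: "1 \<le> t" "t \<le> n - 1" and I: "searchable n K m'"
  then have tn: "t \<le> n"
    by linarith
  have lcp: "allocated m' LCP t"
    using I tn by (auto simp: searchable_def lcp_at_def)
  have "spec (tree_insert (2 ^ K) t) m' (\<lambda>_ m'' t'. searchable n K m'' \<and> 1 + t' \<le> 3 * K + 7)"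
    by (rule spec_mono[OF spec_insert_searchable[OF I tn]]) auto
  then show "spec (do {
       l \<leftarrow> rd LCP t;
       if l < ml then tree_insert (2 ^ K) t else ret ()
     }) m' (\<lambda>_ m'' t'. searchable n K m'' \<and> t' \<le> 3 * K + 7)"
    using lcp I by auto
qed (use assms in auto)

section \<open>Total running time\<close>

lemma lcp_at_new_array: "lcp_at n m \<Longrightarrow> A \<notin> {SA, ISA, LCP} \<Longrightarrow> lcp_at n (new_array m A k)"
  by (auto simp: lcp_at_def inverse_at_def suffix_array_at_def)

lemma searchable_new_array: "searchable n K m \<Longrightarrow> A \<in> {HEAD, NEXT} \<Longrightarrow> searchable n K (new_array m A k)"
  unfolding searchable_def
  by (auto simp: tree_inv_def on_path_def intro!: lcp_at_new_array)

text \<open>The offsets keep the bound positive for n = 0 and n = 1, where n ln n vanishes although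
  steps are executed; n + 2 is the size of the universe of the bit tree.\<close>

definition running_time :: "nat \<Rightarrow> nat" where
  "running_time n = 2000 * ((n + 2) * (floor_log (n + 2) + 4))"

text \<open>The times are those of the phases in program order. The products n L and K n are
  isolated as atoms, so that the rest is linear; the height of the tree enters through K \<le> L +
  1, since it has 2^K \<le> 2 (n + 2) leaves.\<close>

lemma running_time_sum:
  assumes "t1 \<le> 1400 * ((n + 2) * (floor_log n + 3))" "t2 \<le> 5 * n + 6" "t3 \<le> 15 * n + 6"
    and "t4 \<le> 2 * (Suc (floor_log (n + 2)) - floor_log 1) + 2" "2 ^ K \<le> 2 * (n + 2)"
    and "t5 \<le> 3 * K + 6" "t6 \<le> 3 * K + 6" "t7 \<le> ((3 * K + 7) + 2) * (Suc (n - 1) - 1) + 3"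
    and "t8 \<le> (4 + 2) * (Suc (n - 1) - 1) + 3" "t9 \<le> (15 * K + 52) * n + 6 * (n + 1) + 3"
  shows "1 + t1 + t2 + t3 + t4 + (2 * 2 ^ K + 1) + t5 + t6 + t7 + (n + 2 + 1) + (n + 2 + 1) + t8 + t9 \<le> running_time n"
proof -
  define L where "L = floor_log (n + 2)"
  have "floor_log (2 ^ K) \<le> floor_log (2 * (n + 2))"
    using assms(5) by (rule floor_log_le_iff)
  then have K: "K \<le> L + 1"
    by (simp add: L_def del: mult_Suc_right)
  have "floor_log n \<le> L"
    unfolding L_def by (rule floor_log_le_iff) simp
  then have "(n + 2) * (floor_log n + 3) \<le> (n + 2) * (L + 3)"
    by (intro mult_le_mono2) simp
  then have t1: "t1 \<le> 1400 * (n * L + 2 * L + 3 * n + 6)"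
    using assms(1) by (simp add: algebra_simps)
  have Kn: "K * n \<le> n * L + n"
    using mult_le_mono1[OF K, of n] by (simp add: algebra_simps)
  have "(3 * K + 9) * (Suc (n - 1) - 1) \<le> (3 * K + 9) * n"
    by (intro mult_le_mono2) simp
  then have t7: "t7 \<le> 3 * (K * n) + 9 * n + 3"
    using assms(8) by (simp add: algebra_simps)
  have t9: "t9 \<le> 15 * (K * n) + 58 * n + 9"
    using assms(10) by (simp add: algebra_simps)
  have t8: "t8 \<le> 6 * n + 3"
    using assms(9) by simp
  have t4: "t4 \<le> 2 * L + 4"
    using assms(4) by (simp add: L_def)
  have "running_time n = 2000 * (n * L) + 4000 * L + 8000 * n + 16000"
    by (simp add: running_time_def L_def algebra_simps)
  then show ?thesis
    using t1 assms(2,3) t4 assms(5-7) K Kn t7 t8 t9 by simp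
qed

lemma spec_findmaxr:
  "spec (findmaxr ml) (initial_mem w) (\<lambda>_ m' t. t \<le> running_time (length w))"
proof -
  let ?n = "length w"
  let ?m0 = "initial_mem w"
  have len: "length (inp ?m0) = ?n"
    by (simp add: initial_mem_def)
  show ?thesis
    unfolding findmaxr_def
    unfolding spec_bind[of text_length] spec_text_length len
    apply (rule spec_bindI[OF spec_suffix_sort[OF len]])
    apply (elim conjE)
    subgoal premises sorted for _ m1 t1
    proof -
      have sa: "suffix_array_at ?n m1"
        using sorted(1,2) by (simp add: suffix_array_at_def suffix_sort_arrays_def)
      show ?thesis
        apply (rule spec_bindI[OF spec_invert_suffix_array[OF sa]])
        apply (elim conjE)
        apply (rule spec_bindI[OF spec_kasai])
         apply assumption
        apply (elim conjE)
        apply (rule spec_bindI[OF spec_leaf_count])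
        apply (elim conjE exE, hypsubst)
        subgoal premises prems for _ m2 t2 _ m3 t3 _ _ t4 K
        proof -
          let ?m4 = "new_array m3 TREE (2 * 2 ^ K)"
          have lcp: "lcp_at ?n ?m4"
            using prems by (intro lcp_at_new_array) simp_all
          \<comment> \<open>All bits are still 0, so the clauses about nodes with a 1 hold
            vacuously.\<close>
          have tree: "tree_inv ?n K ?m4"
            by (auto simp: tree_inv_def)
          have K: "?n < 2 ^ K"
            using prems by simp
          show ?thesis
            unfolding spec_bind[of "alloc _ _"] spec_alloc
            apply (rule spec_bindI[OF spec_tree_insert[OF tree _ K]])
             apply simp
            apply (elim conjE)
            subgoal premises ins for _ m5 t5
            proof -
              have lcp5: "lcp_at ?n m5"
                by (rule lcp_at_mods[OF lcp mods_mono[OF ins(3)]]) auto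
              show ?thesis
                apply (rule spec_bindI[OF spec_tree_insert[OF ins(1) _ K]])
                 apply simp
                apply (elim conjE)
                subgoal premises ins2 for _ m6 t6
                proof -
                  have "lcp_at ?n m6"
                    by (rule lcp_at_mods[OF lcp5 mods_mono[OF ins2(3)]]) auto
                  moreover have "on_path K 0 m6"
                    by (rule on_path_mono[OF ins(2)]) (use ins2(4) in blast)
                  ultimately have "searchable ?n K m6"
                    using ins2 K by (simp add: searchable_def)
                  then show ?thesis
                    apply (intro spec_bindI[OF spec_insert_small])
                     apply assumption
                    apply (elim conjE)
                    subgoal premises small for _ m7 t7
                    proof -
                      let ?m8 = "new_array (new_array m7 HEAD (?n + 2)) NEXT (?n + 2)"
                      have s8: "searchable ?n K ?m8"
                        using small(2) by (intro searchable_new_array) simp_all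
                      have b8: "buckets_upto ?n 1 ?m8"
                        by (simp add: buckets_upto_def)
                      show ?thesis
                        unfolding spec_bind[of "alloc _ _"] spec_alloc
                        apply (rule spec_bindI[OF spec_fill_buckets[OF s8 b8]])
                         apply simp
                        apply (elim conjE)
                        apply (rule spec_mono[OF spec_process_buckets])
                           apply assumption
                          apply assumption
                         apply simp
                        subgoal premises last for _ _ t8 _ _ t9
                          using running_time_sum[of t1 ?n t2 t3 t4 K t5 t6 t7 t8 t9]
                            sorted prems ins ins2 small last by (simp add: add.assoc)
                        done
                    qed
                    done
                qed
                done
            qed
            done
        qed
        done
    qed
    done
qed

text \<open>For n \<ge> 2, n + 2 \<le> 2 n gives the factor 2. From n + 2 \<le> n^2 the logarithm is
  at most 2 ln n / ln 2, and the summand 4 is at most 4 ln n / ln 2, together the factor 6.\<close>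

lemma running_time_bigo: "(\<lambda>n. real (running_time n)) \<in> O(\<lambda>n. real n * ln (real n))"
proof (rule bigoI[of _ "2000 * (2 * (6 / ln 2))"])
  show "\<forall>\<^sub>F n in sequentially. norm (real (running_time n)) \<le> 2000 * (2 * (6 / ln 2)) * norm (real n * ln (real n))"
    using eventually_ge_at_top[of 2]
  proof eventually_elim
    case (elim n)
    have ln2: "0 < ln (2 :: real)" "ln 2 \<le> ln (real n)"
      using elim by simp_all
    have "real (floor_log (n + 2)) \<le> log 2 (real (n + 2))"
      by (simp add: floor_log_altdef del: of_nat_add)
    also have "\<dots> \<le> log 2 (real n ^ 2)"
    proof -
      have "n + 2 \<le> n * n"
        using elim mult_le_mono1[of 2 n n] by linarith
      then have "real (n + 2) \<le> real n ^ 2"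
        unfolding power2_eq_square of_nat_mult[symmetric] of_nat_le_iff .
      then show ?thesis
        by (intro log_mono) simp_all
    qed
    also have "\<dots> = 2 * (ln (real n) / ln 2)"
      using elim by (simp add: log_def ln_realpow)
    finally have "real (floor_log (n + 2)) \<le> 2 * (ln (real n) / ln 2)" .
    moreover have "1 \<le> ln (real n) / ln 2"
      using ln2 by (simp add: le_divide_eq)
    ultimately have "real (floor_log (n + 2) + 4) \<le> 6 * (ln (real n) / ln 2)"
      unfolding of_nat_add[of "floor_log (n + 2)"] of_nat_numeral by linarith
    moreover have "real (n + 2) \<le> 2 * real n"
      using elim by simp
    ultimately have "real (n + 2) * real (floor_log (n + 2) + 4) \<le> (2 * real n) * (6 * (ln (real n) / ln 2))"
      by (intro mult_mono) simp_all
    then have "real (running_time n) \<le> 2000 * ((2 * real n) * (6 * (ln (real n) / ln 2)))"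
      unfolding running_time_def of_nat_mult of_nat_numeral by (rule mult_left_mono) simp
    moreover have "0 \<le> real n * ln (real n)"
      using elim by simp
    ultimately show ?case
      by (simp add: abs_of_nonneg field_simps)
  qed
qed

theorem theorem4:
  "\<exists>T :: nat \<Rightarrow> nat.
     (\<lambda>n. real (T n)) \<in> O(\<lambda>n. real n * ln (real n)) \<and>
     (\<forall>(w :: 'a::linorder list) (ml :: nat). ml \<ge> 1 \<longrightarrow>
        (\<exists>t. halts_after (findmaxr ml) (initial_mem w) t \<and> t \<le> T (length w)))"
proof (intro exI[of _ running_time] conjI allI impI)
  show "(\<lambda>n. real (running_time n)) \<in> O(\<lambda>n. real n * ln (real n))"
    by (rule running_time_bigo)
next
  fix w :: "'a list" and ml :: nat
  show "\<exists>t. halts_after (findmaxr ml) (initial_mem w) t \<and> t \<le> running_time (length w)"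
    using spec_findmaxr[of ml w] by (auto simp: spec_def halts_after_def)
qed

end
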